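(* Let $\Delta$ be a shellable $(d-1)$-dimensional simplicial complex and let $k$ be an infinite field. Then the barycentric subdivision $\mathrm{sd}(\Delta)$ is almost strong Lefschetz over $k$. That is, there exist a maximal linear system of parameters $\Theta$ of $k[\mathrm{sd}(\Delta)]$ and a linear form $\omega$ such that multiplication $$\omega^{d-1-2i}:(k[\mathrm{sd}(\Delta)]/\Theta)_i\to (k[\mathrm{sd}(\Delta)]/\Theta)_{d-1-i}$$ is injective for all $0\le i\le \lfloor (d-2)/2\rfloor$.
   Context: For a simplicial complex $\Gamma$ on vertex set $[n]$ and a field $k$, $k[\Gamma]=A/I_\Gamma$ is the Stanley–Reisner (face) ring, where $A=k[x_1,\dots,x_n]$ is graded by degree and $I_\Gamma$ is generated by the monomials whose support is not a face of $\Gamma$. An l.s.o.p. is a homogeneous system of parameters consisting of degree-one elements; a maximal l.s.o.p. $\Theta$ has $\dim\Gamma+1$ elements. For an integer $s$, a degree-one element $\omega\in A_1$ is an $s$-Lefschetz element for $k[\Gamma]/\Theta$ if multiplication $\omega^{s-2i}:(k[\Gamma]/\Theta)_i\to(k[\Gamma]/\Theta)_{s-i}$ is injective for all $0\le i\le\lfloor (s-1)/2\rfloor$. $\Gamma$ is $s$-Lefschetz over $k$ if there exists a pair $(\Theta,\omega)$ with $\Theta$ a maximal l.s.o.p. of $k[\Gamma]$ and $\omega$ an $s$-Lefschetz element for $k[\Gamma]/\Theta$; $\Gamma$ is almost strong Lefschetz over $k$ if it is $(\dim\Gamma)$-Lefschetz over $k$. The barycentric subdivision $\mathrm{sd}(\Delta)$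 is the simplicial complex whose vertices are the nonempty faces of $\Delta$ and whose faces are the chains $F_0\subsetneq F_1\subsetneq\dots\subsetneq F_r$ of nonempty faces; it has the same dimension $d-1$ as $\Delta$. A pure simplicial complex is shellable if it is a simplex or its facets admit an ordering $F_1,\dots,F_m$ such that for each $2\le i\le m$, $\langle F_i\rangle\cap\langle F_1,\dots,F_{i-1}\rangle$ is generated by a nonempty set of maximal proper faces of $F_i$ (here $\langle G_1,\dots,G_t\rangle$ denotes the complex of all subsets of the $G_j$). *)

theory Defs
  imports Main "HOL-Library.Poly_Mapping"
begin

definition simplicial_complex :: "'v set set \<Rightarrow> bool" where
  "simplicial_complex \<Gamma> \<longleftrightarrow> finite \<Gamma> \<and> \<Gamma> \<noteq> {} \<and> (\<forall>F\<in>\<Gamma>. finite F) \<and>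
     (\<forall>F\<in>\<Gamma>. \<forall>G. G \<subseteq> F \<longrightarrow> G \<in> \<Gamma>)"

definition sc_dim :: "'v set set \<Rightarrow> int" where
  "sc_dim \<Gamma> = int (Max (card ` \<Gamma>)) - 1"

definition facets :: "'v set set \<Rightarrow> 'v set set" where
  "facets \<Gamma> = {F \<in> \<Gamma>. \<forall>G\<in>\<Gamma>. F \<subseteq> G \<longrightarrow> G = F}"

definition pure :: "'v set set \<Rightarrow> bool" where
  "pure \<Gamma> \<longleftrightarrow> (\<forall>F\<in>facets \<Gamma>. \<forall>G\<in>facets \<Gamma>. card F = card G)"

definition gen_complex :: "'v set set \<Rightarrow> 'v set set" where
  "gen_complex Fs = (\<Union>F\<in>Fs. Pow F)"

definition shellable :: "'v set set \<Rightarrow> bool" where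
  "shellable \<Delta> \<longleftrightarrow> pure \<Delta> \<and>
     ((\<exists>F. finite F \<and> \<Delta> = Pow F) \<or>
      (\<exists>Fs. distinct Fs \<and> set Fs = facets \<Delta> \<and>
         (\<forall>i. 1 \<le> i \<and> i < length Fs \<longrightarrow>
            (\<exists>\<G>. \<G> \<noteq> {} \<and> (\<forall>G\<in>\<G>. G \<subseteq> Fs ! i \<and> card G + 1 = card (Fs ! i)) \<and>
                 gen_complex {Fs ! i} \<inter> gen_complex (set (take i Fs)) = gen_complex \<G>))))"

definition sd :: "'v set set \<Rightarrow> 'v set set set" where
  "sd \<Delta> = {C. C \<subseteq> \<Delta> - {{}} \<and> (\<forall>F\<in>C. \<forall>G\<in>C. F \<subseteq> G \<or> G \<subseteq> F)}"

type_synonym ('v, 'k) poly = "('v \<Rightarrow>\<^sub>0 nat) \<Rightarrow>\<^sub>0 'k"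

definition mon_deg :: "('v \<Rightarrow>\<^sub>0 nat) \<Rightarrow> nat" where
  "mon_deg m = (\<Sum>v\<in>Poly_Mapping.keys m. Poly_Mapping.lookup m v)"

definition homogeneous_of :: "nat \<Rightarrow> ('v, 'k::zero) poly \<Rightarrow> bool" where
  "homogeneous_of i f \<longleftrightarrow> (\<forall>m\<in>Poly_Mapping.keys f. mon_deg m = i)"

definition const :: "'k::zero \<Rightarrow> ('v, 'k) poly" where
  "const c = Poly_Mapping.single 0 c"

definition ideal_gen :: "'a::comm_ring_1 set \<Rightarrow> 'a set" where
  "ideal_gen S = {(\<Sum>s\<in>T. c s * s) | T c. finite T \<and> T \<subseteq> S}"

text \<open>Stanley--Reisner ideal: generated by the monomials whose support is
  not a face.  (Variables not belonging to any face lie in it, so A/I is the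
  face ring of the complex.)\<close>
definition SR_ideal :: "'v set set \<Rightarrow> ('v, 'k::comm_ring_1) poly set" where
  "SR_ideal \<Gamma> = ideal_gen {Poly_Mapping.single m 1 | m. Poly_Mapping.keys m \<notin> \<Gamma>}"

definition SR_Theta_ideal :: "'v set set \<Rightarrow> ('v, 'k::comm_ring_1) poly list \<Rightarrow> ('v, 'k) poly set" where
  "SR_Theta_ideal \<Gamma> \<Theta> = ideal_gen ({Poly_Mapping.single m 1 | m. Poly_Mapping.keys m \<notin> \<Gamma>} \<union> set \<Theta>)"

definition max_lsop :: "'v set set \<Rightarrow> ('v, 'k::field) poly list \<Rightarrow> bool" where
  "max_lsop \<Gamma> \<Theta> \<longleftrightarrow> int (length \<Theta>) = sc_dim \<Gamma> + 1 \<and>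
     (\<forall>\<theta>\<in>set \<Theta>. homogeneous_of 1 \<theta>) \<and>
     (\<exists>B. finite B \<and> (\<forall>f. \<exists>c. f - (\<Sum>b\<in>B. const (c b) * b) \<in> SR_Theta_ideal \<Gamma> \<Theta>))"

definition lefschetz_element :: "int \<Rightarrow> 'v set set \<Rightarrow> ('v, 'k::field) poly list \<Rightarrow> ('v, 'k) poly \<Rightarrow> bool" where
  "lefschetz_element s \<Gamma> \<Theta> \<omega> \<longleftrightarrow> homogeneous_of 1 \<omega> \<and>
     (\<forall>i::nat. int i \<le> (s - 1) div 2 \<longrightarrow>
        (\<forall>f. homogeneous_of i f \<longrightarrow>
           \<omega> ^ nat (s - 2 * int i) * f \<in> SR_Theta_ideal \<Gamma> \<Theta> \<longrightarrow> f \<in> SR_Theta_ideal \<Gamma> \<Theta>))"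

definition s_lefschetz :: "'k::field itself \<Rightarrow> int \<Rightarrow> 'v set set \<Rightarrow> bool" where
  "s_lefschetz _ s \<Gamma> \<longleftrightarrow>
     (\<exists>(\<Theta>::('v,'k) poly list) \<omega>. max_lsop \<Gamma> \<Theta> \<and> lefschetz_element s \<Gamma> \<Theta> \<omega>)"

definition almost_strong_lefschetz :: "'k::field itself \<Rightarrow> 'v set set \<Rightarrow> bool" where
  "almost_strong_lefschetz K \<Gamma> \<longleftrightarrow> s_lefschetz K (sc_dim \<Gamma>) \<Gamma>"

end

theory Submission
  imports Defs "HOL-Computational_Algebra.Polynomial"
begin

text \<open>The class of complexes admitting good parameters \<open>\<theta>\<close> and a good form \<open>\<omega>\<close> is built up by three
  constructions. (1) Glueing: if \<open>\<Gamma> = \<Gamma>\<^sub>1 \<union> \<Gamma>\<^sub>2\<close> and \<open>\<Gamma>\<^sub>1 \<inter> \<Gamma>\<^sub>2\<close> is good in one dimension less, with the last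
  parameter as its Lefschetz form, then the low degree part of the Artinian reduction of \<open>\<Gamma>\<close> embeds into the
  sum of those of \<open>\<Gamma>\<^sub>1\<close> and \<open>\<Gamma>\<^sub>2\<close>; this handles the shelling. (2) Subdividing an edge of a flag complex
  turns the face ring \<open>A\<close> into \<open>A \<oplus> x\<^sub>b B\<close>, where \<open>B\<close> is the face ring of the star of the edge, as modules over \<open>A\<close>;
  so the \<open>s\<close>-Lefschetz property follows from that of \<open>A\<close> and the \<open>(s - 2)\<close>-Lefschetz property of \<open>B\<close>. (3) If the
  star is the whole complex, the subdivision is a cone over a suspension and the \<open>(s - 1)\<close>-Lefschetz
  property of \<open>A\<close> is enough, the form \<open>x\<^sub>c - r x\<^sub>a\<close> being a witness when \<open>r\<close> is not a root of unity of small order.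

  The subdivision of a simplex on \<open>E\<close> arises from the join of a point \<open>{i}\<close> with the subdivision of \<open>E - {i}\<close>
  by subdividing the edges joining \<open>{i}\<close> to \<open>F\<close>, for \<open>F\<close> decreasing; the first of these steps is of type (3), and
  the stars met in the later ones are joins of smaller subdivided simplices. Different complexes can be
  given common parameters because goodness persists at almost all points of every line through a good point.\<close>

section \<open>Forms and graded pieces of ideals\<close>

text \<open>The field is merely infinite, so joins cannot be treated as tensor products of Lefschetz
  algebras: in characteristic 2 every linear form of k[x,y]/(x^2,y^2) has square zero. The induction
  therefore runs over all joins of subdivided simplices at once. Its measure \<open>excess\<close>
  is the expected value of s: the h-vector of a subdivided simplex on n vertices consists of
  Eulerian numbers and is symmetric of degree n - 1, and these degrees add under joins. The losses s
  - 1 in (3) and s - 2 in (2) are exactly the drops of \<open>excess\<close> for the complexes that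
  occur there, while the number of parameters never changes. For the shelling, a simplex with d
  vertices has s = d - 1, and each intersection has s = d - 2. This is just enough for the last
  parameter to be injective on the reduced intersection in the low degrees where glueing needs it.
  The top degree \<open>w\<close> is recorded apart from s, because a shellable complex may be a
  sphere and then has a nonzero piece in degree d. Everything is phrased with membership in graded
  pieces of ideals instead of quotient modules, so that one polynomial ring serves all
  complexes.\<close>

abbreviation lookup where "lookup \<equiv> Poly_Mapping.lookup"
abbreviation keys where "keys \<equiv> Poly_Mapping.keys"
abbreviation single where "single \<equiv> Poly_Mapping.single"

type_synonym ('w, 'k) mpoly = "('w, 'k) Defs.poly"

definition var :: "'w \<Rightarrow> ('w, 'k::field) mpoly" where
  "var v = single (single v 1) 1"

lemma keys_plus_nat: "keys (m + n :: 'w \<Rightarrow>\<^sub>0 nat) = keys m \<union> keys n"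
  by (auto simp: in_keys_iff lookup_add)

lemma mon_deg_superset:
  assumes "finite S" "keys m \<subseteq> S" shows "mon_deg m = (\<Sum>v\<in>S. lookup m v)"
  unfolding mon_deg_def
  by (rule sum.mono_neutral_left) (use assms in \<open>auto simp: in_keys_iff\<close>)

lemma mon_deg_add: "mon_deg (m + n) = mon_deg m + mon_deg n"
proof -
  have "mon_deg (m + n) = (\<Sum>v\<in>keys m \<union> keys n. lookup (m + n) v)"
    by (rule mon_deg_superset) (auto simp: keys_plus_nat)
  also have "\<dots> = (\<Sum>v\<in>keys m \<union> keys n. lookup m v) + (\<Sum>v\<in>keys m \<union> keys n. lookup n v)"
    by (simp add: lookup_add sum.distrib)
  also have "\<dots> = mon_deg m + mon_deg n"
    using mon_deg_superset[of "keys m \<union> keys n" m] mon_deg_superset[of "keys m \<union> keys n" n] by simp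
  finally show ?thesis .
qed

lemma mon_deg_single [simp]: "mon_deg (single v n) = n"
  by (simp add: mon_deg_def)

lemma mon_deg_eq_0_iff: "mon_deg m = 0 \<longleftrightarrow> m = 0"
proof
  assume "mon_deg m = 0"
  then have "v \<notin> keys m" for v by (auto simp: mon_deg_def in_keys_iff)
  then show "m = 0" by (intro poly_mapping_eqI) (simp add: in_keys_iff)
qed (simp add: mon_deg_def)

lemma const_simps [simp]: "const 0 = 0" "const 1 = 1"
  by (simp_all add: const_def)

lemma const_add: "const (a + b) = (const a + const b :: ('w, 'k::field) mpoly)"
  by (simp add: const_def single_add)

lemma const_diff: "const (a - b) = (const a - const b :: ('w, 'k::field) mpoly)"
  by (simp add: const_def single_diff)

lemma const_mult: "const (a * b) = (const a * const b :: ('w, 'k::field) mpoly)"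
  by (simp add: const_def mult_single)

lemma lookup_const_mult: "lookup (const c * f :: ('w, 'k::field) mpoly) m = c * lookup f m"
proof -
  have "const c * f = Poly_Mapping.map ((*) c) f"
    by (simp add: const_def mult_map_scale_conv_mult)
  then show ?thesis by (simp add: map.rep_eq when_def)
qed

lemma keys_const_mult: "keys (const c * f :: ('w, 'k::field) mpoly) \<subseteq> keys f"
  by (auto simp: in_keys_iff lookup_const_mult)

lemma poly_expand: "f = (\<Sum>m\<in>keys f. single m (lookup f m))"
proof (rule poly_mapping_eqI)
  fix k
  show "lookup f k = lookup (\<Sum>m\<in>keys f. single m (lookup f m)) k"
    by (simp add: lookup_sum lookup_single when_def in_keys_iff)
qed

lemma single_split: "single m c = const c * (single m 1 :: ('w, 'k::field) mpoly)"
  by (simp add: const_def mult_single)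

text \<open>Only monomials of the fixed \<open>h\<close> are offered in the step, so whatever is
  known about the support of \<open>h\<close> can be used for each term. Statements about monomial
  ideals reduce to single terms in this way.\<close>

lemma poly_mapping_sum_induct [case_names zero add]:
  assumes "P 0" "\<And>m c f. m \<in> keys h \<Longrightarrow> P f \<Longrightarrow> P (single m c + f)"
  shows "P (h :: ('w, 'k::field) mpoly)"
proof -
  have "P (\<Sum>m\<in>S. single m (lookup h m))" if "finite S" "S \<subseteq> keys h" for S
    using that by (induction S rule: finite_induct) (auto intro: assms)
  from this[of "keys h"] show ?thesis using poly_expand[of h] by simp
qed

text \<open>Degrees are integers, so that the pieces of negative degree vanish without case distinctions.\<close>

definition forms :: "'w set \<Rightarrow> int \<Rightarrow> ('w, 'k::field) mpoly set" where
  "forms V i = {f. \<forall>m\<in>keys f. keys m \<subseteq> V \<and> int (mon_deg m) = i}"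

text \<open>The nonface ideal is a monomial ideal, so membership is decided by the supports of the
  terms and no generators have to be named.\<close>

definition SR :: "'w set \<Rightarrow> 'w set set \<Rightarrow> int \<Rightarrow> ('w, 'k::field) mpoly set" where
  "SR V \<Gamma> i = {f \<in> forms V i. \<forall>m\<in>keys f. keys m \<notin> \<Gamma>}"

text \<open>The degree \<open>i\<close> piece of the ideal generated by the nonfaces and \<open>\<theta> 0, \<dots>, \<theta> (j - 1)\<close>.\<close>

fun SRT :: "'w set \<Rightarrow> 'w set set \<Rightarrow> (nat \<Rightarrow> ('w, 'k::field) mpoly) \<Rightarrow> nat \<Rightarrow> int \<Rightarrow> ('w, 'k) mpoly set" where
  "SRT V \<Gamma> \<theta> 0 i = SR V \<Gamma> i"
| "SRT V \<Gamma> \<theta> (Suc j) i = {e + \<theta> j * p | e p. e \<in> SRT V \<Gamma> \<theta> j i \<and> p \<in> forms V (i - 1)}"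

lemma forms_zero [simp]: "0 \<in> forms V i" by (simp add: forms_def)
lemma forms_add: "f \<in> forms V i \<Longrightarrow> g \<in> forms V i \<Longrightarrow> f + g \<in> forms V i"
  using keys_add[of f g] by (auto simp: forms_def)
lemma forms_const_mult: "f \<in> forms V i \<Longrightarrow> const c * f \<in> forms V i"
  using keys_const_mult[of c f] by (auto simp: forms_def)
lemma minus_const: "- f = const (- 1) * (f :: ('w, 'k::field) mpoly)"
  by (rule poly_mapping_eqI) (simp add: lookup_const_mult)
lemma forms_minus: "f \<in> forms V i \<Longrightarrow> - f \<in> forms V i"
  by (metis minus_const forms_const_mult)
lemma forms_diff: "f \<in> forms V i \<Longrightarrow> g \<in> forms V i \<Longrightarrow> f - g \<in> forms V i"
  using forms_add[of f V i "- g"] forms_minus[of g] by simp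
lemma keys_mult': "m \<in> keys (f * g :: ('w, 'k::field) mpoly) \<Longrightarrow> \<exists>a b. a \<in> keys f \<and> b \<in> keys g \<and> m = a + b"
  using keys_mult[of f g] by blast
lemma forms_mult: "f \<in> forms V i \<Longrightarrow> g \<in> forms V k \<Longrightarrow> f * g \<in> forms V (i + k)"
proof -
  assume f: "f \<in> forms V i" and g: "g \<in> forms V k"
  have "keys m \<subseteq> V \<and> int (mon_deg m) = i + k" if m: "m \<in> keys (f * g)" for m
  proof -
    obtain a b where ab: "a \<in> keys f" "b \<in> keys g" "m = a + b" using keys_mult'[OF m] by blast
    then have "keys a \<subseteq> V" "int (mon_deg a) = i" "keys b \<subseteq> V" "int (mon_deg b) = k"
      using f g by (auto simp: forms_def)
    then show ?thesis by (simp add: ab(3) keys_plus_nat mon_deg_add)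
  qed
  then show "f * g \<in> forms V (i + k)" by (simp add: forms_def)
qed
lemma forms_const [simp]: "const c \<in> forms V 0"
  by (simp add: forms_def const_def mon_deg_def)
lemma forms_one [simp]: "1 \<in> forms V 0"
  using forms_const[of 1 V] by simp
lemma forms_power: "f \<in> forms V i \<Longrightarrow> f ^ n \<in> forms V (int n * i)"
proof (induction n)
  case (Suc n)
  then show ?case using forms_mult[of f V i "f ^ n" "int n * i"] by (simp add: algebra_simps)
qed simp
lemma forms_var [simp]: "v \<in> V \<Longrightarrow> var v \<in> forms V 1"
  by (simp add: forms_def var_def)
lemma forms_neg: "i < 0 \<Longrightarrow> f \<in> forms V i \<Longrightarrow> f = 0"
proof -
  assume "i < 0" "f \<in> forms V i"
  then have "m \<notin> keys f" for m by (auto simp: forms_def)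
  then show "f = 0" by (intro poly_mapping_eqI) (simp add: in_keys_iff)
qed

lemma forms_0_const: assumes "f \<in> forms V 0" shows "\<exists>c. f = const c"
proof -
  have "f = const (lookup f 0)"
  proof (rule poly_mapping_eqI)
    fix m
    show "lookup f m = lookup (const (lookup f 0)) m"
    proof (cases "m = 0")
      case False
      then have "m \<notin> keys f" using assms mon_deg_eq_0_iff[of m] by (auto simp: forms_def)
      then show ?thesis using False by (simp add: const_def lookup_single in_keys_iff when_def)
    qed (simp add: const_def)
  qed
  then show ?thesis by blast
qed

text \<open>Every term of positive degree has a variable to split off; \<open>i \<ge> 0\<close> is
  what makes the degree \<open>i + 1\<close> positive.\<close>

lemma forms_step_induct [consumes 2, case_names zero add mult]:
  assumes f: "f \<in> forms V (i + 1)" and i: "i \<ge> 0"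
    and "P 0" and add: "\<And>f g. P f \<Longrightarrow> P g \<Longrightarrow> P (f + g)"
    and mul: "\<And>v g. v \<in> V \<Longrightarrow> g \<in> forms V i \<Longrightarrow> P (var v * g)"
  shows "P (f :: ('w, 'k::field) mpoly)"
proof (induction rule: poly_mapping_sum_induct[of P f])
  case zero show ?case by fact
next
  case (add m c g)
  have m: "keys m \<subseteq> V" "int (mon_deg m) = i + 1" using f add by (auto simp: forms_def)
  then have "m \<noteq> 0" using i mon_deg_eq_0_iff[of m] by auto
  then obtain v where v: "v \<in> keys m" by (metis all_not_in_conv keys_eq_empty)
  define n where "n = m - single v 1"
  have mn: "m = single v 1 + n"
    using v by (intro poly_mapping_eqI) (auto simp: n_def lookup_add lookup_minus lookup_single when_def in_keys_iff)
  have "mon_deg m = 1 + mon_deg n" unfolding mn mon_deg_add by simp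
  moreover have "keys n \<subseteq> V" using m(1) unfolding mn keys_plus_nat by auto
  ultimately have "single n c \<in> forms V i" using m by (simp add: forms_def)
  from mul[OF _ this] v m have "P (var v * single n c)" by auto
  then have "P (single m c)" by (simp add: var_def mult_single mn)
  then show ?case using add assms(4) by blast
qed

lemma SR_forms: "f \<in> SR V \<Gamma> i \<Longrightarrow> f \<in> forms V i" by (simp add: SR_def)
lemma SR_zero [simp]: "0 \<in> SR V \<Gamma> i" by (simp add: SR_def)
lemma SR_add: "f \<in> SR V \<Gamma> i \<Longrightarrow> g \<in> SR V \<Gamma> i \<Longrightarrow> f + g \<in> SR V \<Gamma> i"
  using keys_add[of f g] by (auto simp: SR_def forms_add)
lemma SR_const_mult: "f \<in> SR V \<Gamma> i \<Longrightarrow> const c * f \<in> SR V \<Gamma> i"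
  using keys_const_mult[of c f] by (auto simp: SR_def forms_const_mult)

definition down_closed :: "'w set set \<Rightarrow> bool" where
  "down_closed \<Gamma> \<longleftrightarrow> (\<forall>F\<in>\<Gamma>. \<forall>G. G \<subseteq> F \<longrightarrow> G \<in> \<Gamma>)"

lemma SR_mult:
  assumes "down_closed \<Gamma>" "f \<in> forms V k" "g \<in> SR V \<Gamma> i"
  shows "f * g \<in> SR V \<Gamma> (k + i)"
proof -
  have "keys m \<notin> \<Gamma>" if m: "m \<in> keys (f * g)" for m
  proof -
    obtain a b where "b \<in> keys g" "m = a + b" using keys_mult'[OF m] by blast
    then have "keys b \<subseteq> keys m" "keys b \<notin> \<Gamma>" using assms(3) by (auto simp: SR_def keys_plus_nat)
    then show ?thesis using assms(1) unfolding down_closed_def by blast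
  qed
  then show ?thesis using forms_mult[of f V k g i] assms by (auto simp: SR_def)
qed

lemma SR_mult':
  assumes "down_closed \<Gamma>" "f \<in> forms V k" "g \<in> SR V \<Gamma> i" "i' = k + i"
  shows "f * g \<in> SR V \<Gamma> i'" "g * f \<in> SR V \<Gamma> i'"
  using SR_mult[OF assms(1-3)] assms(4) by (simp_all add: mult.commute)

lemma SRT_zero [simp]: "0 \<in> SRT V \<Gamma> \<theta> j i"
proof (induction j)
  case (Suc j)
  then have "\<exists>e p. 0 = e + \<theta> j * p \<and> e \<in> SRT V \<Gamma> \<theta> j i \<and> p \<in> forms V (i - 1)"
    by (intro exI[of _ 0]) auto
  then show ?case by simp
qed simp

lemma SRT_add: "f \<in> SRT V \<Gamma> \<theta> j i \<Longrightarrow> g \<in> SRT V \<Gamma> \<theta> j i \<Longrightarrow> f + g \<in> SRT V \<Gamma> \<theta> j i"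
proof (induction j arbitrary: f g)
  case (Suc j)
  then obtain e p e' p' where *: "f = e + \<theta> j * p" "g = e' + \<theta> j * p'"
    "e \<in> SRT V \<Gamma> \<theta> j i" "e' \<in> SRT V \<Gamma> \<theta> j i" "p \<in> forms V (i - 1)" "p' \<in> forms V (i - 1)" by auto
  then have "f + g = (e + e') + \<theta> j * (p + p')" by (simp add: algebra_simps)
  then show ?case using * Suc.IH forms_add by (simp, blast)
qed (simp add: SR_add)

lemma SRT_mult:
  assumes "down_closed \<Gamma>" "g \<in> forms V k"
  shows "f \<in> SRT V \<Gamma> \<theta> j i \<Longrightarrow> g * f \<in> SRT V \<Gamma> \<theta> j (k + i)"
proof (induction j arbitrary: f)
  case (Suc j)
  then obtain e p where *: "f = e + \<theta> j * p" "e \<in> SRT V \<Gamma> \<theta> j i" "p \<in> forms V (i - 1)" by auto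
  have "g * f = g * e + \<theta> j * (g * p)" by (simp add: * algebra_simps)
  moreover have "g * p \<in> forms V (k + i - 1)" using forms_mult[OF assms(2) *(3)] by (simp add: algebra_simps)
  ultimately show ?case using Suc.IH[OF *(2)] by auto
qed (simp add: SR_mult assms)

lemma SRT_mult':
  assumes "down_closed \<Gamma>" "g \<in> forms V k" "f \<in> SRT V \<Gamma> \<theta> j i" "i' = k + i"
  shows "g * f \<in> SRT V \<Gamma> \<theta> j i'"
  using SRT_mult[OF assms(1-3)] assms(4) by simp

lemma SRT_const_mult: "f \<in> SRT V \<Gamma> \<theta> j i \<Longrightarrow> const c * f \<in> SRT V \<Gamma> \<theta> j i"
proof (induction j arbitrary: f)
  case (Suc j)
  then obtain e p where *: "f = e + \<theta> j * p" "e \<in> SRT V \<Gamma> \<theta> j i" "p \<in> forms V (i - 1)" by auto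
  have "const c * f = const c * e + \<theta> j * (const c * p)" by (simp add: * algebra_simps)
  then show ?case using Suc.IH[OF *(2)] forms_const_mult[OF *(3)] by (simp, blast)
qed (simp add: SR_const_mult)

lemma SRT_minus: "f \<in> SRT V \<Gamma> \<theta> j i \<Longrightarrow> - f \<in> SRT V \<Gamma> \<theta> j i"
  by (metis minus_const SRT_const_mult)

lemma SRT_diff: "f \<in> SRT V \<Gamma> \<theta> j i \<Longrightarrow> g \<in> SRT V \<Gamma> \<theta> j i \<Longrightarrow> f - g \<in> SRT V \<Gamma> \<theta> j i"
  using SRT_add[of f V \<Gamma> \<theta> j i "- g"] SRT_minus[of g] by simp

lemma SRT_Suc_mono: "f \<in> SRT V \<Gamma> \<theta> j i \<Longrightarrow> f \<in> SRT V \<Gamma> \<theta> (Suc j) i"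
  by (simp, rule exI[of _ f], rule exI[of _ 0]) simp

lemma SRT_mono: "j \<le> j' \<Longrightarrow> f \<in> SRT V \<Gamma> \<theta> j i \<Longrightarrow> f \<in> SRT V \<Gamma> \<theta> j' i"
  by (induction j' rule: dec_induct) (auto intro: SRT_Suc_mono simp del: SRT.simps)

lemma SRT_SR: "f \<in> SR V \<Gamma> i \<Longrightarrow> f \<in> SRT V \<Gamma> \<theta> j i"
  using SRT_mono[of 0 j] by simp

lemma SRT_theta: "p \<in> forms V (i - 1) \<Longrightarrow> \<theta> j * p \<in> SRT V \<Gamma> \<theta> (Suc j) i"
  by (simp, rule exI[of _ 0], rule exI[of _ p]) simp

lemma SRT_forms: "(\<And>l. \<theta> l \<in> forms V 1) \<Longrightarrow> f \<in> SRT V \<Gamma> \<theta> j i \<Longrightarrow> f \<in> forms V i"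
proof (induction j arbitrary: f)
  case (Suc j)
  then obtain e p where *: "f = e + \<theta> j * p" "e \<in> SRT V \<Gamma> \<theta> j i" "p \<in> forms V (i - 1)" by auto
  then show ?case using forms_mult[OF Suc.prems(1)[of j] *(3)] Suc.IH[OF Suc.prems(1) *(2)] forms_add by auto
qed (simp add: SR_forms)

lemma SRT_antimono_complex: "\<Gamma>' \<subseteq> \<Gamma> \<Longrightarrow> f \<in> SRT V \<Gamma> \<theta> j i \<Longrightarrow> f \<in> SRT V \<Gamma>' \<theta> j i"
proof (induction j arbitrary: f)
  case (Suc j) then show ?case by (simp, blast)
qed (auto simp: SR_def)

lemma SRT_neg: "i < 0 \<Longrightarrow> f \<in> forms V i \<Longrightarrow> f \<in> SRT V \<Gamma> \<theta> j i"
  using forms_neg SRT_zero by metis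

text \<open>The quotient is generated in degree one, so once a piece of nonnegative degree vanishes,
  all later ones do. Vanishing above \<open>w\<close> thus becomes a condition in the single degree
  \<open>w + 1\<close>.\<close>

lemma SRT_full_mono:
  fixes \<theta> :: "nat \<Rightarrow> ('w, 'k::field) mpoly"
  assumes "down_closed \<Gamma>" and full: "forms V i \<subseteq> SRT V \<Gamma> \<theta> j i" "0 \<le> i" "i \<le> i'"
  shows "forms V i' \<subseteq> SRT V \<Gamma> \<theta> j i'"
  using \<open>i \<le> i'\<close>
proof (induction i' rule: int_ge_induct)
  case (step i')
  show ?case
  proof
    fix f :: "('w, 'k) mpoly" assume f: "f \<in> forms V (i' + 1)"
    have i': "i' \<ge> 0" using assms step by simp
    from f i' show "f \<in> SRT V \<Gamma> \<theta> j (i' + 1)"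
    proof (induction rule: forms_step_induct)
      case (mult v g)
      then show ?case using step SRT_mult[OF assms(1) forms_var[OF mult(1)], of g \<theta> j i'] by (auto simp: add.commute)
    qed (auto intro: SRT_add)
  qed
qed (rule full)

text \<open>The parameters are \<open>\<theta> 0, \<dots>, \<theta> (D - 1)\<close>, and \<open>\<theta> D\<close> is the Lefschetz form. Regularity is only demanded in
  degrees below \<open>N\<close>: these are finitely many linear conditions and hence stable under perturbation of \<open>\<theta>\<close>.\<close>

definition good :: "'w set \<Rightarrow> nat \<Rightarrow> int \<Rightarrow> int \<Rightarrow> int \<Rightarrow> 'w set set \<Rightarrow> (nat \<Rightarrow> ('w, 'k::field) mpoly) \<Rightarrow> bool" where
  "good V D s w N \<Gamma> \<theta> \<longleftrightarrow> (\<forall>j. \<theta> j \<in> forms V 1) \<and>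
     (\<forall>j<D. \<forall>i<N. \<forall>f\<in>forms V i. \<theta> j * f \<in> SRT V \<Gamma> \<theta> j (i + 1) \<longrightarrow> f \<in> SRT V \<Gamma> \<theta> j i) \<and>
     (\<forall>i m. 2 * i + int m = s \<longrightarrow> (\<forall>f\<in>forms V i. \<theta> D ^ m * f \<in> SRT V \<Gamma> \<theta> D (i + int m) \<longrightarrow> f \<in> SRT V \<Gamma> \<theta> D i)) \<and>
     (\<forall>i>w. forms V i \<subseteq> SRT V \<Gamma> \<theta> D i)"

lemma goodD:
  assumes "good V D s w N \<Gamma> \<theta>"
  shows good_lin: "\<theta> j \<in> forms V 1"
    and good_reg: "j < D \<Longrightarrow> i < N \<Longrightarrow> f \<in> forms V i \<Longrightarrow> \<theta> j * f \<in> SRT V \<Gamma> \<theta> j (i + 1) \<Longrightarrow> f \<in> SRT V \<Gamma> \<theta> j i"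
    and good_lef: "2 * i + int m = s \<Longrightarrow> f \<in> forms V i \<Longrightarrow> \<theta> D ^ m * f \<in> SRT V \<Gamma> \<theta> D (i + int m) \<Longrightarrow> f \<in> SRT V \<Gamma> \<theta> D i"
    and good_van: "w < i \<Longrightarrow> f \<in> forms V i \<Longrightarrow> f \<in> SRT V \<Gamma> \<theta> D i"
  using assms unfolding good_def by blast+

section \<open>Glueing\<close>

text \<open>A monomial whose support is not in the intersection misses one of the two complexes, and
  is put into the corresponding summand.\<close>

lemma SR_Int_split:
  assumes "f \<in> SR V (\<Gamma>1 \<inter> \<Gamma>2) i"
  shows "\<exists>a b. a \<in> SR V \<Gamma>1 i \<and> b \<in> SR V \<Gamma>2 i \<and> f = a + b"
proof (induction rule: poly_mapping_sum_induct[of "\<lambda>g. \<exists>a b. a \<in> SR V \<Gamma>1 i \<and> b \<in> SR V \<Gamma>2 i \<and> g = a + b" f])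
  case zero show ?case by (intro exI[of _ 0]) auto
next
  case (add m c g)
  then obtain a b where ab: "a \<in> SR V \<Gamma>1 i" "b \<in> SR V \<Gamma>2 i" "g = a + b" by blast
  have m: "keys m \<notin> \<Gamma>1 \<inter> \<Gamma>2" "keys m \<subseteq> V" "int (mon_deg m) = i" using assms add by (auto simp: SR_def forms_def)
  show ?case
  proof (cases "keys m \<in> \<Gamma>1")
    case False
    then have "single m c \<in> SR V \<Gamma>1 i" using m by (auto simp: SR_def forms_def)
    then have "single m c + a \<in> SR V \<Gamma>1 i" using ab SR_add by blast
    moreover have "single m c + g = (single m c + a) + b" by (simp add: ab)
    ultimately show ?thesis using ab by blast
  next
    case True
    then have "single m c \<in> SR V \<Gamma>2 i" using m by (auto simp: SR_def forms_def)
    then have "single m c + b \<in> SR V \<Gamma>2 i" using ab SR_add by blast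
    moreover have "single m c + g = a + (single m c + b)" by (simp add: ab algebra_simps)
    ultimately show ?thesis using ab by blast
  qed
qed

text \<open>The multiples of the parameters lie in both ideals and may go to either summand; here
  they all go to the first.\<close>

lemma SRT_Int_split:
  assumes "f \<in> SRT V (\<Gamma>1 \<inter> \<Gamma>2) \<theta> j i"
  shows "\<exists>a b. a \<in> SRT V \<Gamma>1 \<theta> j i \<and> b \<in> SRT V \<Gamma>2 \<theta> j i \<and> f = a + b"
  using assms
proof (induction j arbitrary: f)
  case (Suc j)
  then obtain e p where *: "f = e + \<theta> j * p" "e \<in> SRT V (\<Gamma>1 \<inter> \<Gamma>2) \<theta> j i" "p \<in> forms V (i - 1)" by auto
  then obtain a b where ab: "a \<in> SRT V \<Gamma>1 \<theta> j i" "b \<in> SRT V \<Gamma>2 \<theta> j i" "e = a + b" using Suc.IH by blast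
  have "a + \<theta> j * p \<in> SRT V \<Gamma>1 \<theta> (Suc j) i" using ab * by auto
  moreover have "b \<in> SRT V \<Gamma>2 \<theta> (Suc j) i" using ab SRT_Suc_mono by blast
  ultimately show ?case using * ab by (metis (no_types, lifting) add.assoc add.commute)
next
  case 0
  then show ?case using SR_Int_split by simp
qed

text \<open>Regularity on the intersection replaces the vanishing of a Tor module in the Mayer--Vietoris sequence.\<close>

lemma SRT_Un:
  assumes lin: "\<And>l. \<theta> l \<in> forms V 1"
    and dc: "down_closed \<Gamma>1" "down_closed \<Gamma>2"
    and inj: "\<And>l p. l < j \<Longrightarrow> p \<in> forms V (i - 1) \<Longrightarrow> \<theta> l * p \<in> SRT V (\<Gamma>1 \<inter> \<Gamma>2) \<theta> l i \<Longrightarrow> p \<in> SRT V (\<Gamma>1 \<inter> \<Gamma>2) \<theta> l (i - 1)"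
    and f: "f \<in> SRT V \<Gamma>1 \<theta> j i" "f \<in> SRT V \<Gamma>2 \<theta> j i"
  shows "f \<in> SRT V (\<Gamma>1 \<union> \<Gamma>2) \<theta> j i"
  using inj f
proof (induction j arbitrary: f)
  case (Suc j)
  obtain g1 p where 1: "f = g1 + \<theta> j * p" "g1 \<in> SRT V \<Gamma>1 \<theta> j i" "p \<in> forms V (i - 1)" using Suc.prems by auto
  obtain g2 q where 2: "f = g2 + \<theta> j * q" "g2 \<in> SRT V \<Gamma>2 \<theta> j i" "q \<in> forms V (i - 1)" using Suc.prems by auto
  \<comment> \<open>The two presentations of \<open>f\<close> may use different coefficients of
    \<open>\<theta> j\<close>. Their difference is controlled by regularity on the intersection, and
    splitting it as \<open>r1 + r2\<close> gives a common coefficient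
    \<open>u = p - r1 = q + r2\<close> up to multiples that each ideal absorbs.\<close>
  have "\<theta> j * (p - q) = g2 - g1" using 1(1) 2(1) by (simp add: algebra_simps)
  moreover have "g2 \<in> SRT V (\<Gamma>1 \<inter> \<Gamma>2) \<theta> j i" "g1 \<in> SRT V (\<Gamma>1 \<inter> \<Gamma>2) \<theta> j i"
    using SRT_antimono_complex[OF _ 1(2)] SRT_antimono_complex[OF _ 2(2)] by auto
  ultimately have "\<theta> j * (p - q) \<in> SRT V (\<Gamma>1 \<inter> \<Gamma>2) \<theta> j i" by (simp only: SRT_diff)
  then have "p - q \<in> SRT V (\<Gamma>1 \<inter> \<Gamma>2) \<theta> j (i - 1)" using Suc.prems(1) 1(3) 2(3) forms_diff by blast
  then obtain r1 r2 where r: "r1 \<in> SRT V \<Gamma>1 \<theta> j (i - 1)" "r2 \<in> SRT V \<Gamma>2 \<theta> j (i - 1)" "p - q = r1 + r2"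
    using SRT_Int_split by blast
  define u where "u = p - r1"
  have u2: "u = q + r2" using r(3) by (simp add: u_def algebra_simps)
  have uh: "u \<in> forms V (i - 1)" unfolding u_def using SRT_forms[OF lin r(1)] 1(3) forms_diff by blast
  have "f - \<theta> j * u = g1 + \<theta> j * r1" by (simp add: u_def 1(1) algebra_simps)
  moreover have "\<theta> j * r1 \<in> SRT V \<Gamma>1 \<theta> j i" by (rule SRT_mult'[OF dc(1) lin r(1)]) simp
  ultimately have a: "f - \<theta> j * u \<in> SRT V \<Gamma>1 \<theta> j i" using SRT_add[OF 1(2)] by simp
  have "f - \<theta> j * u = g2 - \<theta> j * r2" by (simp add: u2 2(1) algebra_simps)
  moreover have "\<theta> j * r2 \<in> SRT V \<Gamma>2 \<theta> j i" by (rule SRT_mult'[OF dc(2) lin r(2)]) simp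
  ultimately have b: "f - \<theta> j * u \<in> SRT V \<Gamma>2 \<theta> j i" using SRT_diff[OF 2(2)] by simp
  have "f - \<theta> j * u \<in> SRT V (\<Gamma>1 \<union> \<Gamma>2) \<theta> j i"
    by (rule Suc.IH) (use Suc.prems(1) a b in auto)
  then have "(f - \<theta> j * u) + \<theta> j * u \<in> SRT V (\<Gamma>1 \<union> \<Gamma>2) \<theta> (Suc j) i" using uh by (simp only: SRT.simps) blast
  then show ?case by simp
next
  case 0
  then show ?case by (auto simp: SR_def)
qed

text \<open>\<open>SRT_Un\<close> is used in three ranges: with at most \<open>d\<close> parameters,
  where the intersection is regular; with all \<open>d + 1\<close> parameters in degrees at most
  \<open>d / 2\<close>, where \<open>\<theta> d\<close> is injective as the Lefschetz form of the
  intersection; and in degree \<open>d + 2\<close>, where the coefficients have degree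
  \<open>d + 1\<close> and the reduced intersection is already zero.\<close>

lemma good_glue:
  assumes g1: "good V (Suc d) (int d) (int d + 1) N \<Gamma>1 \<theta>" and g2: "good V (Suc d) (int d) (int d + 1) N \<Gamma>2 \<theta>"
    and g0: "good V d (int d - 1) (int d) N (\<Gamma>1 \<inter> \<Gamma>2) \<theta>" and dc: "down_closed \<Gamma>1" "down_closed \<Gamma>2"
    and N: "N > int d + 1"
  shows "good V (Suc d) (int d) (int d + 1) N (\<Gamma>1 \<union> \<Gamma>2) \<theta>"
proof -
  note lin = good_lin[OF g1]
  have dc0: "down_closed (\<Gamma>1 \<inter> \<Gamma>2)" "down_closed (\<Gamma>1 \<union> \<Gamma>2)" using dc by (auto simp: down_closed_def)
  have sub: "f \<in> SRT V \<Gamma>1 \<theta> j i" "f \<in> SRT V \<Gamma>2 \<theta> j i" if "f \<in> SRT V (\<Gamma>1 \<union> \<Gamma>2) \<theta> j i" for f j i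
    using SRT_antimono_complex[OF _ that] by auto
  \<comment> \<open>Injectivity of a power of \<open>\<theta> d\<close> implies that of
    \<open>\<theta> d\<close> itself. The power to use starts in degree \<open>i - 1\<close>, and
    \<open>2 * (i - 1) + (m + 1) = d - 1\<close>.\<close>
  have last_inj: "p \<in> SRT V (\<Gamma>1 \<inter> \<Gamma>2) \<theta> d (i - 1)"
    if "2 * i + int m = int d" "p \<in> forms V (i - 1)" "\<theta> d * p \<in> SRT V (\<Gamma>1 \<inter> \<Gamma>2) \<theta> d i" for i m p
  proof (rule good_lef[OF g0, of _ "Suc m"])
    have "\<theta> d ^ m * (\<theta> d * p) \<in> SRT V (\<Gamma>1 \<inter> \<Gamma>2) \<theta> d (i - 1 + int (Suc m))"
      by (rule SRT_mult'[OF dc0(1) forms_power[OF lin] that(3)]) simp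
    then show "\<theta> d ^ Suc m * p \<in> SRT V (\<Gamma>1 \<inter> \<Gamma>2) \<theta> d (i - 1 + int (Suc m))" by (simp add: algebra_simps)
  qed (use that in auto)
  have U1: "f \<in> SRT V (\<Gamma>1 \<union> \<Gamma>2) \<theta> j i" if "j \<le> d" "i \<le> N" "f \<in> SRT V \<Gamma>1 \<theta> j i" "f \<in> SRT V \<Gamma>2 \<theta> j i" for f j i
    by (rule SRT_Un[OF lin dc _ that(3,4)], rule good_reg[OF g0]) (use that in auto)
  have UL: "f \<in> SRT V (\<Gamma>1 \<union> \<Gamma>2) \<theta> (Suc d) i"
    if i: "2 * i + int m = int d" "f \<in> SRT V \<Gamma>1 \<theta> (Suc d) i" "f \<in> SRT V \<Gamma>2 \<theta> (Suc d) i" for f i m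
  proof (rule SRT_Un[OF lin dc _ that(2,3)])
    fix l p assume l: "l < Suc d" "p \<in> forms V (i - 1)" "\<theta> l * p \<in> SRT V (\<Gamma>1 \<inter> \<Gamma>2) \<theta> l i"
    show "p \<in> SRT V (\<Gamma>1 \<inter> \<Gamma>2) \<theta> l (i - 1)"
    proof (cases "l = d")
      case True then show ?thesis using last_inj[OF i(1)] l by auto
    next
      case False
      have "i - 1 < N" using i(1) N by linarith
      then show ?thesis using good_reg[OF g0, of l "i - 1" p] False l by auto
    qed
  qed
  have UV: "f \<in> SRT V (\<Gamma>1 \<union> \<Gamma>2) \<theta> (Suc d) (int d + 2)" if "f \<in> forms V (int d + 2)" for f
  proof (rule SRT_Un[OF lin dc])
    fix l p assume l: "l < Suc d" "p \<in> forms V (int d + 2 - 1)" "\<theta> l * p \<in> SRT V (\<Gamma>1 \<inter> \<Gamma>2) \<theta> l (int d + 2)"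
    show "p \<in> SRT V (\<Gamma>1 \<inter> \<Gamma>2) \<theta> l (int d + 2 - 1)"
    proof (cases "l = d")
      case True then show ?thesis using good_van[OF g0] l by auto
    next
      case False
      have "\<theta> l * p \<in> SRT V (\<Gamma>1 \<inter> \<Gamma>2) \<theta> l (int d + 2 - 1 + 1)" using l(3) by (simp add: add.commute)
      from good_reg[OF g0 _ _ l(2) this] False l(1) N show ?thesis by simp
    qed
  next
    show "f \<in> SRT V \<Gamma>1 \<theta> (Suc d) (int d + 2)" using good_van[OF g1 _ that] by simp
    show "f \<in> SRT V \<Gamma>2 \<theta> (Suc d) (int d + 2)" using good_van[OF g2 _ that] by simp
  qed
  have van: "forms V i \<subseteq> SRT V (\<Gamma>1 \<union> \<Gamma>2) \<theta> (Suc d) i" if "int d + 1 < i" for i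
    by (rule SRT_full_mono[OF dc0(2), of _ "int d + 2"]) (use UV that in auto)
  show ?thesis
    unfolding good_def
  proof (intro conjI allI impI ballI)
    fix j i f assume *: "j < Suc d" "i < N" "f \<in> forms V i" "\<theta> j * f \<in> SRT V (\<Gamma>1 \<union> \<Gamma>2) \<theta> j (i + 1)"
    show "f \<in> SRT V (\<Gamma>1 \<union> \<Gamma>2) \<theta> j i"
      by (rule U1) (use * sub[OF *(4)] good_reg[OF g1 *(1-3)] good_reg[OF g2 *(1-3)] in auto)
  next
    fix i m f assume *: "2 * i + int m = int d" "f \<in> forms V i" "\<theta> (Suc d) ^ m * f \<in> SRT V (\<Gamma>1 \<union> \<Gamma>2) \<theta> (Suc d) (i + int m)"
    show "f \<in> SRT V (\<Gamma>1 \<union> \<Gamma>2) \<theta> (Suc d) i"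
      by (rule UL[OF *(1)]) (use sub[OF *(3)] good_lef[OF g1 *(1-2)] good_lef[OF g2 *(1-2)] in auto)
  qed (use lin van in auto)
qed

section \<open>Perturbation along a line\<close>

interpretation vs: vector_space "\<lambda>(c::'k::field) (f::('w, 'k) mpoly). const c * f"
  by unfold_locales (simp_all add: algebra_simps const_add const_mult)

section \<open>Families of forms depending polynomially on a parameter\<close>

text \<open>\<open>F\<close> is a univariate polynomial over the ring of forms. Each coefficient of
  \<open>f t\<close> is then a univariate polynomial over the field, which is nonzero at almost all
  \<open>t\<close> as soon as it is nonzero at one.\<close>

definition poly_family :: "('k::field \<Rightarrow> ('w, 'k) mpoly) \<Rightarrow> bool" where
  "poly_family f \<longleftrightarrow> (\<exists>F. \<forall>t. f t = poly F (const t))"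

lemma poly_family_const [simp]: "poly_family (\<lambda>t. c)"
  unfolding poly_family_def by (rule exI[of _ "[:c:]"]) simp

lemma poly_family_param [simp]: "poly_family const"
  unfolding poly_family_def by (rule exI[of _ "[:0, 1:]"]) simp

lemma poly_family_add: "poly_family f \<Longrightarrow> poly_family g \<Longrightarrow> poly_family (\<lambda>t. f t + g t)"
  unfolding poly_family_def by (metis poly_add)

lemma poly_family_diff: "poly_family f \<Longrightarrow> poly_family g \<Longrightarrow> poly_family (\<lambda>t. f t - g t)"
  unfolding poly_family_def by (metis poly_diff)

lemma poly_family_mult: "poly_family f \<Longrightarrow> poly_family g \<Longrightarrow> poly_family (\<lambda>t. f t * g t)"
  unfolding poly_family_def by (metis poly_mult)

lemma poly_family_power: "poly_family f \<Longrightarrow> poly_family (\<lambda>t. f t ^ n)"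
  by (induction n) (auto intro: poly_family_mult)

lemma poly_family_line: "poly_family (\<lambda>t. a + const t * b)"
  by (intro poly_family_add poly_family_mult) auto

lemma poly_family_scalar: "poly_family (\<lambda>t. const (poly p t) :: ('w, 'k::field) mpoly)"
proof (induction p)
  case (pCons a p)
  have "(\<lambda>t. const (poly (pCons a p) t) :: ('w, 'k) mpoly) = (\<lambda>t. const a + const t * const (poly p t))"
    by (simp add: const_add const_mult)
  then show ?case using poly_family_add[OF poly_family_const poly_family_mult[OF poly_family_param pCons(2)], of "const a"] by (simp only:)
qed simp

lemma poly_family_lookup:
  fixes f :: "'k::field \<Rightarrow> ('w, 'k) mpoly"
  assumes "poly_family f" shows "\<exists>p. \<forall>t. lookup (f t) m = poly p t"
proof -
  have "\<exists>p. \<forall>t. lookup (poly F (const t)) m = poly p t" for F :: "('w, 'k) mpoly Polynomial.poly"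
  proof (induction F)
    case (pCons a F)
    then obtain p where p: "\<forall>t. lookup (poly F (const t)) m = poly p t" by blast
    have "\<forall>t. lookup (poly (pCons a F) (const t)) m = poly (pCons (lookup a m) p) t"
      by (simp add: lookup_add lookup_const_mult p)
    then show ?case by blast
  qed (auto intro: exI[of _ 0])
  then show ?thesis using assms unfolding poly_family_def by metis
qed

lemma eventually_poly_neq_0:
  assumes "poly p (a::'k::field) \<noteq> 0"
  shows "\<forall>\<^sub>F t in cofinite. poly p t \<noteq> 0"
proof -
  have "p \<noteq> 0" using assms by auto
  then show ?thesis by (simp add: eventually_cofinite poly_roots_finite)
qed

text \<open>Gaussian elimination with a pivot coefficient, cross-multiplied to stay polynomial in the parameter.\<close>

lemma indep_open:
  fixes w :: "'l \<Rightarrow> 'k::field \<Rightarrow> ('w, 'k) mpoly"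
  assumes "finite L" "\<And>l. l \<in> L \<Longrightarrow> poly_family (w l)"
    and "\<And>c. (\<Sum>l\<in>L. const (c l) * w l a) = 0 \<Longrightarrow> \<forall>l\<in>L. c l = 0"
  shows "\<forall>\<^sub>F t in cofinite. \<forall>c. (\<Sum>l\<in>L. const (c l) * w l t) = 0 \<longrightarrow> (\<forall>l\<in>L. c l = 0)"
  using assms
proof (induction L arbitrary: w rule: finite_induct)
  case (insert k L)
  have "w k a \<noteq> 0"
  proof
    assume "w k a = 0"
    then have "(\<Sum>l\<in>insert k L. const (if l = k then 1 else 0) * w l a) = 0"
      using insert(1,2) by (auto intro!: sum.neutral)
    from insert(5)[OF this] show False by simp
  qed
  then obtain m where m: "lookup (w k a) m \<noteq> 0"
    by (metis lookup_zero poly_mapping_eqI)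
  have "\<forall>l\<in>insert k L. \<exists>p. \<forall>t. lookup (w l t) m = poly p t"
    using poly_family_lookup insert(4) by blast
  then obtain q where q: "\<And>l t. l \<in> insert k L \<Longrightarrow> lookup (w l t) m = poly (q l) t" by metis
  define w' where "w' l t = const (poly (q k) t) * w l t - const (poly (q l) t) * w k t" for l t
  have key: "(\<Sum>l\<in>L. const (c l) * w' l t) =
      const (poly (q k) t) * (\<Sum>l\<in>L. const (c l) * w l t) - const (\<Sum>l\<in>L. c l * poly (q l) t) * w k t" for c t
  proof -
    have c: "const (\<Sum>l\<in>L. c l * poly (q l) t) = (\<Sum>l\<in>L. const (c l * poly (q l) t) :: ('w, 'k) mpoly)"
      using insert(1) by (induction L rule: finite_induct) (simp_all add: const_add)
    show ?thesis
      unfolding w'_def c by (simp add: sum_distrib_left sum_distrib_right sum_subtractf algebra_simps const_mult)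
  qed
  have "\<forall>\<^sub>F t in cofinite. \<forall>c. (\<Sum>l\<in>L. const (c l) * w' l t) = 0 \<longrightarrow> (\<forall>l\<in>L. c l = 0)"
  proof (rule insert(3))
    show "poly_family (w' l)" if "l \<in> L" for l
      unfolding w'_def using that insert(4) by (intro poly_family_diff poly_family_mult poly_family_scalar) auto
    fix c assume c: "(\<Sum>l\<in>L. const (c l) * w' l a) = 0"
    \<comment> \<open>The elimination is undone at the point \<open>a\<close>: a relation among the
      reduced vectors becomes one among the original family, with the coefficient of the pivot
      vector collecting all subtracted multiples.\<close>
    define c' where "c' l = (if l = k then - (\<Sum>l\<in>L. c l * poly (q l) a) else c l * poly (q k) a)" for l
    have "(\<Sum>l\<in>L. const (c' l) * w l a) = (\<Sum>l\<in>L. const (poly (q k) a) * (const (c l) * w l a))"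
      using insert(2) by (intro sum.cong) (auto simp: c'_def const_mult mult_ac)
    moreover have "(const (c' k) :: ('w, 'k) mpoly) = - const (\<Sum>l\<in>L. c l * poly (q l) a)"
      using const_diff[of 0 "\<Sum>l\<in>L. c l * poly (q l) a"] by (simp add: c'_def)
    ultimately have "(\<Sum>l\<in>insert k L. const (c' l) * w l a) = (\<Sum>l\<in>L. const (c l) * w' l a)"
      unfolding key using insert(1,2) by (simp add: sum_distrib_left)
    then have "\<forall>l\<in>insert k L. c' l = 0" using insert(5) c by metis
    then show "\<forall>l\<in>L. c l = 0" using insert(2) m q[of k a] by (auto simp: c'_def split: if_splits)
  qed
  moreover have "\<forall>\<^sub>F t in cofinite. poly (q k) t \<noteq> 0"
    using eventually_poly_neq_0[of "q k" a] m q[of k a] by simp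
  ultimately show ?case
  proof eventually_elim
    case (elim t)
    show ?case
    proof (intro allI impI)
      fix c assume c: "(\<Sum>l\<in>insert k L. const (c l) * w l t) = 0"
      then have s: "(\<Sum>l\<in>L. const (c l) * w l t) = - (const (c k) * w k t)"
        using insert(1,2) by (simp add: eq_neg_iff_add_eq_0 add.commute)
      \<comment> \<open>Comparing coefficients at the pivot monomial gives the scalar relation
        \<open>l\<close>, which turns the given relation into one among the reduced vectors.\<close>
      have "0 = lookup (\<Sum>l\<in>insert k L. const (c l) * w l t) m" unfolding c by simp
      also have "\<dots> = (\<Sum>l\<in>insert k L. c l * poly (q l) t)"
        unfolding lookup_sum lookup_const_mult by (intro sum.cong) (auto simp: q)
      finally have l: "(\<Sum>l\<in>L. c l * poly (q l) t) = - (c k * poly (q k) t)"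
        using insert(1,2) by (simp add: eq_neg_iff_add_eq_0 add.commute)
      have "(\<Sum>l\<in>L. const (c l) * w' l t) = 0"
        unfolding key s l using const_diff[of 0 "c k * poly (q k) t"] by (simp add: const_mult)
      then have cl: "\<forall>l\<in>L. c l = 0" using elim by blast
      then have "c k * poly (q k) t = 0" using l by simp
      then show "\<forall>l\<in>insert k L. c l = 0" using cl elim by simp
    qed
  qed
qed simp

section \<open>Dimension counts for injectivity\<close>

text \<open>Stated as a relation so that it also says that \<open>U\<close> is a subspace and of
  finite dimension; both are passed on from one parameter to the next.\<close>

definition has_dim :: "('w, 'k::field) mpoly set \<Rightarrow> nat \<Rightarrow> bool" where
  "has_dim U n \<longleftrightarrow> (\<exists>B. finite B \<and> card B = n \<and> vs.independent B \<and> vs.span B = U)"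

lemma has_dim_subspace: "has_dim U n \<Longrightarrow> vs.subspace U"
  unfolding has_dim_def using vs.subspace_span by blast

lemma has_dim_unique: "has_dim U n \<Longrightarrow> has_dim U m \<Longrightarrow> n = m"
  unfolding has_dim_def by (metis vs.independent_span_bound vs.span_superset le_antisym)

lemma has_dim_spanI:
  assumes "has_dim U n" "vs.independent B" "card B = n" "finite B" "B \<subseteq> U"
  shows "vs.span B = U"
proof
  show "vs.span B \<subseteq> U" using assms has_dim_subspace vs.span_minimal by metis
  obtain B' where B': "finite B'" "card B' = n" "vs.span B' = U" using assms(1) has_dim_def by blast
  show "U \<subseteq> vs.span B"
  proof (rule ccontr)
    assume "\<not> U \<subseteq> vs.span B"
    then obtain u where u: "u \<in> U" "u \<notin> vs.span B" by blast
    then have "vs.independent (insert u B)" using assms(2) vs.independent_insertI by blast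
    moreover have "insert u B \<subseteq> vs.span B'" using u assms B' by auto
    ultimately have "card (insert u B) \<le> n" using vs.independent_span_bound[OF B'(1)] B'(2) by blast
    moreover have "u \<notin> B" using u vs.span_base by blast
    ultimately show False using assms by simp
  qed
qed

lemma has_dim_ex:
  assumes "has_dim X r" "vs.subspace U" "U \<subseteq> X"
  shows "\<exists>n. has_dim U n"
proof -
  obtain B where B: "B \<subseteq> U" "vs.independent B" "U \<subseteq> vs.span B" using vs.maximal_independent_subset by blast
  obtain B' where B': "finite B'" "vs.span B' = X" using assms(1) has_dim_def by blast
  have "finite B" using vs.independent_span_bound[OF B'(1) B(2)] B assms B' by auto
  moreover have "vs.span B = U" using B assms(2) vs.span_minimal by blast
  ultimately show ?thesis using B unfolding has_dim_def by blast
qed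

lemma has_dim_eq:
  assumes "has_dim X r" "has_dim U r" "U \<subseteq> X" shows "U = X"
proof -
  obtain B where B: "finite B" "card B = r" "vs.independent B" "vs.span B = U"
    using assms(2) has_dim_def by blast
  then show ?thesis using has_dim_spanI[OF assms(1) B(3,2,1)] assms(3) vs.span_superset by blast
qed

lemma has_dim_complement:
  assumes X: "has_dim X r" and U: "has_dim U p" "U \<subseteq> X"
  obtains B C where "finite B" "card B = p" "vs.span B = U" "vs.independent (B \<union> C)" "B \<inter> C = {}"
    "finite C" "C \<subseteq> X" "p + card C = r" "vs.span (B \<union> C) = X"
proof -
  obtain B where B: "finite B" "card B = p" "vs.independent B" "vs.span B = U" using U(1) has_dim_def by blast
  then have "B \<subseteq> X" using U(2) vs.span_superset by blast
  then obtain B' where B': "B \<subseteq> B'" "B' \<subseteq> X" "vs.independent B'" "X \<subseteq> vs.span B'"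
    using vs.maximal_independent_subset_extend[of B X] B(3) by blast
  obtain G where G: "finite G" "card G = r" "vs.span G = X" using X has_dim_def by blast
  have fin: "finite B'" using vs.independent_span_bound[OF G(1) B'(3)] B' G by auto
  have sp: "vs.span B' = X" using B' has_dim_subspace[OF X] vs.span_minimal by blast
  then have "has_dim X (card B')" using fin B' has_dim_def by blast
  then have "card B' = r" using has_dim_unique X by blast
  moreover have "card B' = card B + card (B' - B)"
    using fin B'(1) B(1) by (metis card_Diff_subset card_mono le_add_diff_inverse)
  moreover have "B \<union> (B' - B) = B'" using B'(1) by blast
  ultimately show ?thesis using that[of B "B' - B"] B B' fin sp by auto
qed

text \<open>Independence of an indexed family excludes repetitions as well. This matters because
  vectors moving with a parameter may coincide at some of its values.\<close>

lemma family_independent: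
  assumes "finite L" "\<And>c. (\<Sum>l\<in>L. const (c l) * w l) = 0 \<Longrightarrow> \<forall>l\<in>L. c l = (0::'k::field)"
  shows "inj_on w L" "vs.independent (w ` L)"
proof -
  show inj: "inj_on w L"
  proof (rule inj_onI, rule ccontr)
    fix x y assume xy: "x \<in> L" "y \<in> L" "w x = w y" "x \<noteq> y"
    have "(\<Sum>l\<in>L. const (if l = x then 1 else if l = y then - 1 else 0) * w l)
        = (\<Sum>l\<in>{x, y}. const (if l = x then 1 else if l = y then - 1 else 0) * w l)"
      by (rule sum.mono_neutral_right) (use assms xy in auto)
    also have "\<dots> = 0" using xy const_diff[of 0 1] by simp
    finally show False using assms(2)[of "\<lambda>l. if l = x then 1 else if l = y then - 1 else 0"] xy by fastforce
  qed
  show "vs.independent (w ` L)"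
  proof (rule vs.independent_if_scalars_zero)
    fix f x assume "(\<Sum>x\<in>w ` L. const (f x) * x) = 0" "x \<in> w ` L"
    then show "f x = 0" using assms(2)[of "f \<circ> w"] inj by (auto simp: sum.reindex)
  qed (use assms in simp)
qed

lemma independent_family:
  assumes "finite B" "vs.independent B" "(\<Sum>b\<in>B. const (c b) * b) = 0" "b \<in> B"
  shows "c b = 0"
  using vs.independentD[OF assms(2,1) subset_refl assms(3,4)] .

lemma span_family:
  assumes "finite B" "x \<in> vs.span B"
  shows "\<exists>c. x = (\<Sum>b\<in>B. const (c b) * b)"
  using assms vs.span_finite[OF assms(1)] by auto

lemma span_image_family:
  assumes "finite B" "x \<in> vs.span (w ` B)" "inj_on w B"
  shows "\<exists>c. x = (\<Sum>b\<in>B. const (c b) * w b)"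
proof -
  obtain c where "x = (\<Sum>b\<in>w ` B. const (c b) * b)" using span_family[of "w ` B" x] assms by auto
  then have "x = (\<Sum>b\<in>B. const ((c \<circ> w) b) * w b)" using assms by (simp add: sum.reindex)
  then show ?thesis by blast
qed

lemma span_sum_mem: "(\<And>b. b \<in> B \<Longrightarrow> w b \<in> U) \<Longrightarrow> vs.subspace U \<Longrightarrow> (\<Sum>b\<in>B. const (c b) * w b) \<in> U"
  using vs.subspace_sum[of U B "\<lambda>b. const (c b) * w b"] vs.subspace_scale by blast

text \<open>Independence of \<open>q\<close> vectors of \<open>E\<close> together with the products
  \<open>\<tau> * c\<close> is a finite certificate that \<open>\<tau>\<close> maps \<open>X\<close>
  modulo \<open>U\<close> injectively into the ring modulo \<open>E\<close>. \<open>C\<close> is not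
  assumed to be a complement of \<open>U\<close>: in the application it is chosen at another
  parameter value, and complementarity follows by counting dimensions.\<close>

lemma mult_injective_of_independent:
  fixes \<tau> :: "('w, 'k::field) mpoly"
  assumes X: "has_dim X (p + card C)" and U: "has_dim U p" "U \<subseteq> X"
    and C: "C \<subseteq> X" "finite C" and E: "has_dim E q"
    and B: "finite B" "card B = q" "\<And>b. b \<in> B \<Longrightarrow> W b \<in> E"
    and mul: "\<And>u. u \<in> U \<Longrightarrow> \<tau> * u \<in> E"
    and indep: "\<And>\<beta> \<gamma>. (\<Sum>b\<in>B. const (\<beta> b) * W b) + (\<Sum>c\<in>C. const (\<gamma> c) * (\<tau> * c)) = 0 \<Longrightarrow>
      (\<forall>b\<in>B. \<beta> b = 0) \<and> (\<forall>c\<in>C. \<gamma> c = 0)"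
  shows "\<forall>x\<in>X. \<tau> * x \<in> E \<longrightarrow> x \<in> U" and "has_dim {e + \<tau> * x | e x. e \<in> E \<and> x \<in> X} (q + card C)"
proof -
  note sub = has_dim_subspace[OF X] has_dim_subspace[OF U(1)] has_dim_subspace[OF E]
  have iW: "\<forall>b\<in>B. \<beta> b = 0" if "(\<Sum>b\<in>B. const (\<beta> b) * W b) = 0" for \<beta>
    using indep[of \<beta> "\<lambda>_. 0"] that by simp
  have fW: "inj_on W B" "vs.independent (W ` B)"
    by (rule family_independent[OF B(1)], rule iW, assumption)+
  have spE: "vs.span (W ` B) = E"
    by (rule has_dim_spanI[OF E fW(2)]) (use B fW card_image in auto)
  have tau_sum: "\<tau> * (\<Sum>c\<in>C. const (\<gamma> c) * c) = (\<Sum>c\<in>C. const (\<gamma> c) * (\<tau> * c))" for \<gamma>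
    by (simp add: sum_distrib_left mult_ac)
  have ker: "\<forall>c\<in>C. \<gamma> c = 0" if z: "\<tau> * (\<Sum>c\<in>C. const (\<gamma> c) * c) \<in> E" for \<gamma>
  proof -
    obtain \<beta> where "\<tau> * (\<Sum>c\<in>C. const (\<gamma> c) * c) = (\<Sum>b\<in>B. const (\<beta> b) * W b)"
      using span_image_family[OF B(1) _ fW(1)] z spE by blast
    then have "(\<Sum>b\<in>B. const (- \<beta> b) * W b) + (\<Sum>c\<in>C. const (\<gamma> c) * (\<tau> * c)) = 0"
      using const_diff[of 0] by (simp add: tau_sum sum_negf)
    then show ?thesis using indep[of "\<lambda>b. - \<beta> b" \<gamma>] by blast
  qed
  obtain G where G: "finite G" "card G = p" "vs.independent G" "vs.span G = U" using U(1) has_dim_def by blast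
  \<comment> \<open>\<open>\<tau>\<close> maps \<open>U\<close> into \<open>E\<close>, so a relation
    between \<open>U\<close> and \<open>C\<close> becomes a combination of the
    \<open>\<tau> * c\<close> lying in \<open>E\<close>, which \<open>ker\<close> excludes.\<close>
  have *: "(\<forall>g\<in>G. \<beta> g = 0) \<and> (\<forall>c\<in>C. \<gamma> c = 0)"
    if z: "(\<Sum>g\<in>G. const (\<beta> g) * g) + (\<Sum>c\<in>C. const (\<gamma> c) * c) = 0" for \<beta> \<gamma>
  proof -
    have "(\<Sum>g\<in>G. const (\<beta> g) * g) \<in> U" by (rule span_sum_mem) (use G vs.span_superset sub in auto)
    moreover have "(\<Sum>c\<in>C. const (\<gamma> c) * c) = - (\<Sum>g\<in>G. const (\<beta> g) * g)"
      using z by (simp add: eq_neg_iff_add_eq_0 add.commute)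
    ultimately have "(\<Sum>c\<in>C. const (\<gamma> c) * c) \<in> U" using vs.subspace_neg[OF sub(2)] by simp
    then have "\<tau> * (\<Sum>c\<in>C. const (\<gamma> c) * c) \<in> E" by (rule mul)
    then have "\<forall>c\<in>C. \<gamma> c = 0" using ker by blast
    moreover from this have "(\<Sum>g\<in>G. const (\<beta> g) * g) = 0" using z by simp
    ultimately show ?thesis using independent_family[OF G(1,3)] by blast
  qed
  \<comment> \<open>The disjoint sum serves as index set because the disjointness of
    \<open>G\<close> and \<open>C\<close> is part of what is being shown.\<close>
  define F where "F = case_sum (\<lambda>g. g) (\<lambda>c::('w, 'k) mpoly. c)"
  have iF: "\<forall>l\<in>G <+> C. c l = 0" if z: "(\<Sum>l\<in>G <+> C. const (c l) * F l) = 0" for c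
  proof -
    have "(\<Sum>g\<in>G. const ((c \<circ> Inl) g) * g) + (\<Sum>x\<in>C. const ((c \<circ> Inr) x) * x) = 0"
      using z G(1) C(2) by (simp add: F_def sum.Plus)
    from *[OF this] show ?thesis by auto
  qed
  have finP: "finite (G <+> C)" using G C by simp
  have fF: "inj_on F (G <+> C)" "vs.independent (F ` (G <+> C))"
    by (rule family_independent[OF finP], rule iF, assumption)+
  have FGC: "F ` (G <+> C) = G \<union> C" by (simp add: F_def Plus_def image_Un image_image)
  have "G \<subseteq> X" using U(2) G(4) vs.span_superset by blast
  then have "vs.span (G \<union> C) = X"
    by (intro has_dim_spanI[OF X]) (use fF FGC G C U vs.span_superset card_image[OF fF(1)] card_Plus[OF G(1) C(2)] in auto)
  then have dec: "\<exists>u \<gamma>. u \<in> U \<and> x = u + (\<Sum>c\<in>C. const (\<gamma> c) * c)" if "x \<in> X" for x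
    using that span_family[OF C(2)] G(4) unfolding vs.span_Un by blast
  show "\<forall>x\<in>X. \<tau> * x \<in> E \<longrightarrow> x \<in> U"
  proof (intro ballI impI)
    fix x assume x: "x \<in> X" "\<tau> * x \<in> E"
    obtain u \<gamma> where u: "u \<in> U" "x = u + (\<Sum>c\<in>C. const (\<gamma> c) * c)" using dec[OF x(1)] by blast
    have "\<tau> * (\<Sum>c\<in>C. const (\<gamma> c) * c) = \<tau> * x - \<tau> * u" by (simp add: u algebra_simps)
    then have "\<tau> * (\<Sum>c\<in>C. const (\<gamma> c) * c) \<in> E"
      using vs.subspace_diff[OF sub(3) x(2) mul[OF u(1)]] by simp
    then have "\<forall>c\<in>C. \<gamma> c = 0" by (rule ker)
    then show "x \<in> U" using u by simp
  qed
  define H where "H = case_sum W (\<lambda>c. \<tau> * c)"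
  have iH: "\<forall>l\<in>B <+> C. c l = 0" if z: "(\<Sum>l\<in>B <+> C. const (c l) * H l) = 0" for c
  proof -
    have "(\<Sum>b\<in>B. const ((c \<circ> Inl) b) * W b) + (\<Sum>x\<in>C. const ((c \<circ> Inr) x) * (\<tau> * x)) = 0"
      using z B(1) C(2) by (simp add: H_def sum.Plus)
    from indep[OF this] show ?thesis by auto
  qed
  have finQ: "finite (B <+> C)" using B C by simp
  have fH: "inj_on H (B <+> C)" "vs.independent (H ` (B <+> C))"
    by (rule family_independent[OF finQ], rule iH, assumption)+
  have HBC: "H ` (B <+> C) = W ` B \<union> (\<lambda>c. \<tau> * c) ` C" by (simp add: H_def Plus_def image_Un image_image)
  have "vs.span (H ` (B <+> C)) = {e + \<tau> * x | e x. e \<in> E \<and> x \<in> X}"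
  proof (intro set_eqI iffI)
    fix y assume "y \<in> vs.span (H ` (B <+> C))"
    then obtain c where "y = (\<Sum>l\<in>B <+> C. const (c l) * H l)" using span_image_family[OF finQ _ fH(1)] by blast
    then have y: "y = (\<Sum>b\<in>B. const (c (Inl b)) * W b) + \<tau> * (\<Sum>x\<in>C. const (c (Inr x)) * x)"
      using B(1) C(2) by (simp add: H_def sum.Plus tau_sum)
    have "(\<Sum>b\<in>B. const (c (Inl b)) * W b) \<in> E" by (rule span_sum_mem) (use B sub in auto)
    moreover have "(\<Sum>x\<in>C. const (c (Inr x)) * x) \<in> X" by (rule span_sum_mem) (use C sub in auto)
    ultimately show "y \<in> {e + \<tau> * x | e x. e \<in> E \<and> x \<in> X}" using y by blast
  next
    fix y assume "y \<in> {e + \<tau> * x | e x. e \<in> E \<and> x \<in> X}"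
    then obtain e x where ex: "y = e + \<tau> * x" "e \<in> E" "x \<in> X" by blast
    obtain u \<gamma> where u: "u \<in> U" "x = u + (\<Sum>c\<in>C. const (\<gamma> c) * c)" using dec[OF ex(3)] by blast
    have "y = (e + \<tau> * u) + (\<Sum>c\<in>C. const (\<gamma> c) * (\<tau> * c))" unfolding ex(1) u(2) distrib_left tau_sum by (simp add: add.assoc)
    moreover have "e + \<tau> * u \<in> vs.span (W ` B)" using vs.subspace_add[OF sub(3) ex(2) mul[OF u(1)]] spE by simp
    moreover have "(\<Sum>c\<in>C. const (\<gamma> c) * (\<tau> * c)) \<in> vs.span ((\<lambda>c. \<tau> * c) ` C)"
      by (rule span_sum_mem) (auto intro: vs.span_base)
    ultimately show "y \<in> vs.span (H ` (B <+> C))" unfolding HBC vs.span_Un by blast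
  qed
  moreover have "card (H ` (B <+> C)) = q + card C" using card_image[OF fH(1)] card_Plus[OF B(1) C(2)] B(2) by simp
  ultimately show "has_dim {e + \<tau> * x | e x. e \<in> E \<and> x \<in> X} (q + card C)"
    unfolding has_dim_def using fH(2) finQ by blast
qed

text \<open>A basis of \<open>E 0\<close> is extended to \<open>E t\<close> by polynomial sections,
  and the certificate of independence then persists for almost all \<open>t\<close>. The second
  conclusion, constant dimension of the enlarged space, has the form of the hypothesis on
  \<open>E\<close> and makes the lemma iterable over the parameters.\<close>

lemma mult_injective_open:
  fixes \<tau> :: "'k::field \<Rightarrow> ('w, 'k) mpoly"
  assumes X: "has_dim X r" and UX: "\<And>t. U t \<subseteq> X"
    and U: "\<exists>p. has_dim (U 0) p \<and> (\<forall>\<^sub>F t in cofinite. has_dim (U t) p)"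
    and E: "\<exists>q. has_dim (E 0) q \<and> (\<forall>\<^sub>F t in cofinite. has_dim (E t) q)"
    and sec: "\<And>e. e \<in> E 0 \<Longrightarrow> \<exists>w. poly_family w \<and> w 0 = e \<and> (\<forall>t. w t \<in> E t)"
    and tau: "poly_family \<tau>" and mul: "\<And>t u. u \<in> U t \<Longrightarrow> \<tau> t * u \<in> E t"
    and inj: "\<And>x. x \<in> X \<Longrightarrow> \<tau> 0 * x \<in> E 0 \<Longrightarrow> x \<in> U 0"
  shows "\<forall>\<^sub>F t in cofinite. \<forall>x\<in>X. \<tau> t * x \<in> E t \<longrightarrow> x \<in> U t"
    and "\<exists>q. has_dim {e + \<tau> 0 * x | e x. e \<in> E 0 \<and> x \<in> X} q \<and>
      (\<forall>\<^sub>F t in cofinite. has_dim {e + \<tau> t * x | e x. e \<in> E t \<and> x \<in> X} q)"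
proof -
  obtain p where p: "has_dim (U 0) p" "\<forall>\<^sub>F t in cofinite. has_dim (U t) p" using U by blast
  obtain q where q: "has_dim (E 0) q" "\<forall>\<^sub>F t in cofinite. has_dim (E t) q" using E by blast
  obtain G C where C: "finite G" "card G = p" "vs.span G = U 0" "vs.independent (G \<union> C)" "G \<inter> C = {}"
    "finite C" "C \<subseteq> X" "p + card C = r" "vs.span (G \<union> C) = X"
    using has_dim_complement[OF X p(1) UX] .
  obtain B where B: "finite B" "card B = q" "vs.independent B" "vs.span B = E 0" using q(1) has_dim_def by blast
  have "\<forall>b\<in>B. \<exists>w. poly_family w \<and> w 0 = b \<and> (\<forall>t. w t \<in> E t)" using sec B(4) vs.span_superset by blast
  then obtain W where W: "\<And>b. b \<in> B \<Longrightarrow> poly_family (W b)" "\<And>b. b \<in> B \<Longrightarrow> W b 0 = b" "\<And>b t. b \<in> B \<Longrightarrow> W b t \<in> E t"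
    by metis
  define H where "H l t = (case l of Inl b \<Rightarrow> W b t | Inr c \<Rightarrow> \<tau> t * c)" for l :: "('w, 'k) mpoly + ('w, 'k) mpoly" and t
  have sumH: "(\<Sum>l\<in>B <+> C. const (c l) * H l t) =
      (\<Sum>b\<in>B. const (c (Inl b)) * W b t) + (\<Sum>x\<in>C. const (c (Inr x)) * (\<tau> t * x))" for c t
    using B(1) C(6) by (simp add: H_def sum.Plus)
  have i0: "\<forall>l\<in>B <+> C. c l = 0" if c: "(\<Sum>l\<in>B <+> C. const (c l) * H l 0) = 0" for c
  proof -
    define x where "x = (\<Sum>x\<in>C. const (c (Inr x)) * x)"
    have s: "(\<Sum>b\<in>B. const (c (Inl b)) * b) + \<tau> 0 * x = 0"
      using c W(2) unfolding sumH by (simp add: x_def sum_distrib_left mult_ac)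
    have "(\<Sum>b\<in>B. const (c (Inl b)) * b) \<in> E 0"
      by (rule span_sum_mem) (use B vs.span_superset has_dim_subspace[OF q(1)] in auto)
    moreover have "\<tau> 0 * x = - (\<Sum>b\<in>B. const (c (Inl b)) * b)"
      using s by (simp add: eq_neg_iff_add_eq_0 add.commute)
    ultimately have "\<tau> 0 * x \<in> E 0"
      using vs.subspace_neg[OF has_dim_subspace[OF q(1)]] by simp
    moreover have "x \<in> X" unfolding x_def by (rule span_sum_mem) (use C has_dim_subspace[OF X] in auto)
    ultimately have "x \<in> vs.span G" using inj C(3) by blast
    then obtain d where d: "x = (\<Sum>g\<in>G. const (d g) * g)" using span_family C(1) by blast
    \<comment> \<open>\<open>x\<close> lies in the span of \<open>C\<close> by definition and in the
      span of \<open>G\<close> by injectivity at 0; \<open>e\<close> is the resulting relation on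
      the independent set \<open>G \<union> C\<close>.\<close>
    define e where "e g = (if g \<in> G then - d g else c (Inr g))" for g
    have "(\<Sum>g\<in>G \<union> C. const (e g) * g) = (\<Sum>g\<in>G. const (e g) * g) + (\<Sum>g\<in>C. const (e g) * g)"
      by (rule sum.union_disjoint) (use C in auto)
    also have "(\<Sum>g\<in>G. const (e g) * g) = - x"
      unfolding d sum_negf[symmetric] by (intro sum.cong) (auto simp: e_def const_diff[of 0, simplified])
    also have "(\<Sum>g\<in>C. const (e g) * g) = x"
      unfolding x_def using C(5) by (intro sum.cong) (auto simp: e_def)
    finally have "e g = 0" if "g \<in> G \<union> C" for g
      using independent_family[OF _ C(4), of e g] that C(1,6) by simp
    then have r: "\<forall>g\<in>C. c (Inr g) = 0" using C(5) by (auto simp: e_def) (metis disjoint_iff)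
    then have "x = 0" by (simp add: x_def)
    then have "\<forall>b\<in>B. c (Inl b) = 0" using s independent_family[OF B(1,3), of "\<lambda>b. c (Inl b)"] by simp
    then show ?thesis using r by auto
  qed
  have ev: "\<forall>\<^sub>F t in cofinite. \<forall>c. (\<Sum>l\<in>B <+> C. const (c l) * H l t) = 0 \<longrightarrow> (\<forall>l\<in>B <+> C. c l = 0)"
  proof (rule indep_open[where a = 0])
    show "finite (B <+> C)" using B C by simp
    show "poly_family (H l)" if "l \<in> B <+> C" for l
    proof (cases l)
      case (Inl b)
      then have "H l = W b" by (intro ext) (simp add: H_def)
      then show ?thesis using W(1)[of b] that Inl by auto
    next
      case (Inr c)
      then have "H l = (\<lambda>t. \<tau> t * c)" by (intro ext) (simp add: H_def)
      then show ?thesis using poly_family_mult[OF tau poly_family_const[of c]] by simp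
    qed
  qed (use i0 in blast)
  have st: "(\<forall>x\<in>X. \<tau> t * x \<in> E t \<longrightarrow> x \<in> U t) \<and> has_dim {e + \<tau> t * x | e x. e \<in> E t \<and> x \<in> X} (q + card C)"
    if "has_dim (U t) p" "has_dim (E t) q"
      and i: "\<forall>c. (\<Sum>l\<in>B <+> C. const (c l) * H l t) = 0 \<longrightarrow> (\<forall>l\<in>B <+> C. c l = 0)" for t
  proof -
    have i': "(\<forall>b\<in>B. \<beta> b = 0) \<and> (\<forall>c\<in>C. \<gamma> c = 0)"
      if "(\<Sum>b\<in>B. const (\<beta> b) * W b t) + (\<Sum>c\<in>C. const (\<gamma> c) * (\<tau> t * c)) = 0" for \<beta> \<gamma>
      using i[rule_format, of "case_sum \<beta> \<gamma>"] that unfolding sumH by force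
    have X': "has_dim X (p + card C)" using X C(8) by simp
    note * = mult_injective_of_independent[where W = "\<lambda>b. W b t" and \<tau> = "\<tau> t", OF X' that(1) UX C(7,6) that(2) B(1,2)]
    have "\<forall>x\<in>X. \<tau> t * x \<in> E t \<longrightarrow> x \<in> U t" by (rule *(1)) (use W(3) mul i' in blast)+
    moreover have "has_dim {e + \<tau> t * x | e x. e \<in> E t \<and> x \<in> X} (q + card C)"
      by (rule *(2)) (use W(3) mul i' in blast)+
    ultimately show ?thesis by blast
  qed
  have "\<forall>\<^sub>F t in cofinite. (\<forall>x\<in>X. \<tau> t * x \<in> E t \<longrightarrow> x \<in> U t) \<and>
      has_dim {e + \<tau> t * x | e x. e \<in> E t \<and> x \<in> X} (q + card C)"
    using p(2) q(2) ev by eventually_elim (use st in blast)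
  then show "\<forall>\<^sub>F t in cofinite. \<forall>x\<in>X. \<tau> t * x \<in> E t \<longrightarrow> x \<in> U t"
    and "\<exists>q. has_dim {e + \<tau> 0 * x | e x. e \<in> E 0 \<and> x \<in> X} q \<and>
      (\<forall>\<^sub>F t in cofinite. has_dim {e + \<tau> t * x | e x. e \<in> E t \<and> x \<in> X} q)"
    using st[OF p(1) q(1)] i0 by (auto elim: eventually_mono)
qed

section \<open>Goodness persists along lines\<close>

lemma finite_monomials:
  assumes "finite V" shows "finite {m :: 'w \<Rightarrow>\<^sub>0 nat. keys m \<subseteq> V \<and> mon_deg m \<le> n}"
proof -
  have bd: "lookup m \<in> {f. \<forall>x. (x \<in> V \<longrightarrow> f x \<in> {..n}) \<and> (x \<notin> V \<longrightarrow> f x = 0)}"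
    if "keys m \<subseteq> V" "mon_deg m \<le> n" for m :: "'w \<Rightarrow>\<^sub>0 nat"
  proof -
    have "lookup m v \<le> n" if "v \<in> V" for v
    proof (cases "v \<in> keys m")
      case True
      then have "lookup m v \<le> mon_deg m" unfolding mon_deg_def by (intro member_le_sum) auto
      then show ?thesis using \<open>mon_deg m \<le> n\<close> by simp
    qed (simp add: in_keys_iff)
    then show ?thesis using that by (auto simp: in_keys_iff)
  qed
  have "lookup ` {m :: 'w \<Rightarrow>\<^sub>0 nat. keys m \<subseteq> V \<and> mon_deg m \<le> n} \<subseteq> {f. \<forall>x. (x \<in> V \<longrightarrow> f x \<in> {..n}) \<and> (x \<notin> V \<longrightarrow> f x = 0)}"
    by (intro image_subsetI, elim CollectE conjE) (rule bd)
  moreover have "finite {f. \<forall>x. (x \<in> V \<longrightarrow> f x \<in> {..n}) \<and> (x \<notin> V \<longrightarrow> f x = 0)}"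
    using assms by (intro finite_set_of_finite_funs) auto
  ultimately have "finite (lookup ` {m :: 'w \<Rightarrow>\<^sub>0 nat. keys m \<subseteq> V \<and> mon_deg m \<le> n})"
    using finite_subset by blast
  moreover have "inj_on lookup {m :: 'w \<Rightarrow>\<^sub>0 nat. keys m \<subseteq> V \<and> mon_deg m \<le> n}"
    by (rule inj_onI, rule poly_mapping_eqI) simp
  ultimately show ?thesis by (rule finite_imageD)
qed

lemma subspace_forms: "vs.subspace (forms V i)"
  by (intro vs.subspaceI) (auto intro: forms_add forms_const_mult)

lemma subspace_SRT: "vs.subspace (SRT V \<Gamma> \<theta> j i)"
  by (intro vs.subspaceI) (auto intro: SRT_add SRT_const_mult)

lemma has_dim_forms:
  assumes "finite V" shows "\<exists>r. has_dim (forms V i :: ('w, 'k::field) mpoly set) r"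
proof -
  define S where "S = (\<lambda>m. single m (1::'k)) ` {m. keys m \<subseteq> V \<and> int (mon_deg m) = i}"
  have "finite S"
    unfolding S_def by (intro finite_imageI finite_subset[OF _ finite_monomials[OF assms, of "nat i"]]) auto
  have "f \<in> vs.span S" if "f \<in> forms V i" for f
  proof -
    have "(\<Sum>m\<in>keys f. const (lookup f m) * single m 1) \<in> vs.span S"
      by (rule span_sum_mem[OF vs.span_base]) (use that in \<open>auto simp: S_def forms_def\<close>)
    then show ?thesis unfolding single_split[symmetric] poly_expand[of f, symmetric] .
  qed
  then have sub: "forms V i \<subseteq> vs.span S" by blast
  obtain B where B: "B \<subseteq> S" "vs.independent B" "S \<subseteq> vs.span B" using vs.maximal_independent_subset by blast
  have "has_dim (vs.span B) (card B)" using B(1,2) \<open>finite S\<close> finite_subset unfolding has_dim_def by blast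
  moreover have "forms V i \<subseteq> vs.span B" using sub vs.span_minimal[OF B(3) vs.subspace_span] by blast
  ultimately show ?thesis using has_dim_ex subspace_forms by blast
qed

text \<open>The multipliers of the parameters are kept fixed while the parameters move along the
  line.\<close>

lemma SRT_section:
  "e \<in> SRT V \<Gamma> (\<lambda>j. \<theta> j + const 0 * \<eta> j) j i \<Longrightarrow>
   \<exists>w. poly_family w \<and> w 0 = e \<and> (\<forall>t. w t \<in> SRT V \<Gamma> (\<lambda>j. \<theta> j + const t * \<eta> j) j i)"
proof (induction j arbitrary: e)
  case 0
  then show ?case by (intro exI[of _ "\<lambda>_. e"]) auto
next
  case (Suc j)
  then obtain e' p where e: "e = e' + (\<theta> j + const 0 * \<eta> j) * p" "p \<in> forms V (i - 1)"
    "e' \<in> SRT V \<Gamma> (\<lambda>j. \<theta> j + const 0 * \<eta> j) j i" by auto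
  then obtain w where w: "poly_family w" "w 0 = e'" "\<forall>t. w t \<in> SRT V \<Gamma> (\<lambda>j. \<theta> j + const t * \<eta> j) j i"
    using Suc.IH by blast
  show ?case
  proof (intro exI[of _ "\<lambda>t. w t + (\<theta> j + const t * \<eta> j) * p"] conjI allI)
    show "poly_family (\<lambda>t. w t + (\<theta> j + const t * \<eta> j) * p)"
      by (intro poly_family_add poly_family_mult poly_family_line w) auto
    show "w t + (\<theta> j + const t * \<eta> j) * p \<in> SRT V \<Gamma> (\<lambda>j. \<theta> j + const t * \<eta> j) (Suc j) i" for t
      using w(3) e(2) by auto
  qed (use w e in simp)
qed

lemma eventually_Ball_int:
  assumes "\<And>i::int. a \<le> i \<Longrightarrow> i \<le> b \<Longrightarrow> eventually (P i) F"
  shows "eventually (\<lambda>t. \<forall>i. a \<le> i \<longrightarrow> i \<le> b \<longrightarrow> P i t) F"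
proof -
  have "eventually (\<lambda>t. \<forall>i\<in>{a..b}. P i t) F" by (rule eventually_ball_finite) (use assms in auto)
  then show ?thesis by (rule eventually_mono) auto
qed

text \<open>Only finitely many degrees carry a condition: pieces of negative degree are zero,
  regularity stops at \<open>N\<close>, and vanishing is tested in degree \<open>w + 1\<close>.
  Dimensions of the ideal pieces are known to be constant up to degree \<open>N\<close>, and
  \<open>s \<le> N\<close> and \<open>w < N\<close> keep all target degrees within that
  range.\<close>

lemma good_open:
  fixes \<theta> :: "nat \<Rightarrow> ('w, 'k::field) mpoly"
  assumes g: "good V D s w N \<Gamma> \<theta>" and eta: "\<And>j. \<eta> j \<in> forms V 1" and V: "finite V"
    and dc: "down_closed \<Gamma>" and N: "s \<le> N" "w < N" "- 1 \<le> w"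
  shows "\<forall>\<^sub>F t in cofinite. good V D s w N \<Gamma> (\<lambda>j. \<theta> j + const t * \<eta> j)"
proof -
  define L where "L t j = \<theta> j + const t * \<eta> j" for t j
  have L0: "L 0 = \<theta>" by (rule ext) (simp add: L_def)
  have lin: "L t j \<in> forms V 1" for t j
    unfolding L_def using good_lin[OF g] eta forms_add forms_const_mult by blast
  have pL: "poly_family (\<lambda>t. L t j)" for j unfolding L_def by (rule poly_family_line)
  have sec: "\<exists>w. poly_family w \<and> w 0 = e \<and> (\<forall>t. w t \<in> SRT V \<Gamma> (L t) j i)" if "e \<in> SRT V \<Gamma> (L 0) j i" for e j i
    using SRT_section[of e V \<Gamma> \<theta> \<eta> j i] that unfolding L_def .
  have sub: "SRT V \<Gamma> (L t) j i \<subseteq> forms V i" for t j i using SRT_forms[of "L t", OF lin] by blast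
  \<comment> \<open>Adding the parameter \<open>\<theta> j\<close> in degree \<open>i\<close> uses
    regularity in degree \<open>i - 1\<close>, so the range reaches one degree beyond the regularity
    conditions.\<close>
  have dims: "(\<exists>q. has_dim (SRT V \<Gamma> (L 0) j i) q \<and> (\<forall>\<^sub>F t in cofinite. has_dim (SRT V \<Gamma> (L t) j i) q))"
    if "j \<le> D" "i \<le> N" for i j
    using that
  proof (induction j arbitrary: i)
    case 0
    obtain r where "has_dim (forms V i :: ('w, 'k) mpoly set) r" using has_dim_forms[OF V] by blast
    then have "\<exists>q. has_dim (SRT V \<Gamma> (L 0) 0 i) q"
      using has_dim_ex[OF _ subspace_SRT sub] by blast
    then show ?case by auto
  next
    case (Suc j)
    obtain r where r: "has_dim (forms V (i - 1) :: ('w, 'k) mpoly set) r" using has_dim_forms[OF V] by blast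
    have "\<exists>q. has_dim {e + L 0 j * x | e x. e \<in> SRT V \<Gamma> (L 0) j i \<and> x \<in> forms V (i - 1)} q \<and>
      (\<forall>\<^sub>F t in cofinite. has_dim {e + L t j * x | e x. e \<in> SRT V \<Gamma> (L t) j i \<and> x \<in> forms V (i - 1)} q)"
    proof (rule mult_injective_open(2)[OF r sub[of _ j "i - 1"] _ _ sec pL])
      show "L t j * u \<in> SRT V \<Gamma> (L t) j i" if "u \<in> SRT V \<Gamma> (L t) j (i - 1)" for t u
        by (rule SRT_mult'[OF dc lin that]) simp
      show "x \<in> SRT V \<Gamma> (L 0) j (i - 1)" if "x \<in> forms V (i - 1)" "L 0 j * x \<in> SRT V \<Gamma> (L 0) j i" for x
        using good_reg[OF g, of j "i - 1" x] that Suc.prems unfolding L0 by simp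
    qed (use Suc in auto)
    then show ?case by simp
  qed
  have reg: "\<forall>\<^sub>F t in cofinite. \<forall>f\<in>forms V i. L t j * f \<in> SRT V \<Gamma> (L t) j (i + 1) \<longrightarrow> f \<in> SRT V \<Gamma> (L t) j i"
    if "j < D" "i < N" for i j
  proof -
    obtain r where r: "has_dim (forms V i :: ('w, 'k) mpoly set) r" using has_dim_forms[OF V] by blast
    show ?thesis
    proof (rule mult_injective_open(1)[OF r sub[of _ j i] _ _ sec pL])
      show "L t j * u \<in> SRT V \<Gamma> (L t) j (i + 1)" if "u \<in> SRT V \<Gamma> (L t) j i" for t u
        by (rule SRT_mult'[OF dc lin that]) simp
      show "x \<in> SRT V \<Gamma> (L 0) j i" if "x \<in> forms V i" "L 0 j * x \<in> SRT V \<Gamma> (L 0) j (i + 1)" for x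
        using good_reg[OF g, of j i x] that \<open>j < D\<close> \<open>i < N\<close> unfolding L0 by simp
    qed (use dims that in auto)
  qed
  have "\<forall>\<^sub>F t in cofinite. \<forall>j\<in>{..<D}. \<forall>i. 0 \<le> i \<longrightarrow> i \<le> N - 1 \<longrightarrow>
      (\<forall>f\<in>forms V i. L t j * f \<in> SRT V \<Gamma> (L t) j (i + 1) \<longrightarrow> f \<in> SRT V \<Gamma> (L t) j i)"
    by (intro eventually_ball_finite ballI eventually_Ball_int reg) auto
  moreover have lef: "\<forall>\<^sub>F t in cofinite. \<forall>f\<in>forms V i. L t D ^ m * f \<in> SRT V \<Gamma> (L t) D (i + int m) \<longrightarrow> f \<in> SRT V \<Gamma> (L t) D i"
    if "0 \<le> i" "2 * i + int m = s" for i m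
  proof -
    obtain r where r: "has_dim (forms V i :: ('w, 'k) mpoly set) r" using has_dim_forms[OF V] by blast
    show ?thesis
    proof (rule mult_injective_open(1)[OF r sub[of _ D i] _ _ sec poly_family_power[OF pL]])
      show "L t D ^ m * u \<in> SRT V \<Gamma> (L t) D (i + int m)" if "u \<in> SRT V \<Gamma> (L t) D i" for t u
        by (rule SRT_mult'[OF dc forms_power[OF lin] that]) simp
      show "x \<in> SRT V \<Gamma> (L 0) D i" if "x \<in> forms V i" "L 0 D ^ m * x \<in> SRT V \<Gamma> (L 0) D (i + int m)" for x
        using good_lef[OF g \<open>2 * i + int m = s\<close>, of x] that unfolding L0 by simp
    qed (use dims that N in auto)
  qed
  have "\<forall>\<^sub>F t in cofinite. \<forall>i. 0 \<le> i \<longrightarrow> i \<le> s \<longrightarrow> (\<forall>m\<in>{..nat s}. 2 * i + int m = s \<longrightarrow>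
      (\<forall>f\<in>forms V i. L t D ^ m * f \<in> SRT V \<Gamma> (L t) D (i + int m) \<longrightarrow> f \<in> SRT V \<Gamma> (L t) D i))"
  proof (intro eventually_Ball_int eventually_ball_finite ballI)
    show "\<forall>\<^sub>F t in cofinite. 2 * i + int m = s \<longrightarrow>
        (\<forall>f\<in>forms V i. L t D ^ m * f \<in> SRT V \<Gamma> (L t) D (i + int m) \<longrightarrow> f \<in> SRT V \<Gamma> (L t) D i)"
      if "0 \<le> i" for i m
      using lef[OF that, of m] by (cases "2 * i + int m = s") auto
  qed simp
  \<comment> \<open>At 0 the ideal piece is everything, and a subspace of the same dimension is
    again everything.\<close>
  moreover have "\<forall>\<^sub>F t in cofinite. forms V (w + 1) \<subseteq> SRT V \<Gamma> (L t) D (w + 1)"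
  proof -
    obtain q where q: "has_dim (SRT V \<Gamma> (L 0) D (w + 1)) q" "\<forall>\<^sub>F t in cofinite. has_dim (SRT V \<Gamma> (L t) D (w + 1)) q"
      using dims[of D "w + 1"] N by auto
    have "SRT V \<Gamma> (L 0) D (w + 1) = forms V (w + 1)"
      using good_van[OF g, of "w + 1"] sub unfolding L0 by (metis L0 less_add_one subsetI subset_antisym)
    then have "has_dim (forms V (w + 1) :: ('w, 'k) mpoly set) q" using q(1) by simp
    from has_dim_eq[OF this _ sub] show ?thesis by (intro eventually_mono[OF q(2)]) simp
  qed
  ultimately show ?thesis
  proof eventually_elim
    case (elim t)
    have neg: "f \<in> SRT V \<Gamma> (L t) j i" if "f \<in> forms V i" "i < 0" for f i j using that by (rule SRT_neg[rotated])
    have "good V D s w N \<Gamma> (L t)"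
      unfolding good_def
    proof (intro conjI allI impI ballI)
      fix j i f assume *: "j < D" "i < N" "f \<in> forms V i" "L t j * f \<in> SRT V \<Gamma> (L t) j (i + 1)"
      show "f \<in> SRT V \<Gamma> (L t) j i"
        by (cases "i < 0") (use elim(1) * neg in auto)
    next
      fix i m f assume *: "2 * i + int m = s" "f \<in> forms V i" "L t D ^ m * f \<in> SRT V \<Gamma> (L t) D (i + int m)"
      show "f \<in> SRT V \<Gamma> (L t) D i"
      proof (cases "i < 0")
        case False
        then have "i \<le> s" "m \<in> {..nat s}" using * by auto
        then show ?thesis using elim(2) * False by auto
      qed (use * neg in auto)
    next
      fix i assume "w < i"
      then show "forms V i \<subseteq> SRT V \<Gamma> (L t) D i"
        using SRT_full_mono[OF dc elim(3), of i] N by auto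
    qed (rule lin)
    then show ?case unfolding L_def .
  qed
qed

text \<open>An elementary substitute for nonempty Zariski open sets: only openness along lines is used.\<close>

definition generic :: "'w set \<Rightarrow> ((nat \<Rightarrow> ('w, 'k::field) mpoly) \<Rightarrow> bool) \<Rightarrow> bool" where
  "generic V P \<longleftrightarrow> (\<exists>\<theta>. P \<theta>) \<and> (\<forall>\<theta>. P \<theta> \<longrightarrow> (\<forall>j. \<theta> j \<in> forms V 1)) \<and>
     (\<forall>\<theta> \<eta>. P \<theta> \<longrightarrow> (\<forall>j. \<eta> j \<in> forms V 1) \<longrightarrow> (\<forall>\<^sub>F t in cofinite. P (\<lambda>j. \<theta> j + const t * \<eta> j)))"

lemma generic_good:
  assumes "finite V" "down_closed \<Gamma>" "s \<le> N" "w < N" "- 1 \<le> w"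
    and "\<exists>\<theta>::nat \<Rightarrow> ('w, 'k::field) mpoly. good V D s w N \<Gamma> \<theta>"
  shows "generic V (good V D s w N \<Gamma> :: (nat \<Rightarrow> ('w, 'k) mpoly) \<Rightarrow> bool)"
  unfolding generic_def using assms good_open good_lin by blast

lemma genericD:
  assumes "generic V P"
  shows generic_ex: "\<exists>\<theta>. P \<theta>" and generic_lin: "P \<theta> \<Longrightarrow> \<theta> j \<in> forms V 1"
    and generic_line: "P \<theta> \<Longrightarrow> (\<And>j. \<eta> j \<in> forms V 1) \<Longrightarrow> \<forall>\<^sub>F t in cofinite. P (\<lambda>j. \<theta> j + const t * \<eta> j)"
  using assms unfolding generic_def by simp_all

text \<open>The line joining a point of \<open>P\<close> to a point of \<open>Q\<close> leaves
  \<open>P\<close> only finitely often, and, read from the other end by \<open>t\<close> to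
  \<open>1 - t\<close>, leaves \<open>Q\<close> only finitely often. An infinite field has a value
  of \<open>t\<close> outside both exceptional sets.\<close>

lemma generic_conj:
  assumes inf: "infinite (UNIV :: 'k::field set)"
    and P: "generic V (P :: (nat \<Rightarrow> ('w, 'k) mpoly) \<Rightarrow> bool)" and Q: "generic V Q"
  shows "generic V (\<lambda>\<theta>. P \<theta> \<and> Q \<theta>)"
proof -
  obtain \<theta> \<eta> where t: "P \<theta>" "Q \<eta>" using generic_ex[OF P] generic_ex[OF Q] by blast
  define \<delta> where "\<delta> j = \<eta> j - \<theta> j" for j
  have d: "\<delta> j \<in> forms V 1" "- \<delta> j \<in> forms V 1" for j
    unfolding \<delta>_def using generic_lin[OF P t(1)] generic_lin[OF Q t(2)] by (simp_all add: forms_diff forms_minus del: minus_diff_eq)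
  note 1 = generic_line[OF P t(1) d(1)]
  have "\<forall>\<^sub>F t in cofinite. Q (\<lambda>j. \<eta> j + const t * - \<delta> j)" by (rule generic_line[OF Q t(2) d(2)])
  then have "finite ((\<lambda>t. 1 - t) ` {t. \<not> Q (\<lambda>j. \<eta> j + const t * - \<delta> j)})"
    by (simp add: eventually_cofinite)
  moreover have e: "(\<lambda>j. \<eta> j + const (1 - t) * - \<delta> j) = (\<lambda>j. \<theta> j + const t * \<delta> j)" for t
    by (rule ext) (simp add: \<delta>_def const_diff algebra_simps)
  moreover have "{t. \<not> Q (\<lambda>j. \<theta> j + const t * \<delta> j)} \<subseteq> (\<lambda>t. 1 - t) ` {t. \<not> Q (\<lambda>j. \<eta> j + const t * - \<delta> j)}"
  proof (intro subsetI, unfold mem_Collect_eq)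
    fix t assume a: "\<not> Q (\<lambda>j. \<theta> j + const t * \<delta> j)"
    have "t = 1 - (1 - t)" by simp
    then show "t \<in> (\<lambda>t. 1 - t) ` {t. \<not> Q (\<lambda>j. \<eta> j + const t * - \<delta> j)}"
      by (rule image_eqI) (use a e[of t] in simp)
  qed
  ultimately have 2: "\<forall>\<^sub>F t in cofinite. Q (\<lambda>j. \<theta> j + const t * \<delta> j)"
    unfolding eventually_cofinite using finite_subset by blast
  have "(cofinite :: 'k filter) \<noteq> bot" using inf by simp
  from eventually_happens'[OF this eventually_conj[OF 1 2]]
  obtain t where "P (\<lambda>j. \<theta> j + const t * \<delta> j) \<and> Q (\<lambda>j. \<theta> j + const t * \<delta> j)" by (rule exE)
  then have ex: "\<exists>\<theta>. P \<theta> \<and> Q \<theta>" by (rule exI[where x = "\<lambda>j. \<theta> j + const t * \<delta> j"])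
  show ?thesis
    unfolding generic_def
  proof (intro conjI allI impI ex)
    fix \<theta> \<eta> :: "nat \<Rightarrow> ('w, 'k) mpoly"
    assume a: "P \<theta> \<and> Q \<theta>" and b: "\<forall>j. \<eta> j \<in> forms V 1"
    show "\<forall>\<^sub>F t in cofinite. P (\<lambda>j. \<theta> j + const t * \<eta> j) \<and> Q (\<lambda>j. \<theta> j + const t * \<eta> j)"
      by (intro eventually_conj generic_line[OF P] generic_line[OF Q]) (use a b in simp_all)
  qed (use generic_lin[OF P] in simp)
qed

section \<open>Substitution homomorphisms\<close>

definition subst_mon :: "('w \<Rightarrow> ('u, 'k::field) mpoly) \<Rightarrow> ('w \<Rightarrow>\<^sub>0 nat) \<Rightarrow> ('u, 'k) mpoly" where
  "subst_mon g m = (\<Prod>v\<in>keys m. g v ^ lookup m v)"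

definition subst_poly :: "('w \<Rightarrow> ('u, 'k::field) mpoly) \<Rightarrow> ('w, 'k) mpoly \<Rightarrow> ('u, 'k) mpoly" where
  "subst_poly g f = (\<Sum>m\<in>keys f. const (lookup f m) * subst_mon g m)"

lemma subst_mon_superset:
  assumes "finite S" "keys m \<subseteq> S" shows "subst_mon g m = (\<Prod>v\<in>S. g v ^ lookup m v)"
  unfolding subst_mon_def
  by (rule prod.mono_neutral_left) (use assms in \<open>auto simp: in_keys_iff\<close>)

lemma subst_mon_0 [simp]: "subst_mon g 0 = 1" by (simp add: subst_mon_def)
lemma subst_mon_single [simp]: "subst_mon g (single v (Suc 0)) = g v" by (simp add: subst_mon_def)

lemma subst_mon_add: "subst_mon g (m + n) = subst_mon g m * subst_mon g n"
proof -
  have "subst_mon g (m + n) = (\<Prod>v\<in>keys m \<union> keys n. g v ^ lookup (m + n) v)"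
    by (rule subst_mon_superset) (auto simp: keys_plus_nat)
  also have "\<dots> = (\<Prod>v\<in>keys m \<union> keys n. g v ^ lookup m v) * (\<Prod>v\<in>keys m \<union> keys n. g v ^ lookup n v)"
    by (simp add: lookup_add power_add prod.distrib)
  also have "\<dots> = subst_mon g m * subst_mon g n"
    using subst_mon_superset[of "keys m \<union> keys n" m g] subst_mon_superset[of "keys m \<union> keys n" n g] by simp
  finally show ?thesis .
qed

lemma subst_poly_superset:
  assumes "finite S" "keys f \<subseteq> S" shows "subst_poly g f = (\<Sum>m\<in>S. const (lookup f m) * subst_mon g m)"
  unfolding subst_poly_def
  by (rule sum.mono_neutral_left) (use assms in \<open>auto simp: in_keys_iff\<close>)

lemma subst_poly_0 [simp]: "subst_poly g 0 = 0" by (simp add: subst_poly_def)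

lemma subst_poly_single: "subst_poly g (single m c) = const c * subst_mon g m"
proof -
  have "keys (single m c) \<subseteq> {m}" by simp
  from subst_poly_superset[OF _ this, of g] show ?thesis by (simp only: finite.emptyI finite.insertI sum.insert sum.empty empty_iff lookup_single_eq simp_thms add_0_right)
qed

lemma subst_poly_add: "subst_poly g (f + h) = subst_poly g f + subst_poly g h"
proof -
  have "subst_poly g (f + h) = (\<Sum>m\<in>keys f \<union> keys h. const (lookup (f + h) m) * subst_mon g m)"
    by (rule subst_poly_superset) (auto simp: keys_add)
  also have "\<dots> = (\<Sum>m\<in>keys f \<union> keys h. const (lookup f m) * subst_mon g m) + (\<Sum>m\<in>keys f \<union> keys h. const (lookup h m) * subst_mon g m)"
    by (simp add: lookup_add const_add distrib_right sum.distrib)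
  also have "\<dots> = subst_poly g f + subst_poly g h"
    using subst_poly_superset[of "keys f \<union> keys h" f g] subst_poly_superset[of "keys f \<union> keys h" h g] by simp
  finally show ?thesis .
qed

lemma subst_poly_mult: "subst_poly g (f * h) = subst_poly g f * subst_poly g h"
proof -
  have 1: "subst_poly g (single m c * h) = subst_poly g (single m c) * subst_poly g h" for m c
  proof (induction h rule: poly_mapping_sum_induct)
    case (add n d h)
    have "subst_poly g (single m c * single n d) = subst_poly g (single m c) * subst_poly g (single n d)"
      unfolding mult_single subst_poly_single subst_mon_add const_mult by (simp only: mult_ac)
    then show ?case by (simp only: distrib_left subst_poly_add add(2))
  qed simp
  show ?thesis
  proof (induction f rule: poly_mapping_sum_induct)
    case (add m c f)
    then show ?case by (simp only: distrib_right subst_poly_add 1)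
  qed simp
qed

lemma subst_poly_const [simp]: "subst_poly g (const c) = const c"
  using subst_poly_single[of g 0 c] by (simp add: const_def)

lemma subst_poly_one [simp]: "subst_poly g 1 = 1"
  using subst_poly_const[of g 1] by simp

lemma subst_poly_minus: "subst_poly g (- f) = - subst_poly g f"
  by (subst (1 2) minus_const) (simp only: subst_poly_mult subst_poly_const)

lemma subst_poly_diff: "subst_poly g (f - h) = subst_poly g f - subst_poly g h"
  using subst_poly_add[of g f "- h"] subst_poly_minus[of g h] by simp

lemma subst_poly_power: "subst_poly g (f ^ n) = subst_poly g f ^ n"
  by (induction n) (simp_all add: subst_poly_mult)

lemma subst_poly_var [simp]: "subst_poly g (var v) = g v"
  by (simp add: var_def subst_poly_single)

lemmas subst_poly_simps = subst_poly_add subst_poly_mult subst_poly_minus subst_poly_diff subst_poly_power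

lemma forms_induct [consumes 1, case_names zero const add mult]:
  assumes "f \<in> forms V i"
    and z: "\<And>i. P i 0" and c: "\<And>c. P 0 (const c)"
    and a: "\<And>i f g. f \<in> forms V i \<Longrightarrow> g \<in> forms V i \<Longrightarrow> P i f \<Longrightarrow> P i g \<Longrightarrow> P i (f + g)"
    and m: "\<And>i v g. v \<in> V \<Longrightarrow> 0 \<le> i \<Longrightarrow> g \<in> forms V i \<Longrightarrow> P i g \<Longrightarrow> P (i + 1) (var v * g)"
  shows "P i f"
proof (cases "0 \<le> i")
  case True
  then show ?thesis using assms(1)
  proof (induction i arbitrary: f rule: int_ge_induct)
    case base
    then show ?case using forms_0_const[of f V] c by auto
  next
    case (step i)
    have "f \<in> forms V (i + 1) \<and> P (i + 1) f"
      using step.prems step.hyps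
    proof (induction rule: forms_step_induct)
      case (add f g)
      then show ?case using a forms_add by auto
    next
      case (mult v g)
      then show ?case using m[OF mult(1) step.hyps mult(2) step.IH[OF mult(2)]] forms_mult[OF forms_var[OF mult(1)] mult(2)]
        by (simp add: add.commute)
    qed (use z in auto)
    then show ?case by simp
  qed
next
  case False
  then show ?thesis using forms_neg[OF _ assms(1)] z by simp
qed

lemma subst_mon_forms:
  assumes "\<And>v. v \<in> V \<Longrightarrow> g v \<in> forms U 1" "keys m \<subseteq> V"
  shows "subst_mon g m \<in> forms U (int (mon_deg m))"
proof -
  have "(\<Prod>v\<in>S. g v ^ lookup m v) \<in> forms U (int (\<Sum>v\<in>S. lookup m v))" if "finite S" "S \<subseteq> V" for S
    using that
  proof (induction S rule: finite_induct)
    case (insert x S)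
    then have "g x ^ lookup m x \<in> forms U (int (lookup m x) * 1)" using forms_power assms(1) by blast
    then show ?case using forms_mult[of "g x ^ lookup m x" U "int (lookup m x)"] insert by simp
  qed simp
  from this[of "keys m"] show ?thesis using assms(2) by (simp add: subst_mon_def mon_deg_def)
qed

lemma subst_poly_forms:
  assumes "f \<in> forms V i" "\<And>v. v \<in> V \<Longrightarrow> g v \<in> forms U 1"
  shows "subst_poly g f \<in> forms U i"
  using assms(1)
proof (induction rule: forms_induct)
  case (mult i v h)
  then show ?case using forms_mult[OF assms(2)[OF mult(1)] mult(4)] by (simp add: subst_poly_mult add.commute)
qed (simp_all add: subst_poly_add forms_add)

lemma subst_poly_id: "f \<in> forms V i \<Longrightarrow> subst_poly var f = f"
  by (induction rule: forms_induct) (simp_all add: subst_poly_simps)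

lemma subst_poly_cong: "f \<in> forms V i \<Longrightarrow> (\<And>v. v \<in> V \<Longrightarrow> g v = h v) \<Longrightarrow> subst_poly g f = subst_poly h f"
  by (induction rule: forms_induct) (simp_all add: subst_poly_simps)

lemma subst_poly_subst_poly: "f \<in> forms V i \<Longrightarrow> subst_poly g (subst_poly h f) = subst_poly (\<lambda>v. subst_poly g (h v)) f"
  by (induction rule: forms_induct) (simp_all add: subst_poly_simps)

lemma SR_diff: "f \<in> SR V \<Gamma> i \<Longrightarrow> g \<in> SR V \<Gamma> i \<Longrightarrow> f - g \<in> SR V \<Gamma> i"
  using SRT_diff[of f V \<Gamma> _ 0 i g] by simp

lemma SR_minus: "f \<in> SR V \<Gamma> i \<Longrightarrow> - f \<in> SR V \<Gamma> i"
  using SRT_minus[of f V \<Gamma> _ 0 i] by simp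

lemma subst_poly_cong_ideal:
  assumes f: "f \<in> forms V i" and dc: "down_closed \<Gamma>"
    and g: "\<And>v. v \<in> V \<Longrightarrow> g v \<in> forms V 1" "\<And>v. v \<in> V \<Longrightarrow> h v \<in> forms V 1"
    and d: "\<And>v. v \<in> V \<Longrightarrow> g v - h v \<in> SR V \<Gamma> 1"
  shows "subst_poly g f - subst_poly h f \<in> SR V \<Gamma> i"
  using f
proof (induction rule: forms_induct)
  case (add i a b)
  have "subst_poly g (a + b) - subst_poly h (a + b) = (subst_poly g a - subst_poly h a) + (subst_poly g b - subst_poly h b)" by (simp add: subst_poly_add)
  then show ?case using SR_add[OF add(3,4)] by simp
next
  case (mult i v a)
  have "subst_poly g (var v * a) - subst_poly h (var v * a) = g v * (subst_poly g a - subst_poly h a) + (g v - h v) * subst_poly h a"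
    by (simp add: subst_poly_mult algebra_simps)
  moreover have "g v * (subst_poly g a - subst_poly h a) \<in> SR V \<Gamma> (i + 1)"
    by (rule SR_mult'(1)[OF dc g(1)[OF mult(1)] mult(4)]) simp
  moreover have "(g v - h v) * subst_poly h a \<in> SR V \<Gamma> (i + 1)"
    by (rule SR_mult'(2)[OF dc subst_poly_forms[OF mult(3) g(2)] d[OF mult(1)]]) auto
  ultimately show ?case using SR_add by simp
qed simp_all

section \<open>Flag complexes and their face ideals\<close>

definition flag :: "'w set \<Rightarrow> ('w \<Rightarrow> 'w \<Rightarrow> bool) \<Rightarrow> 'w set set" where
  "flag W R = {C. C \<subseteq> W \<and> (\<forall>u\<in>C. \<forall>v\<in>C. u \<noteq> v \<longrightarrow> R u v)}"

lemma down_closed_flag [simp]: "down_closed (flag W R)"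
  unfolding down_closed_def flag_def by blast

lemma var_SR:
  "v \<in> V \<Longrightarrow> v \<notin> W \<Longrightarrow> var v \<in> SR V (flag W R) 1"
  using forms_var[of v V] by (auto simp: SR_def flag_def var_def)

lemma var_var_SR:
  assumes "v \<in> V" "w \<in> V" "v \<noteq> w" "\<not> R v w \<or> \<not> R w v"
  shows "var v * var w \<in> SR V (flag W R) 2"
proof -
  have "var v * var w \<in> forms V 2" using forms_mult[OF forms_var[OF assms(1)] forms_var[OF assms(2)]] by simp
  then show ?thesis using assms(3,4) by (auto simp: SR_def flag_def var_def mult_single keys_plus_nat)
qed

lemma split_var: "v \<in> keys m \<Longrightarrow> \<exists>n. m = single v (Suc 0) + n"
  by (rule exI[of _ "m - single v (Suc 0)"], rule poly_mapping_eqI)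
     (auto simp: lookup_add lookup_minus lookup_single when_def in_keys_iff)

text \<open>The ideal of a flag complex is generated by the variables outside \<open>W\<close> and
  the products of nonadjacent pairs, so only these are tested. The factor \<open>e\<close> allows
  the target to be an ideal quotient; it becomes \<open>xb\<close> when the star of the new vertex
  is treated.\<close>

lemma mult_subst_poly_SR:
  assumes dc: "down_closed \<Gamma>'" and W: "W \<subseteq> V" and g: "\<And>v. v \<in> V \<Longrightarrow> g v \<in> forms V 1" and e: "e \<in> forms V k"
    and nv: "\<And>v. v \<in> V \<Longrightarrow> v \<notin> W \<Longrightarrow> e * g v \<in> SR V \<Gamma>' (k + 1)"
    and ne: "\<And>v w. v \<in> W \<Longrightarrow> w \<in> W \<Longrightarrow> v \<noteq> w \<Longrightarrow> \<not> R v w \<Longrightarrow> e * (g v * g w) \<in> SR V \<Gamma>' (k + 2)"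
    and f: "f \<in> SR V (flag W R) i"
  shows "e * subst_poly g f \<in> SR V \<Gamma>' (k + i)"
proof -
  have mon: "e * subst_mon g m \<in> SR V \<Gamma>' (k + int (mon_deg m))" if m: "keys m \<subseteq> V" "keys m \<notin> flag W R" for m
  proof (cases "keys m \<subseteq> W")
    case False
    then obtain v where v: "v \<in> keys m" "v \<in> V" "v \<notin> W" using m by blast
    then obtain n where n: "m = single v (Suc 0) + n" using split_var[OF v(1)] by (elim exE)
    have "subst_mon g n \<in> forms V (int (mon_deg n))" by (rule subst_mon_forms[OF g]) (use m n in \<open>auto simp: keys_plus_nat\<close>)
    from SR_mult'(1)[OF dc this nv[OF v(2,3)] refl] show ?thesis
      by (simp add: n subst_mon_add mon_deg_add algebra_simps)
  next
    case True
    then obtain v w where v: "v \<in> keys m" "w \<in> keys m" "v \<noteq> w" "\<not> R v w" using m unfolding flag_def by blast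
    then obtain n where n: "m = single v (Suc 0) + n" using split_var[OF v(1)] by (elim exE)
    then have "w \<in> keys n" using v by (simp add: keys_plus_nat)
    from split_var[OF this] obtain l where l: "n = single w (Suc 0) + l" by (elim exE)
    have "subst_mon g l \<in> forms V (int (mon_deg l))" by (rule subst_mon_forms[OF g]) (use m n l in \<open>auto simp: keys_plus_nat\<close>)
    from SR_mult'(1)[OF dc this ne[OF _ _ v(3,4)] refl] True v show ?thesis
      by (simp add: n l subst_mon_add mon_deg_add algebra_simps subset_eq)
  qed
  have "e * (\<Sum>m\<in>S. const (lookup f m) * subst_mon g m) \<in> SR V \<Gamma>' (k + i)" if "finite S" "S \<subseteq> keys f" for S
    using that
  proof (induction S rule: finite_induct)
    case (insert m S)
    then have m: "keys m \<subseteq> V" "keys m \<notin> flag W R" "int (mon_deg m) = i" using f by (auto simp: SR_def forms_def)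
    have "const (lookup f m) * (e * subst_mon g m) \<in> SR V \<Gamma>' (k + i)"
      using SR_const_mult[OF mon[OF m(1,2)]] m(3) by simp
    with insert show ?case using SR_add[of "const (lookup f m) * (e * subst_mon g m)"] by (simp add: distrib_left mult_ac)
  qed simp
  from this[of "keys f"] show ?thesis by (simp add: subst_poly_def)
qed

lemma subst_poly_SR:
  assumes "down_closed \<Gamma>'" "W \<subseteq> V" "\<And>v. v \<in> V \<Longrightarrow> g v \<in> forms V 1"
    and "\<And>v. v \<in> V \<Longrightarrow> v \<notin> W \<Longrightarrow> g v \<in> SR V \<Gamma>' 1"
    and "\<And>v w. v \<in> W \<Longrightarrow> w \<in> W \<Longrightarrow> v \<noteq> w \<Longrightarrow> \<not> R v w \<Longrightarrow> g v * g w \<in> SR V \<Gamma>' 2"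
    and "f \<in> SR V (flag W R) i"
  shows "subst_poly g f \<in> SR V \<Gamma>' i"
  using mult_subst_poly_SR[of \<Gamma>' W V g 1 0 R f i] assms by simp

lemma lookup_single_mult: "lookup (single k 1 * f :: ('w, 'k::field) mpoly) (k + m) = lookup f m"
  by (induction f rule: poly_mapping_sum_induct)
     (simp_all add: distrib_left mult_single lookup_add lookup_single when_def)

lemma lookup_var_mult:
  fixes f :: "('w, 'k::field) mpoly"
  shows "lookup (var x * f) n = (if lookup n x = 0 then 0 else lookup f (n - single x (Suc 0)))"
proof (cases "lookup n x = 0")
  case True
  have "n \<notin> keys (var x * f)"
  proof
    assume "n \<in> keys (var x * f)"
    from keys_mult'[OF this] obtain a b where "a \<in> keys (var x :: ('w, 'k) mpoly)" "n = a + b" by (elim exE conjE)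
    then show False using True by (auto simp: var_def lookup_add)
  qed
  then show ?thesis using True by (simp add: in_keys_iff)
next
  case False
  have "n = single x (Suc 0) + (n - single x (Suc 0))"
    using False by (intro poly_mapping_eqI) (auto simp: lookup_add lookup_minus lookup_single when_def)
  then show ?thesis using False lookup_single_mult[of "single x 1" f "n - single x (Suc 0)"] by (simp add: var_def)
qed

text \<open>Take a term of \<open>v\<close> on a face with the largest exponent of the cone point
  \<open>a\<close>. After multiplication by \<open>var a\<close> it still lives on a face, and a
  cancelling term from \<open>var c * v\<close> would have to come from a term on a face with a
  larger exponent of \<open>a\<close>.\<close>

lemma var_diff_nonzerodivisor:
  assumes ac: "a \<in> V" "c \<in> V" "a \<noteq> c"
    and ins: "\<And>F. F \<in> \<Gamma> \<Longrightarrow> insert a F \<in> \<Gamma>" and dc: "down_closed \<Gamma>"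
    and v: "v \<in> forms V i" and p: "(var a - var c) * v \<in> SR V \<Gamma> j"
  shows "v \<in> SR V \<Gamma> i"
proof (rule ccontr)
  assume "v \<notin> SR V \<Gamma> i"
  define T where "T = {m \<in> keys v. keys m \<in> \<Gamma>}"
  have T: "finite T" "T \<noteq> {}" using \<open>v \<notin> SR V \<Gamma> i\<close> v by (auto simp: T_def SR_def)
  have "Max ((\<lambda>m. lookup m a) ` T) \<in> (\<lambda>m. lookup m a) ` T" using T by (intro Max_in) auto
  then obtain m where "m \<in> T" and e: "Max ((\<lambda>m. lookup m a) ` T) = lookup m a" by (elim imageE)
  moreover have "lookup m' a \<le> lookup m a" if "m' \<in> T" for m'
    unfolding e[symmetric] using T that by (intro Max_ge) auto
  ultimately have m: "m \<in> T" "\<And>m'. m' \<in> T \<Longrightarrow> lookup m' a \<le> lookup m a" by simp_all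
  define n where "n = single a (Suc 0) + m"
  have kn: "keys n = insert a (keys m)" by (simp add: n_def keys_plus_nat)
  have "insert a (keys m) \<in> \<Gamma>" using ins m(1) by (simp add: T_def)
  then have nG: "keys n \<in> \<Gamma>" using kn by simp
  have "lookup (var c * v) n = 0"
  proof (cases "lookup n c = 0")
    case False
    define m' where "m' = n - single c (Suc 0)"
    have "keys m' \<subseteq> keys n" by (auto simp: m'_def in_keys_iff lookup_minus)
    then have "keys m' \<in> \<Gamma>" using nG dc unfolding down_closed_def by blast
    moreover have "lookup m' a = Suc (lookup m a)"
      using ac(3) by (simp add: m'_def n_def lookup_minus lookup_add lookup_single when_def)
    ultimately have "m' \<notin> keys v" using m(2)[of m'] by (auto simp: T_def)
    then show ?thesis using False by (simp add: lookup_var_mult m'_def in_keys_iff)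
  qed (simp add: lookup_var_mult)
  moreover have "lookup (var a * v) n = lookup v m"
    using lookup_single_mult[of "single a 1" v m] by (simp add: var_def n_def)
  ultimately have "lookup ((var a - var c) * v) n \<noteq> 0"
    using m(1) by (simp add: left_diff_distrib lookup_minus T_def in_keys_iff)
  then have "n \<in> keys ((var a - var c) * v)" by (simp add: in_keys_iff)
  then show False using p nG by (simp add: SR_def)
qed

lemma SRT_cong: "(\<And>l. l < j \<Longrightarrow> \<theta> l = \<theta>' l) \<Longrightarrow> SRT V \<Gamma> \<theta> j i = SRT V \<Gamma> \<theta>' j i"
  by (induction j) simp_all

section \<open>Subdividing an edge of a flag complex\<close>

text \<open>The new vertex \<open>b\<close> subdivides the edge \<open>{a, c}\<close>, whose star is spanned by \<open>St\<close>. The argument \<open>dummy\<close> only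
  fixes the coefficient field.\<close>

locale edge_subdivision =
  fixes V W :: "'w set" and R R' :: "'w \<Rightarrow> 'w \<Rightarrow> bool" and a b c :: 'w and St :: "'w set" and dummy :: "'k::field itself"
  assumes W: "W \<subseteq> V" and bV: "b \<in> V" and bW: "b \<notin> W" and aW: "a \<in> W" and cW: "c \<in> W" and ac: "a \<noteq> c"
    and sym: "\<And>u v. R u v \<Longrightarrow> R v u" and Rac: "R a c"
    and St: "St = {v \<in> W. (v = a \<or> R v a) \<and> (v = c \<or> R v c)}"
    and R'W: "\<And>u v. u \<in> W \<Longrightarrow> v \<in> W \<Longrightarrow> u \<noteq> v \<Longrightarrow> R' u v \<longleftrightarrow> R u v \<and> {u, v} \<noteq> {a, c}"
    and R'b: "\<And>v. v \<in> W \<Longrightarrow> R' b v \<longleftrightarrow> v \<in> St" "\<And>v. v \<in> W \<Longrightarrow> R' v b \<longleftrightarrow> v \<in> St"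
begin

definition "\<Gamma> = flag W R"
definition "\<Gamma>s = flag St R"
definition "\<Gamma>' = flag (insert b W) R'"
text \<open>With the new vertex placed at the sum of the vectors of \<open>a\<close> and
  \<open>c\<close>, the piecewise linear function on the old complex that is 1 at \<open>a\<close>
  takes the value 1 at \<open>b\<close> too. Hence \<open>xa\<close> goes to \<open>xa + xb\<close>,
  and likewise for \<open>c\<close>. The vertex \<open>b\<close> is absent from the old complex, so
  its variable goes to 0.\<close>

definition phi_var :: "'w \<Rightarrow> ('w, 'k) mpoly" where
  "phi_var v = (if v = a then var a + var b else if v = c then var c + var b else if v = b then 0 else var v)"
definition phi :: "('w, 'k) mpoly \<Rightarrow> ('w, 'k) mpoly" where
  "phi = subst_poly phi_var"

abbreviation "xa \<equiv> (var a :: ('w, 'k) mpoly)"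
abbreviation "xb \<equiv> (var b :: ('w, 'k) mpoly)"
abbreviation "xc \<equiv> (var c :: ('w, 'k) mpoly)"

lemma dc: "down_closed \<Gamma>" "down_closed \<Gamma>s" "down_closed \<Gamma>'"
  by (simp_all add: \<Gamma>_def \<Gamma>s_def \<Gamma>'_def)

lemma inV: "a \<in> V" "b \<in> V" "c \<in> V" "a \<noteq> b" "c \<noteq> b" "b \<noteq> a" "b \<noteq> c" "c \<noteq> a" "a \<in> St" "c \<in> St" "St \<subseteq> V" "b \<notin> St"
  using W bV bW aW cW ac Rac sym St by auto

lemma x_forms: "xa \<in> forms V 1" "xb \<in> forms V 1" "xc \<in> forms V 1"
  using inV by simp_all

lemma phi_var_forms: "v \<in> V \<Longrightarrow> phi_var v \<in> forms V 1"
  unfolding phi_var_def using x_forms by (simp add: forms_add)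

lemma phi_forms: "f \<in> forms V i \<Longrightarrow> phi f \<in> forms V i"
  unfolding phi_def by (rule subst_poly_forms[OF _ phi_var_forms])

lemma phi_simps: "phi (f + g) = phi f + phi g" "phi (f - g) = phi f - phi g" "phi (- f) = - phi f"
    "phi (f * g) = phi f * phi g" "phi (f ^ n) = phi f ^ n" "phi 0 = 0" "phi 1 = 1" "phi (const k) = const k"
    "phi xa = xa + xb" "phi xc = xc + xb" "phi xb = 0"
  by (simp_all add: phi_def subst_poly_simps phi_var_def inV)

lemma nonadj:
  assumes "v \<in> V" "w \<in> V" "v \<noteq> w" "v \<notin> insert b W \<or> w \<notin> insert b W \<or> \<not> R' v w"
  shows "var v * var w \<in> SR V \<Gamma>' 2"
proof (cases "v \<in> insert b W \<and> w \<in> insert b W")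
  case True
  then show ?thesis unfolding \<Gamma>'_def using assms by (intro var_var_SR) auto
next
  case False
  then consider "v \<notin> insert b W" | "w \<notin> insert b W" by blast
  then show ?thesis
  proof cases
    case 1
    from SR_mult'(2)[OF dc(3) forms_var[OF assms(2)] var_SR[OF assms(1) 1, of R', folded \<Gamma>'_def], of 2] show ?thesis by simp
  next
    case 2
    from SR_mult'(1)[OF dc(3) forms_var[OF assms(1)] var_SR[OF assms(2) 2, of R', folded \<Gamma>'_def], of 2] show ?thesis by simp
  qed
qed

lemma xaxc: "xa * xc \<in> SR V \<Gamma>' 2"
  using R'W[of a c] aW cW ac inV by (intro nonadj) auto

text \<open>If one of the vertices is an end of the subdivided edge, the other is outside the star,
  so its product with \<open>xb\<close> vanishes along with the original product.\<close>

lemma phi_nonadj: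
  assumes vw: "v \<in> W" "w \<in> W" "v \<noteq> w" "\<not> R v w"
  shows "phi_var v * phi_var w \<in> SR V \<Gamma>' 2"
proof -
  have nR: "\<not> R w v" using sym vw(4) by blast
  have vV: "v \<in> V" "w \<in> V" "v \<noteq> b" "w \<noteq> b" using vw W bW by auto
  have b: "var b * var u \<in> SR V \<Gamma>' 2" if "u \<in> W" "u \<notin> St" for u
    using that inV W R'b bW by (intro nonadj) auto
  have n1: "var v * var w \<in> SR V \<Gamma>' 2" using vw vV R'W by (intro nonadj) auto
  consider "v = a" "w \<noteq> c" | "v = c" "w \<noteq> a" | "w = a" "v \<noteq> c" | "w = c" "v \<noteq> a" | "v \<notin> {a, c}" "w \<notin> {a, c}"
    using vw Rac nR by blast
  then show ?thesis
  proof cases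
    case 1
    then have "w \<notin> St" using nR vw(3) St by auto
    from SR_add[OF n1 b[OF vw(2) this]] 1 vw(3) vV show ?thesis by (simp add: phi_var_def algebra_simps)
  next
    case 2
    then have "w \<notin> St" using nR vw(3) St by auto
    from SR_add[OF n1 b[OF vw(2) this]] 2 vw(3) vV inV show ?thesis by (simp add: phi_var_def algebra_simps)
  next
    case 3
    then have "v \<notin> St" using vw St by auto
    from SR_add[OF n1 b[OF vw(1) this]] 3 vw(3) vV show ?thesis by (simp add: phi_var_def algebra_simps)
  next
    case 4
    then have "v \<notin> St" using vw St by auto
    from SR_add[OF n1 b[OF vw(1) this]] 4 vw(3) vV inV show ?thesis by (simp add: phi_var_def algebra_simps)
  next
    case 5
    then show ?thesis using n1 vV by (simp add: phi_var_def)
  qed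
qed

lemma phi_SR: assumes "f \<in> SR V \<Gamma> i" shows "phi f \<in> SR V \<Gamma>' i"
  unfolding phi_def
proof (rule subst_poly_SR[OF dc(3) W phi_var_forms _ _ assms[unfolded \<Gamma>_def]])
  show "phi_var v \<in> SR V \<Gamma>' 1" if v: "v \<in> V" "v \<notin> W" for v
  proof (cases "v = b")
    case True then show ?thesis by (simp add: phi_var_def inV)
  next
    case False
    then have "v \<notin> insert b W" "v \<noteq> a" "v \<noteq> c" using v aW cW by auto
    then show ?thesis using var_SR[OF v(1), of "insert b W" R'] False by (simp add: phi_var_def \<Gamma>'_def)
  qed
qed (assumption | rule phi_nonadj)+

text \<open>Multiplication by \<open>xb\<close> only sees the star of \<open>b\<close>, so the
  second summand depends on its coefficient modulo the ideal of the old star only.\<close>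

lemma phi_SR_star: assumes "f \<in> SR V \<Gamma>s i" shows "xb * phi f \<in> SR V \<Gamma>' (i + 1)"
proof -
  have "xb * subst_poly phi_var f \<in> SR V \<Gamma>' (1 + i)"
  proof (rule mult_subst_poly_SR[OF dc(3) inV(11) phi_var_forms x_forms(2) _ _ assms[unfolded \<Gamma>s_def]])
    show "xb * phi_var v \<in> SR V \<Gamma>' (1 + 1)" if v: "v \<in> V" "v \<notin> St" for v
    proof (cases "v = b")
      case False
      then have "v \<noteq> a" "v \<noteq> c" using v inV by auto
      moreover have "xb * var v \<in> SR V \<Gamma>' 2"
        using v False inV R'b by (intro nonadj) auto
      ultimately show ?thesis using False by (simp add: phi_var_def)
    qed (simp add: phi_var_def inV)
    show "xb * (phi_var v * phi_var w) \<in> SR V \<Gamma>' (1 + 2)" if v: "v \<in> St" "w \<in> St" "v \<noteq> w" "\<not> R v w" for v w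
      by (rule SR_mult[OF dc(3) x_forms(2) phi_nonadj]) (use v St in auto)
  qed
  then show ?thesis by (simp add: phi_def add.commute)
qed

text \<open>The vanishing product \<open>xa * xc\<close> reads
  \<open>(phi xa - xb) * (phi xc - xb) = 0\<close>, so \<open>xb\<close> satisfies a monic quadratic
  equation over the image of \<open>phi\<close>: its square is
  \<open>xb * phi (xa + xc) - phi (xa * xc)\<close>. The witnesses in the four cases are obtained by
  reducing with this equation.\<close>

lemma phi_decomp:
  assumes "f \<in> forms V i"
  shows "\<exists>u v. u \<in> forms V i \<and> v \<in> forms V (i - 1) \<and> f - (phi u + xb * phi v) \<in> SR V \<Gamma>' i"
  using assms
proof (induction rule: forms_induct)
  case (zero i)
  show ?case by (rule exI[of _ 0], rule exI[of _ 0]) (simp add: phi_simps)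
next
  case (const k)
  show ?case by (rule exI[of _ "Defs.const k"], rule exI[of _ 0]) (simp add: phi_simps)
next
  case (add i f g)
  then obtain u v u' v' where 1: "u \<in> forms V i" "v \<in> forms V (i - 1)" "f - (phi u + xb * phi v) \<in> SR V \<Gamma>' i"
    and 2: "u' \<in> forms V i" "v' \<in> forms V (i - 1)" "g - (phi u' + xb * phi v') \<in> SR V \<Gamma>' i" by (elim exE conjE)
  have eq: "f + g - (phi (u + u') + xb * phi (v + v')) = (f - (phi u + xb * phi v)) + (g - (phi u' + xb * phi v'))"
    by (simp add: phi_simps algebra_simps)
  have "f + g - (phi (u + u') + xb * phi (v + v')) \<in> SR V \<Gamma>' i" unfolding eq by (rule SR_add[OF 1(3) 2(3)])
  then show ?case using forms_add[OF 1(1) 2(1)] forms_add[OF 1(2) 2(2)] by (intro exI conjI)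
next
  case (mult i x g)
  then obtain u v where uv: "u \<in> forms V i" "v \<in> forms V (i - 1)" "g - (phi u + xb * phi v) \<in> SR V \<Gamma>' i"
    by (elim exE conjE)
  define r where "r = g - (phi u + xb * phi v)"
  have g: "g = phi u + xb * phi v + r" by (simp add: r_def)
  have xr: "var x * r \<in> SR V \<Gamma>' (i + 1)"
    by (rule SR_mult'(1)[OF dc(3) forms_var[OF mult(1)] uv(3)[folded r_def]]) simp
  have q: "xa * xc * phi v \<in> SR V \<Gamma>' (i + 1)"
    by (rule SR_mult'(2)[OF dc(3) phi_forms[OF uv(2)] xaxc]) simp
  have m1: "var y * u \<in> forms V (i + 1)" if "y \<in> V" for y
    using forms_mult[OF forms_var[OF that] uv(1)] by (simp add: add.commute)
  have m2: "var y * v \<in> forms V i" if "y \<in> V" for y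
    using forms_mult[OF forms_var[OF that] uv(2)] by simp
  have m3: "xa * (xc * v) \<in> forms V (i + 1)"
    using forms_mult[OF x_forms(1) m2[OF inV(3)]] by (simp add: add.commute)
  have fin: ?case if "u' \<in> forms V (i + 1)" "v' \<in> forms V i" "var x * g - (phi u' + xb * phi v') = e" "e \<in> SR V \<Gamma>' (i + 1)" for u' v' e
    by (rule exI[of _ u'], rule exI[of _ v']) (use that in simp)
  consider "x = a" | "x = c" | "x = b" | "x \<notin> {a, b, c}" by blast
  then show ?case
  proof cases
    case 1
    show ?thesis
    proof (rule fin)
      show "xa * u + xa * (xc * v) \<in> forms V (i + 1)" using m1[OF inV(1)] m3 by (rule forms_add)
      show "- u - xc * v \<in> forms V i" using forms_diff[OF forms_minus[OF uv(1)] m2[OF inV(3)]] .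
      show "var x * g - (phi (xa * u + xa * (xc * v)) + xb * phi (- u - xc * v)) = var x * r - xa * xc * phi v"
        unfolding 1 g by (simp add: phi_simps algebra_simps)
      show "var x * r - xa * xc * phi v \<in> SR V \<Gamma>' (i + 1)" by (rule SR_diff[OF xr q])
    qed
  next
    case 2
    show ?thesis
    proof (rule fin)
      show "xc * u + xa * (xc * v) \<in> forms V (i + 1)" using m1[OF inV(3)] m3 by (rule forms_add)
      show "- u - xa * v \<in> forms V i" using forms_diff[OF forms_minus[OF uv(1)] m2[OF inV(1)]] .
      show "var x * g - (phi (xc * u + xa * (xc * v)) + xb * phi (- u - xa * v)) = var x * r - xa * xc * phi v"
        unfolding 2 g by (simp add: phi_simps algebra_simps)
      show "var x * r - xa * xc * phi v \<in> SR V \<Gamma>' (i + 1)" by (rule SR_diff[OF xr q])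
    qed
  next
    case 3
    show ?thesis
    proof (rule fin)
      show "- (xa * (xc * v)) \<in> forms V (i + 1)" using m3 by (rule forms_minus)
      show "u + (xa * v + xc * v) \<in> forms V i" by (intro forms_add uv m2 inV)
      show "var x * g - (phi (- (xa * (xc * v))) + xb * phi (u + (xa * v + xc * v))) = var x * r + xa * xc * phi v"
        unfolding 3 g by (simp add: phi_simps algebra_simps)
      show "var x * r + xa * xc * phi v \<in> SR V \<Gamma>' (i + 1)" by (rule SR_add[OF xr q])
    qed
  next
    case 4
    then have px: "phi (var x) = var x" by (simp add: phi_def phi_var_def)
    show ?thesis
    proof (rule fin)
      show "var x * u \<in> forms V (i + 1)" by (rule m1[OF mult(1)])
      show "var x * v \<in> forms V i" by (rule m2[OF mult(1)])
      show "var x * g - (phi (var x * u) + xb * phi (var x * v)) = var x * r"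
        unfolding g by (simp add: phi_simps px algebra_simps)
    qed (rule xr)
  qed
qed

end

section \<open>The sum decomposition is direct and passes to quotients\<close>

context edge_subdivision
begin

abbreviation X :: "'w \<Rightarrow> ('w, 'k) mpoly" where "X \<equiv> var"

text \<open>Restriction to the star of \<open>{x, b}\<close>, with \<open>b\<close> renamed to \<open>y\<close>; a section of \<open>phi\<close> modulo the ideal of the star.\<close>

definition rho :: "'w \<Rightarrow> 'w \<Rightarrow> 'w \<Rightarrow> ('w, 'k) mpoly" where
  "rho x y v = (if v = x then X x - X y else if v = y then 0 else if v = b then X y else X v)"

lemma rho_forms: "x \<in> V \<Longrightarrow> y \<in> V \<Longrightarrow> v \<in> V \<Longrightarrow> rho x y v \<in> forms V 1"
  unfolding rho_def by (simp add: forms_diff)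

lemma not_St: "v \<in> V \<Longrightarrow> v \<notin> St \<Longrightarrow> X v \<in> SR V \<Gamma>s 1"
  unfolding \<Gamma>s_def by (rule var_SR)

lemma nonadj_St:
  assumes "v \<in> V" "w \<in> V" "v \<noteq> w" "v \<notin> St \<or> w \<notin> St \<or> \<not> R v w"
  shows "X v * X w \<in> SR V \<Gamma>s 2"
proof (cases "v \<in> St \<and> w \<in> St")
  case True
  then show ?thesis unfolding \<Gamma>s_def using assms by (intro var_var_SR) auto
next
  case False
  then consider "v \<notin> St" | "w \<notin> St" by blast
  then show ?thesis
  proof cases
    case 1
    from SR_mult'(2)[OF dc(2) forms_var[OF assms(2)] not_St[OF assms(1) 1], of 2] show ?thesis by simp
  next
    case 2
    from SR_mult'(1)[OF dc(2) forms_var[OF assms(1)] not_St[OF assms(2) 2], of 2] show ?thesis by simp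
  qed
qed

lemma rho_SR:
  assumes xy: "{x, y} = {a, c}" "x \<noteq> y" and f: "f \<in> SR V \<Gamma>' i"
  shows "subst_poly (rho x y) f \<in> SR V \<Gamma>s i"
proof (rule subst_poly_SR[OF dc(2) _ _ _ _ f[unfolded \<Gamma>'_def]])
  have x: "x \<in> V" "y \<in> V" "x \<noteq> b" "y \<noteq> b" "x \<in> St" "y \<in> St" "x \<in> W" "y \<in> W"
    using xy inV aW cW by (auto simp: doubleton_eq_iff)
  show "insert b W \<subseteq> V" using W bV by auto
  show "rho x y v \<in> forms V 1" if "v \<in> V" for v using rho_forms x that by simp
  show "rho x y v \<in> SR V \<Gamma>s 1" if v: "v \<in> V" "v \<notin> insert b W" for v
  proof -
    have "v \<noteq> x" "v \<noteq> y" "v \<noteq> b" "v \<notin> St" using v x St by auto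
    then show ?thesis using not_St[OF v(1)] by (simp add: rho_def)
  qed
  have yv: "X y * X v \<in> SR V \<Gamma>s 2" "(X x - X y) * X v \<in> SR V \<Gamma>s 2"
    if "v \<in> V" "v \<notin> St" for v
  proof -
    have "X x * X v \<in> SR V \<Gamma>s 2" using nonadj_St[of x v] that x by auto
    moreover show "X y * X v \<in> SR V \<Gamma>s 2" using nonadj_St[of y v] that x by auto
    ultimately show "(X x - X y) * X v \<in> SR V \<Gamma>s 2" by (simp add: left_diff_distrib SR_diff)
  qed
  have nSt: "v \<notin> St" if "v \<in> W" "v \<noteq> x" "v \<noteq> y" "\<not> R x v \<or> \<not> R v x" for v
    using that xy sym St by (auto simp: doubleton_eq_iff)
  have half: "rho x y v * rho x y w \<in> SR V \<Gamma>s 2"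
    if "v \<in> insert b W" "w \<in> insert b W" and ne: "v \<noteq> w" and "\<not> R' v w \<and> \<not> R' w v" and o: "v \<in> {x, b} \<or> (v \<notin> {x, b} \<and> w \<notin> {x, b})" for v w
  proof -
    have vV: "v \<in> V" "w \<in> V" using that W bV by auto
    consider "v = y \<or> w = y" | "v = x" "w = b" | "v = b" "w = x" | "v = b" "w \<notin> {x, y, b}" | "v = x" "w \<notin> {x, y, b}"
      | "v \<notin> {x, y, b}" "w \<notin> {x, y, b}" using ne o by blast
    then show ?thesis
    proof cases
      case 1 then show ?thesis using x xy(2) by (auto simp: rho_def)
    next
      case 2 then show ?thesis using that R'b(2)[of x] x by simp
    next
      case 3 then show ?thesis using that R'b(1)[of x] x by simp
    next
      case 4
      then have "w \<notin> St" using that R'b(1)[of w] by auto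
      then show ?thesis using 4 yv[OF vV(2)] x by (simp add: rho_def)
    next
      case 5
      then have "\<not> R x w \<or> \<not> R w x" using that R'W[of x w] x xy by auto
      then have "w \<notin> St" using 5 that nSt[of w] by auto
      then show ?thesis using 5 yv[OF vV(2)] x by (simp add: rho_def)
    next
      case 6
      then have "v \<in> W" "w \<in> W" using that by auto
      then have "\<not> R v w" using 6 that R'W[of v w] xy by auto
      then show ?thesis using 6 nonadj_St[OF vV that(3)] by (simp add: rho_def)
    qed
  qed
  show "rho x y v * rho x y w \<in> SR V \<Gamma>s 2"
    if vw: "v \<in> insert b W" "w \<in> insert b W" "v \<noteq> w" "\<not> R' v w" for v w
  proof -
    have "\<not> R' w v"
    proof (cases "v = b \<or> w = b")
      case True then show ?thesis using vw R'b bW by auto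
    next
      case False
      then have "v \<in> W" "w \<in> W" using vw by auto
      moreover have "{w, v} = {v, w}" by auto
      ultimately show ?thesis using vw(3,4) R'W[of v w] R'W[of w v] sym by auto
    qed
    then show ?thesis
      using half[of v w] half[of w v] vw by (cases "v \<in> {x, b}"; cases "w \<in> {x, b}") (auto simp: mult.commute)
  qed
qed

lemma subst_poly_subst_poly_phi: "f \<in> forms V i \<Longrightarrow> subst_poly g (phi f) = subst_poly (\<lambda>v. subst_poly g (phi_var v)) f"
  unfolding phi_def by (rule subst_poly_subst_poly)

lemma rho_phi:
  assumes xy: "{x, y} = {a, c}" "x \<noteq> y" and f: "f \<in> forms V i"
  shows "subst_poly (rho x y) (phi f) - f \<in> SR V \<Gamma>s i"
proof -
  have x: "x \<in> V" "y \<in> V" "x \<noteq> b" "y \<noteq> b" using xy inV by (auto simp: doubleton_eq_iff)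
  have "subst_poly (\<lambda>v. subst_poly (rho x y) (phi_var v)) f - subst_poly var f \<in> SR V \<Gamma>s i"
  proof (rule subst_poly_cong_ideal[OF f dc(2)])
    show "subst_poly (rho x y) (phi_var v) \<in> forms V 1" if "v \<in> V" for v
      by (rule subst_poly_forms[OF phi_var_forms[OF that] rho_forms[OF x(1,2)]])
    show "subst_poly (rho x y) (phi_var v) - X v \<in> SR V \<Gamma>s 1" if "v \<in> V" for v
    proof (cases "v = b")
      case True then show ?thesis using SR_minus[OF not_St[OF inV(2,12)]] by (simp add: phi_var_def inV)
    next
      case False
      have "subst_poly (rho x y) (phi_var v) = X v"
        using xy x inV False by (auto simp: phi_var_def rho_def subst_poly_add doubleton_eq_iff)
      then show ?thesis by simp
    qed
  qed simp
  then show ?thesis by (simp add: subst_poly_subst_poly_phi[OF f] subst_poly_id[OF f])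
qed

lemma insert_St: "F \<in> \<Gamma>s \<Longrightarrow> insert a F \<in> \<Gamma>s"
proof -
  have "R v a \<and> R a v" if "v \<in> St" "v \<noteq> a" for v using that St sym by auto
  moreover assume "F \<in> \<Gamma>s"
  ultimately show "insert a F \<in> \<Gamma>s" using inV(9) by (auto simp: \<Gamma>s_def flag_def subset_eq)
qed

text \<open>Restriction to the two halves of the new star sends \<open>xb\<close> to
  \<open>xc\<close> and to \<open>xa\<close>, so both \<open>u + xc * v\<close> and
  \<open>u + xa * v\<close> vanish on the old star. Their difference is \<open>(xa - xc) * v\<close>
  up to sign, and \<open>a\<close> is a cone point of the star, so \<open>v\<close> vanishes there.
  Then so does \<open>u\<close>, and setting \<open>xb\<close> to 0 treats the faces not containing
  the edge.\<close>

lemma phi_unique: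
  assumes u: "u \<in> forms V i" and v: "v \<in> forms V (i - 1)" and z: "phi u + xb * phi v \<in> SR V \<Gamma>' i"
  shows "u \<in> SR V \<Gamma> i" "v \<in> SR V \<Gamma>s (i - 1)"
proof -
  have st: "u + X y * v \<in> SR V \<Gamma>s i" if xy: "{x, y} = {a, c}" "x \<noteq> y" for x y
  proof -
    have y: "y \<in> V" "y \<noteq> b" "x \<noteq> b" using xy inV by (auto simp: doubleton_eq_iff)
    have 1: "subst_poly (rho x y) (phi u) + X y * subst_poly (rho x y) (phi v) \<in> SR V \<Gamma>s i"
      using rho_SR[OF xy z] y by (simp add: subst_poly_simps rho_def)
    have 2: "subst_poly (rho x y) (phi u) - u \<in> SR V \<Gamma>s i" by (rule rho_phi[OF xy u])
    have 3: "X y * (subst_poly (rho x y) (phi v) - v) \<in> SR V \<Gamma>s i"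
      by (rule SR_mult'(1)[OF dc(2) forms_var[OF y(1)] rho_phi[OF xy v]]) simp
    from SR_diff[OF SR_diff[OF 1 2] 3] show ?thesis by (simp add: algebra_simps)
  qed
  have "u + X c * v \<in> SR V \<Gamma>s i" using st[of a c] ac by simp
  moreover have uav: "u + X a * v \<in> SR V \<Gamma>s i" using st[of c a] ac by (simp add: insert_commute)
  ultimately have p: "(X a - X c) * v \<in> SR V \<Gamma>s i"
    using SR_diff[of "u + X a * v" V \<Gamma>s i "u + X c * v"] by (simp add: algebra_simps)
  show vs: "v \<in> SR V \<Gamma>s (i - 1)"
    by (rule var_diff_nonzerodivisor[OF inV(1,3) ac _ dc(2) v p]) (rule insert_St)
  have "X a * v \<in> SR V \<Gamma>s i" by (rule SR_mult'(1)[OF dc(2) x_forms(1) vs]) simp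
  from SR_diff[OF uav this] have us: "u \<in> SR V \<Gamma>s i" by simp
  have "xb * phi v \<in> SR V \<Gamma>' i" using phi_SR_star[OF vs] by simp
  from SR_diff[OF z this] have pu: "phi u \<in> SR V \<Gamma>' i" by simp
  define z0 where "z0 v = (if v = b then 0 else X v )" for v
  have z0h: "z0 v \<in> forms V 1" if "v \<in> V" for v using that by (simp add: z0_def)
  have 0: "subst_poly z0 (phi u) \<in> SR V \<Gamma>' i"
  proof (rule subst_poly_SR[OF dc(3) _ z0h _ _ pu[unfolded \<Gamma>'_def]])
    show "insert b W \<subseteq> V" using W bV by auto
    then show "z0 v * z0 w \<in> SR V \<Gamma>' 2"
      if "v \<in> insert b W" "w \<in> insert b W" "v \<noteq> w" "\<not> R' v w" for v w
      using that nonadj[of v w] by (auto simp: z0_def)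
    show "z0 v \<in> SR V \<Gamma>' 1" if "v \<in> V" "v \<notin> insert b W" for v
      using var_SR[OF that, of R'] that by (simp add: z0_def \<Gamma>'_def)
  qed
  have diff: "subst_poly z0 (phi u) - u \<in> SR V (flag S Q) i" if "b \<notin> S" for S Q
  proof -
    have "subst_poly (\<lambda>v. subst_poly z0 (phi_var v)) u - subst_poly var u \<in> SR V (flag S Q) i"
    proof (rule subst_poly_cong_ideal[OF u down_closed_flag])
      show "subst_poly z0 (phi_var v) \<in> forms V 1" if "v \<in> V" for v
        by (rule subst_poly_forms[OF phi_var_forms[OF that] z0h])
      show "subst_poly z0 (phi_var v) - X v \<in> SR V (flag S Q) 1" if "v \<in> V" for v
      proof (cases "v = b")
        case True then show ?thesis using SR_minus[OF var_SR[OF bV \<open>b \<notin> S\<close>]] by (simp add: phi_var_def inV)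
      next
        case False
        then have "subst_poly z0 (phi_var v) = X v" by (auto simp: phi_var_def z0_def subst_poly_add inV)
        then show ?thesis by simp
      qed
    qed simp
    then show ?thesis by (simp add: subst_poly_subst_poly_phi[OF u] subst_poly_id[OF u])
  qed
  have 1: "subst_poly z0 (phi u) \<in> SR V \<Gamma>s i"
    using SR_add[OF us diff[OF inV(12), of R, folded \<Gamma>s_def]] by simp
  \<comment> \<open>An old face that is no longer a face contains both \<open>a\<close> and
    \<open>c\<close>, hence lies in the star; so the two ideals already treated together give the
    old one.\<close>
  have "subst_poly z0 (phi u) \<in> SR V \<Gamma> i"
  proof -
    have "keys m \<notin> \<Gamma>" if m: "m \<in> keys (subst_poly z0 (phi u))" for m
    proof
      assume mG: "keys m \<in> \<Gamma>"
      have m': "keys m \<notin> \<Gamma>'" "keys m \<notin> \<Gamma>s" using m 0 1 by (auto simp: SR_def)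
      have mW: "keys m \<subseteq> W" "\<And>p q. p \<in> keys m \<Longrightarrow> q \<in> keys m \<Longrightarrow> p \<noteq> q \<Longrightarrow> R p q"
        using mG by (auto simp: \<Gamma>_def flag_def)
      then obtain p q where "p \<in> keys m" "q \<in> keys m" "p \<noteq> q" "\<not> R' p q"
        using m'(1) unfolding \<Gamma>'_def flag_def by blast
      then have "{p, q} = {a, c}" using R'W[of p q] mW by blast
      then have "a \<in> keys m" "c \<in> keys m" using \<open>p \<in> keys m\<close> \<open>q \<in> keys m\<close> by (auto simp: doubleton_eq_iff)
      then have "keys m \<subseteq> St" using mW St by auto
      then have "keys m \<in> \<Gamma>s" using mW(2) by (simp add: \<Gamma>s_def flag_def)
      then show False using m' by simp
    qed
    then show ?thesis using SR_forms[OF 0] by (simp add: SR_def)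
  qed
  from SR_diff[OF this diff[OF bW, of R, folded \<Gamma>_def]] show "u \<in> SR V \<Gamma> i" by simp
qed

lemma phi_SRT: "u \<in> SRT V \<Gamma> \<theta> j i \<Longrightarrow> phi u \<in> SRT V \<Gamma>' (\<lambda>l. phi (\<theta> l)) j i"
proof (induction j arbitrary: u)
  case (Suc j)
  then obtain e p where *: "u = e + \<theta> j * p" "e \<in> SRT V \<Gamma> \<theta> j i" "p \<in> forms V (i - 1)" by auto
  have "phi u = phi e + phi (\<theta> j) * phi p" by (simp add: * phi_simps)
  then show ?case using Suc.IH[OF *(2)] phi_forms[OF *(3)] by auto
qed (simp add: phi_SR)

lemma phi_SRT_star: "v \<in> SRT V \<Gamma>s \<theta> j (i - 1) \<Longrightarrow> xb * phi v \<in> SRT V \<Gamma>' (\<lambda>l. phi (\<theta> l)) j i"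
proof (induction j arbitrary: v)
  case (Suc j)
  then obtain e p where *: "v = e + \<theta> j * p" "e \<in> SRT V \<Gamma>s \<theta> j (i - 1)" "p \<in> forms V (i - 1 - 1)" by auto
  have "xb * phi v = xb * phi e + phi (\<theta> j) * (xb * phi p)" by (simp add: * phi_simps algebra_simps)
  moreover have "xb * phi p \<in> forms V (i - 1)" using forms_mult[OF x_forms(2) phi_forms[OF *(3)]] by simp
  ultimately show ?case using Suc.IH[OF *(2)] by auto
next
  case 0
  then show ?case using phi_SR_star[of v "i - 1"] by simp
qed

text \<open>The multiplier of \<open>phi (\<theta> j)\<close> is an arbitrary form of the larger
  ring. It has to be decomposed itself before the parameters can be collected in the two
  summands.\<close>

lemma SRT_phi_decomp:
  assumes lin: "\<And>l. \<theta> l \<in> forms V 1"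
  shows "e \<in> SRT V \<Gamma>' (\<lambda>l. phi (\<theta> l)) j i \<Longrightarrow>
    \<exists>u v. u \<in> SRT V \<Gamma> \<theta> j i \<and> v \<in> SRT V \<Gamma>s \<theta> j (i - 1) \<and> e - (phi u + xb * phi v) \<in> SR V \<Gamma>' i"
proof (induction j arbitrary: e)
  case 0
  then show ?case by (intro exI[of _ 0]) (simp add: phi_simps)
next
  case (Suc j)
  then obtain e' p where e: "e = e' + phi (\<theta> j) * p" "e' \<in> SRT V \<Gamma>' (\<lambda>l. phi (\<theta> l)) j i" "p \<in> forms V (i - 1)" by auto
  from Suc.IH[OF e(2)] obtain u v where uv: "u \<in> SRT V \<Gamma> \<theta> j i" "v \<in> SRT V \<Gamma>s \<theta> j (i - 1)"
    "e' - (phi u + xb * phi v) \<in> SR V \<Gamma>' i" by (elim exE conjE)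
  from phi_decomp[OF e(3)] obtain u' v' where uv': "u' \<in> forms V (i - 1)" "v' \<in> forms V (i - 1 - 1)"
    "p - (phi u' + xb * phi v') \<in> SR V \<Gamma>' (i - 1)" by (elim exE conjE)
  show ?case
  proof (intro exI conjI)
    show "u + \<theta> j * u' \<in> SRT V \<Gamma> \<theta> (Suc j) i" using uv uv' by auto
    show "v + \<theta> j * v' \<in> SRT V \<Gamma>s \<theta> (Suc j) (i - 1)" using uv uv' by auto
    have eq: "e - (phi (u + \<theta> j * u') + xb * phi (v + \<theta> j * v')) =
        (e' - (phi u + xb * phi v)) + phi (\<theta> j) * (p - (phi u' + xb * phi v'))"
      by (simp add: e(1) phi_simps algebra_simps)
    have "phi (\<theta> j) * (p - (phi u' + xb * phi v')) \<in> SR V \<Gamma>' i"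
      by (rule SR_mult'(1)[OF dc(3) phi_forms[OF lin] uv'(3)]) simp
    then show "e - (phi (u + \<theta> j * u') + xb * phi (v + \<theta> j * v')) \<in> SR V \<Gamma>' i"
      unfolding eq using uv(3) by (intro SR_add)
  qed
qed

lemma SRT_phi_iff:
  assumes lin: "\<And>l. \<theta> l \<in> forms V 1" and u: "u \<in> forms V i" and v: "v \<in> forms V (i - 1)"
  shows "phi u + xb * phi v \<in> SRT V \<Gamma>' (\<lambda>l. phi (\<theta> l)) j i \<longleftrightarrow> u \<in> SRT V \<Gamma> \<theta> j i \<and> v \<in> SRT V \<Gamma>s \<theta> j (i - 1)"
proof
  assume "phi u + xb * phi v \<in> SRT V \<Gamma>' (\<lambda>l. phi (\<theta> l)) j i"
  from SRT_phi_decomp[OF lin this] obtain u' v' where uv': "u' \<in> SRT V \<Gamma> \<theta> j i" "v' \<in> SRT V \<Gamma>s \<theta> j (i - 1)"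
    "phi u + xb * phi v - (phi u' + xb * phi v') \<in> SR V \<Gamma>' i" by (elim exE conjE)
  have eq: "phi u + xb * phi v - (phi u' + xb * phi v') = phi (u - u') + xb * phi (v - v')"
    by (simp add: phi_simps algebra_simps)
  have "u - u' \<in> forms V i" using forms_diff[OF u SRT_forms[of \<theta>, OF lin uv'(1)]] .
  moreover have "v - v' \<in> forms V (i - 1)" using forms_diff[OF v SRT_forms[of \<theta>, OF lin uv'(2)]] .
  ultimately have "u - u' \<in> SR V \<Gamma> i" "v - v' \<in> SR V \<Gamma>s (i - 1)"
    using phi_unique uv'(3)[unfolded eq] by simp_all
  then have "(u - u') + u' \<in> SRT V \<Gamma> \<theta> j i" "(v - v') + v' \<in> SRT V \<Gamma>s \<theta> j (i - 1)"
    using SRT_add[OF SRT_SR[where \<theta> = \<theta>] uv'(1)] SRT_add[OF SRT_SR[where \<theta> = \<theta>] uv'(2)] by blast+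
  then show "u \<in> SRT V \<Gamma> \<theta> j i \<and> v \<in> SRT V \<Gamma>s \<theta> j (i - 1)" by simp
next
  assume "u \<in> SRT V \<Gamma> \<theta> j i \<and> v \<in> SRT V \<Gamma>s \<theta> j (i - 1)"
  then show "phi u + xb * phi v \<in> SRT V \<Gamma>' (\<lambda>l. phi (\<theta> l)) j i"
    by (intro SRT_add phi_SRT phi_SRT_star) auto
qed

text \<open>Multiplication by an element of the image of \<open>phi\<close> acts on both summands
  separately; regularity and Lefschetz conditions for parameters of the form
  \<open>phi (\<theta> j)\<close> therefore split.\<close>

lemma SRT_phi_mult_iff:
  assumes lin: "\<And>l. \<theta> l \<in> forms V 1" and u: "u \<in> forms V i" and v: "v \<in> forms V (i - 1)"
    and f: "f - (phi u + xb * phi v) \<in> SR V \<Gamma>' i" and g: "g \<in> forms V k"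
  shows "phi g * f \<in> SRT V \<Gamma>' (\<lambda>l. phi (\<theta> l)) j (i + k) \<longleftrightarrow>
    g * u \<in> SRT V \<Gamma> \<theta> j (i + k) \<and> g * v \<in> SRT V \<Gamma>s \<theta> j (i - 1 + k)"
proof -
  have d: "phi g * (f - (phi u + xb * phi v)) \<in> SRT V \<Gamma>' (\<lambda>l. phi (\<theta> l)) j (i + k)"
    by (rule SRT_SR, rule SR_mult'(1)[OF dc(3) phi_forms[OF g] f]) simp
  have "phi g * f = (phi (g * u) + xb * phi (g * v)) + phi g * (f - (phi u + xb * phi v))"
    "phi (g * u) + xb * phi (g * v) = phi g * f - phi g * (f - (phi u + xb * phi v))"
    by (simp_all add: phi_simps algebra_simps)
  then have "phi g * f \<in> SRT V \<Gamma>' (\<lambda>l. phi (\<theta> l)) j (i + k) \<longleftrightarrow>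
      phi (g * u) + xb * phi (g * v) \<in> SRT V \<Gamma>' (\<lambda>l. phi (\<theta> l)) j (i + k)"
    using SRT_add[OF _ d] SRT_diff[OF _ d] by metis
  moreover have "g * u \<in> forms V (i + k)" using forms_mult[OF g u] by (simp add: add.commute)
  moreover have "g * v \<in> forms V (i + k - 1)" using forms_mult[OF g v] by (simp add: algebra_simps)
  ultimately have "phi g * f \<in> SRT V \<Gamma>' (\<lambda>l. phi (\<theta> l)) j (i + k) \<longleftrightarrow>
      g * u \<in> SRT V \<Gamma> \<theta> j (i + k) \<and> g * v \<in> SRT V \<Gamma>s \<theta> j (i + k - 1)"
    using SRT_phi_iff[of \<theta>, OF lin] by simp
  moreover have "i + k - 1 = i - 1 + k" by simp
  ultimately show ?thesis by (simp only:)
qed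

text \<open>The second summand is shifted by one degree: \<open>2 * i + m = s\<close> means
  \<open>2 * (i - 1) + m = s - 2\<close>, and vanishing above \<open>w\<close> means vanishing above
  \<open>w - 1\<close> for the star.\<close>

lemma good_subdivision:
  assumes g: "good V D s w N \<Gamma> \<theta>" and gs: "good V D (s - 2) (w - 1) N \<Gamma>s \<theta>"
  shows "good V D s w N \<Gamma>' (\<lambda>j. phi (\<theta> j))"
proof -
  note lin = good_lin[OF g]
  have mult_iff: "phi g * f \<in> SRT V \<Gamma>' (\<lambda>l. phi (\<theta> l)) j (i + k) \<longleftrightarrow>
      g * u \<in> SRT V \<Gamma> \<theta> j (i + k) \<and> g * v \<in> SRT V \<Gamma>s \<theta> j (i - 1 + k)"
    if "u \<in> forms V i" "v \<in> forms V (i - 1)" "f - (phi u + xb * phi v) \<in> SR V \<Gamma>' i" "g \<in> forms V k" for f g u v i j k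
    using SRT_phi_mult_iff[of \<theta>, OF lin that] .
  have recomb: "f \<in> SRT V \<Gamma>' (\<lambda>l. phi (\<theta> l)) j i"
    if "u \<in> SRT V \<Gamma> \<theta> j i" "v \<in> SRT V \<Gamma>s \<theta> j (i - 1)" "u \<in> forms V i" "v \<in> forms V (i - 1)"
      "f - (phi u + xb * phi v) \<in> SR V \<Gamma>' i" for f u v i j
    using mult_iff[OF that(3-5) forms_one] that(1,2) by (simp add: phi_simps)
  show ?thesis
    unfolding good_def
  proof (intro conjI allI impI ballI)
    show "phi (\<theta> j) \<in> forms V 1" for j by (rule phi_forms[OF lin])
  next
    fix j i f
    assume *: "j < D" "i < N" "f \<in> forms V i" "phi (\<theta> j) * f \<in> SRT V \<Gamma>' (\<lambda>l. phi (\<theta> l)) j (i + 1)"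
    from phi_decomp[OF *(3)] obtain u v where uv: "u \<in> forms V i" "v \<in> forms V (i - 1)"
      "f - (phi u + xb * phi v) \<in> SR V \<Gamma>' i" by (elim exE conjE)
    from mult_iff[OF uv lin] *(4) have "\<theta> j * u \<in> SRT V \<Gamma> \<theta> j (i + 1)" "\<theta> j * v \<in> SRT V \<Gamma>s \<theta> j (i - 1 + 1)"
      by simp_all
    then have "u \<in> SRT V \<Gamma> \<theta> j i" "v \<in> SRT V \<Gamma>s \<theta> j (i - 1)"
      using good_reg[OF g *(1,2) uv(1)] good_reg[OF gs *(1) _ uv(2)] *(2) by simp_all
    then show "f \<in> SRT V \<Gamma>' (\<lambda>l. phi (\<theta> l)) j i" using uv by (rule recomb)
  next
    fix i m f
    assume *: "2 * i + int m = s" "f \<in> forms V i" "phi (\<theta> D) ^ m * f \<in> SRT V \<Gamma>' (\<lambda>l. phi (\<theta> l)) D (i + int m)"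
    from phi_decomp[OF *(2)] obtain u v where uv: "u \<in> forms V i" "v \<in> forms V (i - 1)"
      "f - (phi u + xb * phi v) \<in> SR V \<Gamma>' i" by (elim exE conjE)
    have hp: "\<theta> D ^ m \<in> forms V (int m)" using forms_power[OF lin[of D], of m] by simp
    from mult_iff[OF uv hp] *(3) have "\<theta> D ^ m * u \<in> SRT V \<Gamma> \<theta> D (i + int m)" "\<theta> D ^ m * v \<in> SRT V \<Gamma>s \<theta> D (i - 1 + int m)"
      by (simp_all add: phi_simps)
    then have "u \<in> SRT V \<Gamma> \<theta> D i" "v \<in> SRT V \<Gamma>s \<theta> D (i - 1)"
      using good_lef[OF g *(1) uv(1)] good_lef[OF gs _ uv(2), of m] *(1) by simp_all
    then show "f \<in> SRT V \<Gamma>' (\<lambda>l. phi (\<theta> l)) D i" using uv by (rule recomb)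
  next
    fix i assume i: "w < i"
    show "forms V i \<subseteq> SRT V \<Gamma>' (\<lambda>l. phi (\<theta> l)) D i"
    proof
      fix f :: "('w, 'k) mpoly" assume f: "f \<in> forms V i"
      from phi_decomp[OF f] obtain u v where uv: "u \<in> forms V i" "v \<in> forms V (i - 1)"
        "f - (phi u + xb * phi v) \<in> SR V \<Gamma>' i" by (elim exE conjE)
      have "u \<in> SRT V \<Gamma> \<theta> D i" "v \<in> SRT V \<Gamma>s \<theta> D (i - 1)"
        using good_van[OF g i uv(1)] good_van[OF gs _ uv(2)] i by simp_all
      then show "f \<in> SRT V \<Gamma>' (\<lambda>l. phi (\<theta> l)) D i" using uv by (rule recomb)
    qed
  qed
qed

section \<open>Suspensions and powers of a perturbed form\<close>

text \<open>All mixed terms are multiples of \<open>xa * xc\<close>, the monomial of the removed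
  edge, and will vanish. For \<open>m = 1\<close> the cofactor \<open>h\<close> has degree -1 and so
  is zero.\<close>

lemma binomial_power_mod:
  assumes "m \<ge> 1"
  shows "\<exists>h. h \<in> forms V (int m - 2) \<and> (xc - const r * xa) ^ m = xc ^ m + const ((- r) ^ m) * xa ^ m + xa * xc * h"
  using assms
proof (induction m rule: dec_induct)
  case base
  show ?case by (rule exI[of _ 0]) (simp add: const_diff[of 0, simplified])
next
  case (step m)
  then obtain h where h: "h \<in> forms V (int m - 2)"
    "(xc - const r * xa) ^ m = xc ^ m + const ((- r) ^ m) * xa ^ m + xa * xc * h" by (elim exE conjE)
  obtain l where l: "m = Suc l" using step.hyps by (cases m) auto
  have lh: "xc ^ l \<in> forms V (int l)" "xa ^ l \<in> forms V (int l)"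
    using forms_power[OF x_forms(3), of l] forms_power[OF x_forms(1), of l] by simp_all
  define h' where "h' = (xc - const r * xa) * h + const ((- r) ^ m) * xa ^ l - const r * xc ^ l"
  have "(xc - const r * xa) * h \<in> forms V (int l)"
    using forms_mult[OF forms_diff[OF x_forms(3) forms_const_mult[OF x_forms(1), of r]] h(1)] l by simp
  then have "h' \<in> forms V (int (Suc m) - 2)"
    unfolding h'_def l using lh by (simp add: forms_add forms_diff forms_const_mult)
  moreover have "(xc - const r * xa) ^ Suc m = xc ^ Suc m + const ((- r) ^ Suc m) * xa ^ Suc m + xa * xc * h'"
  proof -
    have c: "const ((- r) ^ Suc m) = - (const r * const ((- r) ^ m) :: ('w, 'k) mpoly)"
      using const_diff[of 0 "r * (- r) ^ m"] by (simp add: const_mult)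
    define K where "K = (const ((- r) ^ m) :: ('w, 'k) mpoly)"
    have "(xc - const r * xa) ^ Suc m = (xc - const r * xa) * (xc ^ m + const ((- r) ^ m) * xa ^ m + xa * xc * h)"
      unfolding power_Suc h(2) ..
    also have "\<dots> = xc ^ Suc m + const ((- r) ^ Suc m) * xa ^ Suc m + xa * xc * h'"
      unfolding c h'_def unfolding K_def[symmetric] unfolding l by (simp add: algebra_simps)
    finally show ?thesis .
  qed
  ultimately show ?case by (intro exI conjI)
qed

lemma xa_power_mod:
  "\<exists>h. h \<in> forms V (int l - 1) \<and> xa * (xc - const r * xa) ^ l = const ((- r) ^ l) * xa ^ Suc l + xa * xc * h"
proof (cases l)
  case 0
  then show ?thesis by (intro exI[of _ 0]) simp
next
  case (Suc k)
  then have "l \<ge> 1" by simp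
  from binomial_power_mod[OF this, of r] obtain h where h: "h \<in> forms V (int l - 2)"
    "(xc - const r * xa) ^ l = xc ^ l + const ((- r) ^ l) * xa ^ l + xa * xc * h" by (elim exE conjE)
  have "xa * h + xc ^ k \<in> forms V (int l - 1)"
    using forms_add[of "xa * h" V "int l - 1" "xc ^ k"] forms_mult[OF x_forms(1) h(1)] forms_power[OF x_forms(3), of k] Suc by simp
  moreover have "xa * (xc - const r * xa) ^ l = const ((- r) ^ l) * xa ^ Suc l + xa * xc * (xa * h + xc ^ k)"
    unfolding h(2) unfolding Suc by (simp add: algebra_simps)
  ultimately show ?thesis by (intro exI conjI)
qed

text \<open>Modulo the product of \<open>x\<^sub>a\<close> and \<open>x\<^sub>c\<close>, powers of \<open>x\<^sub>c - r x\<^sub>a\<close> and of \<open>x\<^sub>c - x\<^sub>a = phi (\<theta> D)\<close> are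
  combinations of the same pure powers, so their actions can be compared.\<close>

lemma good_suspension:
  assumes cone: "St = W" and g: "good V D (s - 1) (w - 1) N \<Gamma> \<theta>" and thD: "\<theta> D = xc - xa"
    and r: "r \<noteq> 0" "\<And>m. 1 \<le> m \<Longrightarrow> int m \<le> s \<Longrightarrow> r ^ m \<noteq> 1"
  shows "good V D s w N \<Gamma>' (\<lambda>j. if j = D then xc - const r * xa else phi (\<theta> j))"
    (is "good V D s w N \<Gamma>' ?\<eta>")
proof -
  note lin = good_lin[OF g]
  have gs: "\<Gamma>s = \<Gamma>" unfolding \<Gamma>s_def \<Gamma>_def by (simp add: cone)
  define E where "E j i = SRT V \<Gamma>' (\<lambda>l. phi (\<theta> l)) j i" for j i
  have Eeta: "SRT V \<Gamma>' ?\<eta> j i = E j i" if "j \<le> D" for i j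
    unfolding E_def by (rule SRT_cong) (use that in simp)
  have mult_iff: "phi g * f \<in> E j (i + k) \<longleftrightarrow> g * u \<in> SRT V \<Gamma> \<theta> j (i + k) \<and> g * v \<in> SRT V \<Gamma> \<theta> j (i - 1 + k)"
    if "u \<in> forms V i" "v \<in> forms V (i - 1)" "f - (phi u + xb * phi v) \<in> SR V \<Gamma>' i" "g \<in> forms V k" for f g u v i j k
    using SRT_phi_mult_iff[of \<theta>, OF lin that] unfolding gs E_def .
  have recomb: "f \<in> E j i"
    if "u \<in> SRT V \<Gamma> \<theta> j i" "v \<in> SRT V \<Gamma> \<theta> j (i - 1)" "u \<in> forms V i" "v \<in> forms V (i - 1)"
      "f - (phi u + xb * phi v) \<in> SR V \<Gamma>' i" for f u v i j
    using mult_iff[OF that(3-5) forms_one] that(1,2) by (simp add: phi_simps)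
  have Emult: "g * f \<in> E j i'" if "g \<in> forms V k" "f \<in> E j i" "i' = k + i" for g f j i k i'
    using SRT_mult'[OF dc(3) that(1) that(2)[unfolded E_def] that(3)] unfolding E_def .
  have Eadd: "f + g \<in> E j i" "f - g \<in> E j i" if "f \<in> E j i" "g \<in> E j i" for f g j i
    using SRT_add[OF that[unfolded E_def]] SRT_diff[OF that[unfolded E_def]] unfolding E_def by simp_all
  have Econst: "f \<in> E j i" if "const k * f \<in> E j i" "k \<noteq> 0" for f k j i
  proof -
    have "const (inverse k) * (const k * f) \<in> E j i" using SRT_const_mult[OF that(1)[unfolded E_def], of "inverse k"] unfolding E_def .
    then show ?thesis using that(2) by (simp add: mult.assoc[symmetric] const_mult[symmetric])
  qed
  have kill: "xa * xc * h \<in> E j i'" if "h \<in> forms V i" "i' = i + 2" for h i j i'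
    unfolding E_def by (rule SRT_SR, rule SR_mult'(2)[OF dc(3) that(1) xaxc that(2)])
  \<comment> \<open>The two copies of \<open>xb\<close> cancel, so the old form has the same shape
    as the new one, with 1 in place of \<open>r\<close>.\<close>
  have P: "phi (\<theta> D) = xc - const 1 * xa" unfolding thD by (simp add: phi_simps)
  have pw: "xc ^ l \<in> forms V (int l)" "xa ^ l \<in> forms V (int l)" for l
    using forms_power[OF x_forms(3), of l] forms_power[OF x_forms(1), of l] by simp_all
  have lef: "f \<in> E D i" if m: "2 * i + int m = s" and f: "f \<in> forms V i" and hyp: "(xc - const r * xa) ^ m * f \<in> E D (i + int m)" for i m f
  proof (cases "m = 0 \<or> i < 0")
    case True
    then show ?thesis
    proof
      assume "i < 0" then show ?thesis unfolding E_def using f by (rule SRT_neg)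
    qed (use hyp in simp)
  next
    case False
    then obtain l where l: "m = Suc l" by (cases m) auto
    have m1: "1 \<le> m" "int m \<le> s" using False m by auto
    define K where "K = (- r) ^ m"
    have K: "K \<noteq> 0" using r(1) by (simp add: K_def)
    from binomial_power_mod[OF m1(1), of r] obtain h where h: "h \<in> forms V (int m - 2)"
      "(xc - const r * xa) ^ m = xc ^ m + const K * xa ^ m + xa * xc * h" unfolding K_def by (elim exE conjE)
    have pure: "xc ^ m * f + const K * (xa ^ m * f) \<in> E D (i + int m)"
      if "f \<in> forms V i" "(xc - const r * xa) ^ m * f \<in> E D (i + int m)" for f
    proof -
      have "xa * xc * (h * f) \<in> E D (i + int m)"
        by (rule kill[OF forms_mult[OF h(1) that(1)]]) (simp add: l)
      from Eadd(2)[OF that(2)[unfolded h(2)] this] show ?thesis by (simp add: algebra_simps)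
    qed
    \<comment> \<open>One more factor \<open>xc\<close> or \<open>xa\<close> removes the other pure
      power, because the product of the two variables vanishes; \<open>K\<close> is
      invertible.\<close>
    have up: "xc ^ Suc m * f \<in> E D (i + int (Suc m))" "xa ^ Suc m * f \<in> E D (i + int (Suc m))"
      if f: "f \<in> forms V i" and p: "xc ^ m * f + const K * (xa ^ m * f) \<in> E D (i + int m)" for f
    proof -
      have kl: "xa * xc * (xc ^ l * f) \<in> E D (i + int (Suc m))" "xa * xc * (const K * (xa ^ l * f)) \<in> E D (i + int (Suc m))"
        by (rule kill[OF forms_mult[OF pw(1)[of l] f]], simp add: l)
          (rule kill[OF forms_const_mult[OF forms_mult[OF pw(2)[of l] f]]], simp add: l)
      have "xc * (xc ^ m * f + const K * (xa ^ m * f)) \<in> E D (i + int (Suc m))"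
        by (rule Emult[OF x_forms(3) p]) simp
      from Eadd(2)[OF this kl(2)] show "xc ^ Suc m * f \<in> E D (i + int (Suc m))"
        unfolding l by (simp add: algebra_simps)
      have "xa * (xc ^ m * f + const K * (xa ^ m * f)) \<in> E D (i + int (Suc m))"
        by (rule Emult[OF x_forms(1) p]) simp
      from Eadd(2)[OF this kl(1)] have "const K * (xa ^ Suc m * f) \<in> E D (i + int (Suc m))"
        unfolding l by (simp add: algebra_simps)
      then show "xa ^ Suc m * f \<in> E D (i + int (Suc m))" using K by (rule Econst)
    qed
    from phi_decomp[OF f] obtain u v where uv: "u \<in> forms V i" "v \<in> forms V (i - 1)"
      "f - (phi u + xb * phi v) \<in> SR V \<Gamma>' i" by (elim exE conjE)
    have tp: "\<theta> D ^ n \<in> forms V (int n)" for n using forms_power[OF lin[of D], of n] by simp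
    \<comment> \<open>The extra factor is harmless for \<open>v\<close>, which has degree
      \<open>i - 1\<close>: here \<open>2 * (i - 1) + (m + 1) = s - 1\<close>, the range of the
      hypothesis.\<close>
    have "v \<in> SRT V \<Gamma> \<theta> D (i - 1)"
    proof -
      have "1 \<le> Suc m" by simp
      from binomial_power_mod[OF this, of 1] obtain k where k: "k \<in> forms V (int (Suc m) - 2)"
        "(xc - const 1 * xa) ^ Suc m = xc ^ Suc m + const ((- 1) ^ Suc m) * xa ^ Suc m + xa * xc * k" by (elim exE conjE)
      note fu = up[OF f pure[OF f hyp]]
      have "xa * xc * (k * f) \<in> E D (i + int (Suc m))"
        by (rule kill[OF forms_mult[OF k(1) f]]) (simp add: l)
      moreover have "const ((- 1) ^ Suc m) * (xa ^ Suc m * f) \<in> E D (i + int (Suc m))"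
        using SRT_const_mult fu(2) unfolding E_def by blast
      ultimately have "xc ^ Suc m * f + const ((- 1) ^ Suc m) * (xa ^ Suc m * f) + xa * xc * (k * f) \<in> E D (i + int (Suc m))"
        using fu(1) by (intro Eadd(1))
      then have "phi (\<theta> D ^ Suc m) * f \<in> E D (i + int (Suc m))"
        unfolding phi_simps(5) P k(2) by (simp only: distrib_right mult.assoc)
      then have "\<theta> D ^ Suc m * v \<in> SRT V \<Gamma> \<theta> D (i - 1 + int (Suc m))" unfolding mult_iff[OF uv tp] by simp
      then show ?thesis using good_lef[OF g _ uv(2), of "Suc m"] m by simp
    qed
    then have "xb * phi v \<in> E D i" unfolding E_def by (intro phi_SRT_star) (simp add: gs)
    moreover have "f - (phi u + xb * phi v) \<in> E D i" unfolding E_def by (rule SRT_SR[OF uv(3)])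
    ultimately have "f - (phi u + xb * phi v) + xb * phi v \<in> E D i" by (intro Eadd(1))
    then have "(xc - const r * xa) ^ m * (f - phi u) \<in> E D (i + int m)"
      using Emult[OF forms_power[OF forms_diff[OF x_forms(3) forms_const_mult[OF x_forms(1)]]], of "f - phi u" D i "i + int m" m r] by simp
    from Eadd(2)[OF hyp this] have hu: "(xc - const r * xa) ^ m * phi u \<in> E D (i + int m)" by (simp add: algebra_simps)
    have pu: "phi u \<in> forms V i" by (rule phi_forms[OF uv(1)])
    note pure_u = pure[OF pu hu]
    note up_u = up[OF pu pure_u]
    from binomial_power_mod[OF m1(1), of 1] obtain k where k: "k \<in> forms V (int m - 2)"
      "(xc - const 1 * xa) ^ m = xc ^ m + const ((- 1) ^ m) * xa ^ m + xa * xc * k" by (elim exE conjE)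
    \<comment> \<open>Multiplying by \<open>xc\<close> or \<open>xa\<close> moves \<open>u\<close>,
      up to sign, into the \<open>xb\<close> component, from which directness of the sum can extract
      a statement about \<open>u\<close> itself.\<close>
    have split: "phi u * xc = phi (xc * u) + xb * phi (- u)" "phi u * xa = phi (xa * u) + xb * phi (- u)"
      by (simp_all add: phi_simps algebra_simps)
    have xu: "xc * u \<in> forms V (i + 1)" "xa * u \<in> forms V (i + 1)" "- u \<in> forms V (i + 1 - 1)"
      using forms_mult[OF x_forms(3) uv(1)] forms_mult[OF x_forms(1) uv(1)] forms_minus[OF uv(1)] by (simp_all add: add.commute)
    have "\<theta> D ^ m * u \<in> SRT V \<Gamma> \<theta> D (i + int m)"
    proof -
      have "const ((- 1) ^ m) * (xa ^ l * phi u) + k * (xc * phi u) \<in> forms V (i + int m - 1)"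
      proof (rule forms_add)
        show "const ((- 1) ^ m) * (xa ^ l * phi u) \<in> forms V (i + int m - 1)"
          using forms_const_mult[OF forms_mult[OF pw(2)[of l] pu], of "(- 1) ^ m"] by (simp add: l add.commute)
        show "k * (xc * phi u) \<in> forms V (i + int m - 1)"
          using forms_mult[OF k(1) forms_mult[OF x_forms(3) pu]] by (simp add: algebra_simps)
      qed
      then have "xa * xc * (const ((- 1) ^ m) * (xa ^ l * phi u) + k * (xc * phi u)) \<in> E D (i + int (Suc m))"
        by (rule kill) simp
      from Eadd(1)[OF up_u(1) this] have "(xc - const 1 * xa) ^ m * (phi u * xc) \<in> E D (i + int (Suc m))"
        unfolding k(2) unfolding l by (simp add: algebra_simps)
      then have "phi (\<theta> D ^ m) * (phi u * xc) \<in> E D (i + 1 + int m)"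
        unfolding phi_simps(5) P by (simp add: algebra_simps)
      then have "\<theta> D ^ m * - u \<in> SRT V \<Gamma> \<theta> D (i + 1 - 1 + int m)"
        using mult_iff[OF xu(1,3) _ tp[of m], of "phi u * xc" D] split(1) by simp
      then show ?thesis using SRT_minus[of "\<theta> D ^ m * - u"] by simp
    qed
    then have "phi (\<theta> D ^ m * u) \<in> E D (i + int m)" unfolding E_def by (rule phi_SRT)
    then have "(xc - const 1 * xa) ^ m * phi u \<in> E D (i + int m)" by (simp add: phi_simps P)
    moreover have "xa * xc * (k * phi u) \<in> E D (i + int m)"
      by (rule kill[OF forms_mult[OF k(1) pu]]) (simp add: l)
    ultimately have "(xc - const 1 * xa) ^ m * phi u - xa * xc * (k * phi u) \<in> E D (i + int m)" by (rule Eadd(2))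
    from Eadd(2)[OF this pure_u] have "const ((- 1) ^ m - K) * (xa ^ m * phi u) \<in> E D (i + int m)"
      unfolding k(2) by (simp add: algebra_simps const_diff)
    \<comment> \<open>Two combinations of the \<open>m\<close>-th powers of \<open>xc\<close> and
      \<open>xa\<close> annihilate \<open>phi u\<close>. As \<open>r ^ m \<noteq> 1\<close>, their
      coefficients of \<open>xa ^ m\<close> differ, so that power alone annihilates it.\<close>
    moreover have "(- 1) ^ m - K \<noteq> 0"
    proof
      assume "(- 1) ^ m - K = 0"
      then have "(- 1) ^ m * r ^ m = (- 1) ^ m" unfolding K_def power_minus[of r m] by (simp only: right_minus_eq)
      then show False using r(2)[OF m1] by simp
    qed
    ultimately have xam: "xa ^ m * phi u \<in> E D (i + int m)" by (rule Econst)
    \<comment> \<open>The exponent must be lowered to \<open>l = m - 1\<close>, as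
      \<open>2 * i + l = s - 1\<close>. The pure power \<open>xa ^ m\<close> is, up to sign and
      vanishing terms, \<open>xa\<close> times the \<open>l\<close>-th power of
      \<open>phi (\<theta> D)\<close>.\<close>
    from xa_power_mod[of l 1] obtain h' where h': "h' \<in> forms V (int l - 1)"
      "xa * (xc - const 1 * xa) ^ l = const ((- 1) ^ l) * xa ^ Suc l + xa * xc * h'" by (elim exE conjE)
    have "const ((- 1) ^ l) * (xa ^ m * phi u) \<in> E D (i + int m)" using SRT_const_mult xam unfolding E_def by blast
    moreover have "xa * xc * (h' * phi u) \<in> E D (i + int m)"
      by (rule kill[OF forms_mult[OF h'(1) pu]]) (simp add: l)
    ultimately have "const ((- 1) ^ l) * (xa ^ m * phi u) + xa * xc * (h' * phi u) \<in> E D (i + int m)" by (rule Eadd(1))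
    moreover have "const ((- 1) ^ l) * (xa ^ m * phi u) + xa * xc * (h' * phi u) = (xa * (xc - const 1 * xa) ^ l) * phi u"
      unfolding h'(2) l by (simp only: distrib_right mult.assoc)
    ultimately have "phi (\<theta> D ^ l) * (phi u * xa) \<in> E D (i + 1 + int l)"
      unfolding phi_simps(5) P by (simp add: l algebra_simps)
    then have "\<theta> D ^ l * - u \<in> SRT V \<Gamma> \<theta> D (i + 1 - 1 + int l)"
      using mult_iff[OF xu(2,3) _ tp[of l], of "phi u * xa" D] split(2) by simp
    then have "\<theta> D ^ l * u \<in> SRT V \<Gamma> \<theta> D (i + int l)" using SRT_minus[of "\<theta> D ^ l * - u"] by simp
    then have "u \<in> SRT V \<Gamma> \<theta> D i" using good_lef[OF g _ uv(1), of l] m l by simp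
    then show ?thesis using \<open>v \<in> SRT V \<Gamma> \<theta> D (i - 1)\<close> uv by (rule recomb)
  qed
  show ?thesis
    unfolding good_def
  proof (intro conjI allI impI ballI)
    show "?\<eta> j \<in> forms V 1" for j
      using phi_forms[OF lin, of j] forms_diff[OF x_forms(3) forms_const_mult[OF x_forms(1)]] by simp
  next
    fix j i f
    assume *: "j < D" "i < N" "f \<in> forms V i" "?\<eta> j * f \<in> SRT V \<Gamma>' ?\<eta> j (i + 1)"
    then have **: "phi (\<theta> j) * f \<in> E j (i + 1)" using Eeta[of j] by simp
    from phi_decomp[OF *(3)] obtain u v where uv: "u \<in> forms V i" "v \<in> forms V (i - 1)"
      "f - (phi u + xb * phi v) \<in> SR V \<Gamma>' i" by (elim exE conjE)
    from mult_iff[OF uv lin] ** have "\<theta> j * u \<in> SRT V \<Gamma> \<theta> j (i + 1)" "\<theta> j * v \<in> SRT V \<Gamma> \<theta> j (i - 1 + 1)"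
      by simp_all
    then have "u \<in> SRT V \<Gamma> \<theta> j i" "v \<in> SRT V \<Gamma> \<theta> j (i - 1)"
      using good_reg[OF g *(1,2) uv(1)] good_reg[OF g *(1) _ uv(2)] *(2) by simp_all
    then have "f \<in> E j i" using uv by (rule recomb)
    then show "f \<in> SRT V \<Gamma>' ?\<eta> j i" using Eeta[of j] *(1) by simp
  next
    fix i m f
    assume *: "2 * i + int m = s" "f \<in> forms V i" "?\<eta> D ^ m * f \<in> SRT V \<Gamma>' ?\<eta> D (i + int m)"
    then show "f \<in> SRT V \<Gamma>' ?\<eta> D i" using lef[of i m f] Eeta[of D] by simp
  next
    fix i assume i: "w < i"
    have "f \<in> E D i" if f: "f \<in> forms V i" for f
    proof -
      from phi_decomp[OF f] obtain u v where uv: "u \<in> forms V i" "v \<in> forms V (i - 1)"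
        "f - (phi u + xb * phi v) \<in> SR V \<Gamma>' i" by (elim exE conjE)
      have "u \<in> SRT V \<Gamma> \<theta> D i" "v \<in> SRT V \<Gamma> \<theta> D (i - 1)"
        using good_van[OF g _ uv(1)] good_van[OF g _ uv(2)] i by simp_all
      then show ?thesis using uv by (rule recomb)
    qed
    then show "forms V i \<subseteq> SRT V \<Gamma>' ?\<eta> D i" using Eeta[of D] by auto
  qed
qed

end

section \<open>Change of coordinates and existence of good parameters\<close>

lemma SRT_subst_poly:
  assumes h: "\<And>v. v \<in> V \<Longrightarrow> h v \<in> forms V 1" and pres: "\<And>i f. f \<in> SR V \<Gamma> i \<Longrightarrow> subst_poly h f \<in> SR V \<Gamma> i"
  shows "f \<in> SRT V \<Gamma> \<theta> j i \<Longrightarrow> subst_poly h f \<in> SRT V \<Gamma> (\<lambda>l. subst_poly h (\<theta> l)) j i"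
proof (induction j arbitrary: f)
  case (Suc j)
  then obtain e p where *: "f = e + \<theta> j * p" "e \<in> SRT V \<Gamma> \<theta> j i" "p \<in> forms V (i - 1)" by auto
  have "subst_poly h f = subst_poly h e + subst_poly h (\<theta> j) * subst_poly h p" by (simp add: * subst_poly_simps)
  moreover have "subst_poly h p \<in> forms V (i - 1)" by (rule subst_poly_forms[OF *(3)]) (rule h)
  ultimately show ?case using Suc.IH[OF *(2)] by auto
qed (simp add: pres)

lemma good_subst_poly:
  fixes h h' :: "'w \<Rightarrow> ('w, 'k::field) mpoly"
  assumes h: "\<And>v. v \<in> V \<Longrightarrow> h v \<in> forms V 1" and pres: "\<And>i f. f \<in> SR V \<Gamma> i \<Longrightarrow> subst_poly h f \<in> SR V \<Gamma> i"
    and h': "\<And>v. v \<in> V \<Longrightarrow> h' v \<in> forms V 1" and pres': "\<And>i f. f \<in> SR V \<Gamma> i \<Longrightarrow> subst_poly h' f \<in> SR V \<Gamma> i"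
    and inv: "\<And>v. v \<in> V \<Longrightarrow> subst_poly h (h' v) = var v" "\<And>v. v \<in> V \<Longrightarrow> subst_poly h' (h v) = var v"
    and g: "good V D s w N \<Gamma> \<theta>"
  shows "good V D s w N \<Gamma> (\<lambda>j. subst_poly h (\<theta> j))"
proof -
  note lin = good_lin[OF g]
  have sh: "subst_poly h f \<in> forms V i" and sh': "subst_poly h' f \<in> forms V i" if "f \<in> forms V i" for f i
    using subst_poly_forms[OF that, of h] subst_poly_forms[OF that, of h'] h h' by simp_all
  have hh': "subst_poly h (subst_poly h' f) = f" and h'h: "subst_poly h' (subst_poly h f) = f" if "f \<in> forms V i" for f i
  proof -
    show "subst_poly h (subst_poly h' f) = f"
      unfolding subst_poly_subst_poly[OF that] using subst_poly_cong[OF that, of "\<lambda>v. subst_poly h (h' v)" var] inv subst_poly_id[OF that] by simp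
    show "subst_poly h' (subst_poly h f) = f"
      unfolding subst_poly_subst_poly[OF that] using subst_poly_cong[OF that, of "\<lambda>v. subst_poly h' (h v)" var] inv subst_poly_id[OF that] by simp
  qed
  have iff: "f \<in> SRT V \<Gamma> (\<lambda>l. subst_poly h (\<theta> l)) j i \<longleftrightarrow> subst_poly h' f \<in> SRT V \<Gamma> \<theta> j i" if f: "f \<in> forms V i" for f i j
  proof
    assume "f \<in> SRT V \<Gamma> (\<lambda>l. subst_poly h (\<theta> l)) j i"
    from SRT_subst_poly[of V h' \<Gamma>, OF h' pres' this] have "subst_poly h' f \<in> SRT V \<Gamma> (\<lambda>l. subst_poly h' (subst_poly h (\<theta> l))) j i" by simp
    then show "subst_poly h' f \<in> SRT V \<Gamma> \<theta> j i" using h'h[OF lin] by simp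
  next
    assume "subst_poly h' f \<in> SRT V \<Gamma> \<theta> j i"
    from SRT_subst_poly[of V h \<Gamma>, OF h pres this] show "f \<in> SRT V \<Gamma> (\<lambda>l. subst_poly h (\<theta> l)) j i" using hh'[OF f] by simp
  qed
  show ?thesis
    unfolding good_def
  proof (intro conjI allI impI ballI)
    show "subst_poly h (\<theta> j) \<in> forms V 1" for j by (rule sh[OF lin])
  next
    fix j i f assume *: "j < D" "i < N" "f \<in> forms V i" "subst_poly h (\<theta> j) * f \<in> SRT V \<Gamma> (\<lambda>j. subst_poly h (\<theta> j)) j (i + 1)"
    have "subst_poly h (\<theta> j) * f \<in> forms V (i + 1)" using forms_mult[OF sh[OF lin] *(3)] by (simp add: add.commute)
    from *(4)[unfolded iff[OF this]] have "\<theta> j * subst_poly h' f \<in> SRT V \<Gamma> \<theta> j (i + 1)"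
      by (simp add: subst_poly_mult h'h[OF lin])
    from good_reg[OF g *(1,2) sh'[OF *(3)] this] show "f \<in> SRT V \<Gamma> (\<lambda>j. subst_poly h (\<theta> j)) j i"
      unfolding iff[OF *(3)] .
  next
    fix i m f assume *: "2 * i + int m = s" "f \<in> forms V i" "subst_poly h (\<theta> D) ^ m * f \<in> SRT V \<Gamma> (\<lambda>j. subst_poly h (\<theta> j)) D (i + int m)"
    have "subst_poly h (\<theta> D) ^ m * f \<in> forms V (i + int m)"
      using forms_mult[OF forms_power[OF sh[OF lin[of D]], of m] *(2)] by (simp add: add.commute)
    from *(3)[unfolded iff[OF this]] have "\<theta> D ^ m * subst_poly h' f \<in> SRT V \<Gamma> \<theta> D (i + int m)"
      by (simp add: subst_poly_simps h'h[OF lin])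
    from good_lef[OF g *(1) sh'[OF *(2)] this] show "f \<in> SRT V \<Gamma> (\<lambda>j. subst_poly h (\<theta> j)) D i"
      unfolding iff[OF *(2)] .
  next
    fix i assume i: "w < i"
    show "forms V i \<subseteq> SRT V \<Gamma> (\<lambda>j. subst_poly h (\<theta> j)) D i"
    proof
      fix f :: "('w, 'k) mpoly" assume f: "f \<in> forms V i"
      show "f \<in> SRT V \<Gamma> (\<lambda>j. subst_poly h (\<theta> j)) D i"
        unfolding iff[OF f] by (rule good_van[OF g i sh'[OF f]])
    qed
  qed
qed

lemma subst_mon_cong: "(\<And>v. v \<in> keys m \<Longrightarrow> g v = h v) \<Longrightarrow> subst_mon g m = subst_mon h m"
  unfolding subst_mon_def by (intro prod.cong) auto

lemma subst_poly_cong_keys: "(\<And>m v. m \<in> keys f \<Longrightarrow> v \<in> keys m \<Longrightarrow> g v = h v) \<Longrightarrow> subst_poly g f = subst_poly h f"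
  unfolding subst_poly_def by (intro sum.cong refl arg_cong2[where f = "(*)"] subst_mon_cong) auto

text \<open>Changing the coordinate of a cone point \<open>c\<close> by a linear form preserves the ideal of the complex.\<close>

lemma good_normalize_omega:
  fixes \<theta> :: "nat \<Rightarrow> ('w, 'k::field) mpoly"
  assumes W: "W \<subseteq> V" and c: "c \<in> W" and a: "a \<in> V" "a \<noteq> c"
    and cone: "\<And>v. v \<in> W \<Longrightarrow> v \<noteq> c \<Longrightarrow> R c v \<and> R v c"
    and g: "good V D s w N (flag W R) \<theta>" and nz: "lookup (\<theta> D) (single c (Suc 0)) \<noteq> 0"
  shows "\<exists>\<theta>'::nat \<Rightarrow> ('w, 'k) mpoly. good V D s w N (flag W R) \<theta>' \<and> \<theta>' D = var c - var a"
proof -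
  define k where "k = lookup (\<theta> D) (single c (Suc 0))"
  define q where "q = \<theta> D - const k * var c"
  have cV: "c \<in> V" using W c by auto
  have k: "k \<noteq> 0" using nz by (simp add: k_def)
  have kk: "const (inverse k) * const k = (1 :: ('w, 'k) mpoly)" using k by (simp add: const_mult[symmetric])
  have qh: "q \<in> forms V 1"
    unfolding q_def by (intro forms_diff good_lin[OF g] forms_const_mult forms_var cV)
  have qc: "c \<notin> keys m" if m: "m \<in> keys q" for m
  proof
    assume cm: "c \<in> keys m"
    obtain n where n: "m = single c (Suc 0) + n" using split_var[OF cm] by (elim exE)
    have "mon_deg m = 1" using m qh by (auto simp: forms_def)
    then have "n = 0" unfolding n mon_deg_add using mon_deg_eq_0_iff[of n] by simp
    then have "m = single c (Suc 0)" using n by simp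
    then have "lookup q m = 0" by (simp add: q_def lookup_minus lookup_const_mult k_def var_def)
    then show False using m by (simp add: in_keys_iff)
  qed
  have sq: "subst_poly f q = q" if "\<And>v. v \<noteq> c \<Longrightarrow> f v = var v" for f
  proof -
    have "subst_poly f q = subst_poly var q" by (rule subst_poly_cong_keys) (use that qc in metis)
    then show ?thesis using subst_poly_id[OF qh] by simp
  qed
  \<comment> \<open>\<open>\<theta> D = k * var c + q\<close> is solved for \<open>var c\<close>:
    the value of \<open>h\<close> at \<open>c\<close> is the one for which \<open>\<theta> D\<close>
    becomes \<open>var c - var a\<close>. Since \<open>q\<close> does not involve \<open>c\<close>,
    both substitutions fix it, and \<open>h'\<close> is the inverse.\<close>
  define h where "h v = (if v = c then const (inverse k) * (var c - var a - q) else var v)" for v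
  define h' where "h' v = (if v = c then \<theta> D + var a else var v)" for v
  have hom: "h v \<in> forms V 1" "h' v \<in> forms V 1" if "v \<in> V" for v
    unfolding h_def h'_def using that cV a qh good_lin[OF g, of D]
    by (simp_all add: forms_const_mult forms_diff forms_add)
  have pres: "subst_poly f p \<in> SR V (flag W R) i"
    if f: "\<And>v. v \<in> V \<Longrightarrow> f v \<in> forms V 1" "\<And>v. v \<noteq> c \<Longrightarrow> f v = var v" and p: "p \<in> SR V (flag W R) i" for f p i
  proof (rule subst_poly_SR[OF down_closed_flag W f(1) _ _ p])
    show "f v \<in> SR V (flag W R) 1" if "v \<in> V" "v \<notin> W" for v
    proof -
      have "f v = var v" using f(2)[of v] that c by auto
      then show ?thesis using that by (simp add: var_SR)
    qed
    show "f v * f w \<in> SR V (flag W R) 2" if vw: "v \<in> W" "w \<in> W" "v \<noteq> w" "\<not> R v w" for v w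
    proof -
      have "v \<noteq> c" "w \<noteq> c" using cone vw by auto
      then have e: "f v = var v" "f w = var w" using f(2) by simp_all
      show ?thesis unfolding e by (rule var_var_SR) (use vw W in auto)
    qed
  qed
  have tD: "\<theta> D = const k * var c + q" by (simp add: q_def)
  have hD: "subst_poly h (\<theta> D) = var c - var a"
  proof -
    have "subst_poly h (\<theta> D) = const k * h c + q" unfolding tD using sq[of h] by (simp add: subst_poly_simps h_def)
    also have "\<dots> = (const (inverse k) * const k) * (var c - var a - q) + q" by (simp add: h_def mult_ac)
    finally show ?thesis by (simp add: kk)
  qed
  have "good V D s w N (flag W R) (\<lambda>j. subst_poly h (\<theta> j))"
  proof (rule good_subst_poly[where h' = h', OF _ _ _ _ _ _ g])
    show "subst_poly h (h' v) = var v" for v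
    proof (cases "v = c")
      case True
      then have "subst_poly h (h' v) = subst_poly h (\<theta> D) + h a" by (simp add: h'_def subst_poly_simps)
      then show ?thesis using True a by (simp add: hD h_def)
    qed (simp add: h'_def h_def)
    show "subst_poly h' (h v) = var v" for v
    proof (cases "v = c")
      case True
      then have "subst_poly h' (h v) = const (inverse k) * (\<theta> D + var a - var a - q)"
        using a sq[of h'] by (simp add: h_def h'_def subst_poly_simps)
      also have "\<dots> = (const (inverse k) * const k) * var c" unfolding tD by (simp add: mult.assoc)
      finally show ?thesis using True by (simp add: kk)
    qed (simp add: h'_def h_def)
    show "subst_poly h f \<in> SR V (flag W R) i" "subst_poly h' f \<in> SR V (flag W R) i" if "f \<in> SR V (flag W R) i" for f i
      by (rule pres[OF _ _ that]; use hom in \<open>simp add: h_def h'_def\<close>)+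
  qed (use hom in auto)
  then show ?thesis using hD by (intro exI[of _ "\<lambda>j. subst_poly h (\<theta> j)"] conjI)
qed

lemma lookup_var_self: "lookup (var c) (single c (Suc 0)) = 1"
  by (simp add: var_def)

text \<open>Combined with goodness, this provides a good choice whose Lefschetz form really involves
  the cone point and can serve as a coordinate there.\<close>

lemma generic_coeff:
  assumes "c \<in> V"
  shows "generic V (\<lambda>\<theta>::nat \<Rightarrow> ('w, 'k::field) mpoly. (\<forall>j. \<theta> j \<in> forms V 1) \<and> lookup (\<theta> D) (single c (Suc 0)) \<noteq> 0)"
  unfolding generic_def
proof (intro conjI allI impI)
  show "\<exists>\<theta>::nat \<Rightarrow> ('w, 'k) mpoly. (\<forall>j. \<theta> j \<in> forms V 1) \<and> lookup (\<theta> D) (single c (Suc 0)) \<noteq> 0"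
    by (rule exI[of _ "\<lambda>_. var c"]) (use forms_var[OF assms] in \<open>simp add: lookup_var_self\<close>)
next
  fix \<theta> \<eta> :: "nat \<Rightarrow> ('w, 'k) mpoly"
  assume t: "(\<forall>j. \<theta> j \<in> forms V 1) \<and> lookup (\<theta> D) (single c (Suc 0)) \<noteq> 0" and e: "\<forall>j. \<eta> j \<in> forms V 1"
  define p where "p = [:lookup (\<theta> D) (single c (Suc 0)), lookup (\<eta> D) (single c (Suc 0)):]"
  have "\<forall>\<^sub>F t in cofinite. poly p t \<noteq> 0" by (rule eventually_poly_neq_0[of _ 0]) (use t in \<open>simp add: p_def\<close>)
  then show "\<forall>\<^sub>F t in cofinite. (\<forall>j. \<theta> j + const t * \<eta> j \<in> forms V 1) \<and> lookup (\<theta> D + const t * \<eta> D) (single c (Suc 0)) \<noteq> 0"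
    by (rule eventually_mono) (use t e in \<open>simp add: p_def lookup_add lookup_const_mult forms_add forms_const_mult\<close>)
qed simp

lemma ex_not_root_of_unity:
  assumes "infinite (UNIV :: 'k::field set)"
  shows "\<exists>r::'k. r \<noteq> 0 \<and> (\<forall>m\<in>{1..n}. r ^ m \<noteq> 1)"
proof -
  have "\<forall>\<^sub>F r::'k in cofinite. r ^ m \<noteq> 1" if "m \<in> {1..n}" for m
  proof -
    have "poly (monom 1 m - 1) (0::'k) \<noteq> 0" using that by (cases m) (simp_all add: poly_monom)
    from eventually_poly_neq_0[OF this] show ?thesis by (simp add: poly_monom)
  qed
  then have "\<forall>\<^sub>F r::'k in cofinite. \<forall>m\<in>{1..n}. r ^ m \<noteq> 1" by (intro eventually_ball_finite) auto
  moreover have "\<forall>\<^sub>F r::'k in cofinite. r \<noteq> 0" by (simp add: eventually_cofinite)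
  ultimately have ev: "\<forall>\<^sub>F r::'k in cofinite. r \<noteq> 0 \<and> (\<forall>m\<in>{1..n}. r ^ m \<noteq> 1)" by (rule eventually_conj[rotated])
  have "(cofinite :: 'k filter) \<noteq> bot" using assms by simp
  from eventually_happens'[OF this ev] show ?thesis .
qed

context edge_subdivision
begin

lemma ex_good_subdivision:
  assumes inf: "infinite (UNIV :: 'k set)" and V: "finite V" and N: "s \<le> N" "w < N" "0 \<le> w"
    and "\<exists>\<theta>::nat \<Rightarrow> ('w, 'k) mpoly. good V D s w N \<Gamma> \<theta>"
    and "\<exists>\<theta>::nat \<Rightarrow> ('w, 'k) mpoly. good V D (s - 2) (w - 1) N \<Gamma>s \<theta>"
  shows "\<exists>\<theta>::nat \<Rightarrow> ('w, 'k) mpoly. good V D s w N \<Gamma>' \<theta>"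
proof -
  have "generic V (good V D s w N \<Gamma> :: (nat \<Rightarrow> ('w, 'k) mpoly) \<Rightarrow> bool)"
    by (rule generic_good) (use assms dc in simp_all)
  moreover have "generic V (good V D (s - 2) (w - 1) N \<Gamma>s :: (nat \<Rightarrow> ('w, 'k) mpoly) \<Rightarrow> bool)"
    by (rule generic_good) (use assms dc in simp_all)
  ultimately obtain \<theta> :: "nat \<Rightarrow> ('w, 'k) mpoly" where "good V D s w N \<Gamma> \<theta> \<and> good V D (s - 2) (w - 1) N \<Gamma>s \<theta>"
    using generic_ex[OF generic_conj[OF inf]] by blast
  then show ?thesis using good_subdivision by blast
qed

lemma ex_good_suspension:
  assumes inf: "infinite (UNIV :: 'k set)" and V: "finite V" and N: "s \<le> N" "w \<le> N" "0 \<le> w"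
    and cone: "St = W"
    and ex: "\<exists>\<theta>::nat \<Rightarrow> ('w, 'k) mpoly. good V D (s - 1) (w - 1) N \<Gamma> \<theta>"
  shows "\<exists>\<theta>::nat \<Rightarrow> ('w, 'k) mpoly. good V D s w N \<Gamma>' \<theta>"
proof -
  have 1: "generic V (good V D (s - 1) (w - 1) N \<Gamma> :: (nat \<Rightarrow> ('w, 'k) mpoly) \<Rightarrow> bool)"
    by (rule generic_good) (use assms dc in simp_all)
  from generic_ex[OF generic_conj[OF inf 1 generic_coeff[OF inV(3), of D]]]
  obtain \<theta> :: "nat \<Rightarrow> ('w, 'k) mpoly" where t: "good V D (s - 1) (w - 1) N \<Gamma> \<theta>" "lookup (\<theta> D) (single c (Suc 0)) \<noteq> 0"
    by (elim exE conjE)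
  have cc: "R c v \<and> R v c" if "v \<in> W" "v \<noteq> c" for v using that cone St sym by auto
  have "\<exists>\<theta>'::nat \<Rightarrow> ('w, 'k) mpoly. good V D (s - 1) (w - 1) N (flag W R) \<theta>' \<and> \<theta>' D = xc - xa"
    by (rule good_normalize_omega[OF W cW inV(1) ac _ t[unfolded \<Gamma>_def]]) (rule cc)
  then obtain \<theta>' :: "nat \<Rightarrow> ('w, 'k) mpoly" where t': "good V D (s - 1) (w - 1) N \<Gamma> \<theta>'" "\<theta>' D = xc - xa"
    unfolding \<Gamma>_def by (elim exE conjE)
  obtain r :: 'k where "r \<noteq> 0" "\<forall>m\<in>{1..nat s}. r ^ m \<noteq> 1" using ex_not_root_of_unity[OF inf] by blast
  then have r: "r \<noteq> 0" "\<And>m. 1 \<le> m \<Longrightarrow> int m \<le> s \<Longrightarrow> r ^ m \<noteq> 1" by auto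
  show ?thesis by (rule exI, rule good_suspension[OF cone t' r])
qed

end

text \<open>The variables themselves are the parameters: each one cuts the simplex down to the face
  on the remaining vertices (\<open>P j\<close>), and the final quotient is the field in degree 0,
  whence \<open>s = w = 0\<close>.\<close>

lemma good_simplex:
  assumes W: "finite W" "W \<subseteq> V" and N: "N \<ge> 0"
  shows "\<exists>\<theta>::nat \<Rightarrow> ('w, 'k::field) mpoly. good V (card W) 0 0 N (Pow W) \<theta>"
proof -
  obtain e where e: "bij_betw e {..<card W} W"
    using ex_bij_betw_nat_finite[OF W(1)] unfolding atLeast0LessThan by (elim exE)
  define \<theta> where "\<theta> j = (if j < card W then var (e j) else 0 :: ('w, 'k) mpoly)" for j
  have eW: "e j \<in> W" if "j < card W" for j using e that by (auto simp: bij_betw_def)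
  have lin: "\<theta> j \<in> forms V 1" for j using eW[of j] W by (auto simp: \<theta>_def)
  define P where "P j = Pow (W - e ` {..<j})" for j
  have dcP: "down_closed (P j)" for j by (auto simp: P_def down_closed_def)
  have div: "p \<in> SR V (P j) i" if "j < card W" and ph: "p \<in> forms V i" and vp: "var (e j) * p \<in> SR V (P j) (i + 1)"
    for j i and p :: "('w, 'k) mpoly"
  proof -
    have "keys m \<notin> P j" if m: "m \<in> keys p" for m
    proof
      assume mP: "keys m \<in> P j"
      have "inj_on e {..<card W}" using e by (simp add: bij_betw_def)
      then have "e j \<notin> e ` {..<j}" using inj_on_image_mem_iff[of e "{..<card W}" j "{..<j}"] \<open>j < card W\<close> by auto
      then have eP: "e j \<in> W - e ` {..<j}" using eW[OF \<open>j < card W\<close>] by simp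
      have "single (e j) (Suc 0) + m \<in> keys (var (e j) * p)"
        using m lookup_single_mult[of "single (e j) (Suc 0)" p m] by (simp add: in_keys_iff var_def)
      then have "keys (single (e j) (Suc 0) + m) \<notin> P j" using vp by (simp add: SR_def)
      then show False using mP eP by (auto simp: P_def keys_plus_nat)
    qed
    then show ?thesis using ph by (simp add: SR_def)
  qed
  have E: "SRT V (Pow W) \<theta> j i = SR V (P j) i" if "j \<le> card W" for j i
    using that
  proof (induction j arbitrary: i)
    case 0
    then show ?case by (simp add: P_def)
  next
    case (Suc j)
    then have j: "j < card W" by simp
    have ejV: "e j \<in> V" using eW[OF j] W by auto
    have sub: "P (Suc j) \<subseteq> P j" by (auto simp: P_def)
    show ?case
    proof (intro set_eqI iffI)
      fix f :: "('w, 'k) mpoly" assume "f \<in> SRT V (Pow W) \<theta> (Suc j) i"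
      then obtain u p where f: "f = u + \<theta> j * p" "u \<in> SR V (P j) i" "p \<in> forms V (i - 1)"
        using Suc.IH[of i] j by auto
      have "(var (e j) :: ('w, 'k) mpoly) \<in> SR V (P (Suc j)) 1"
        using forms_var[OF ejV] by (auto simp: SR_def P_def var_def)
      then have "p * var (e j) \<in> SR V (P (Suc j)) i" by (rule SR_mult'(1)[OF dcP f(3)]) simp
      moreover have "u \<in> SR V (P (Suc j)) i" using f(2) sub by (auto simp: SR_def)
      ultimately show "f \<in> SR V (P (Suc j)) i" unfolding f(1) using j by (simp add: \<theta>_def SR_add mult.commute)
    next
      fix f :: "('w, 'k) mpoly" assume f: "f \<in> SR V (P (Suc j)) i"
      show "f \<in> SRT V (Pow W) \<theta> (Suc j) i"
      proof (induction f rule: poly_mapping_sum_induct)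
        case (add m k g)
        have m: "keys m \<notin> P (Suc j)" "keys m \<subseteq> V" "int (mon_deg m) = i" using f add(1) by (auto simp: SR_def forms_def)
        have "single m k \<in> SRT V (Pow W) \<theta> (Suc j) i"
        proof (cases "e j \<in> keys m")
          case True
          obtain n where n: "m = single (e j) (Suc 0) + n" using split_var[OF True] by (elim exE)
          have "single n k \<in> forms V (i - 1)" using m(2,3) unfolding n by (auto simp: forms_def keys_plus_nat mon_deg_add)
          from SRT_theta[OF this, of \<theta> j "Pow W"] show ?thesis using j by (simp add: \<theta>_def var_def mult_single n del: SRT.simps)
        next
          case False
          then have "keys m \<notin> P j" using m(1) by (auto simp: P_def lessThan_Suc)
          then have "single m k \<in> SRT V (Pow W) \<theta> j i" using Suc.IH[of i] j m by (auto simp: SR_def forms_def)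
          then show ?thesis by (rule SRT_Suc_mono)
        qed
        then show ?case using add(2) by (rule SRT_add)
      qed (rule SRT_zero)
    qed
  qed
  have "good V (card W) 0 0 N (Pow W) \<theta>"
    unfolding good_def
  proof (intro conjI allI impI ballI)
    fix j i and f :: "('w, 'k) mpoly"
    assume *: "j < card W" "i < N" "f \<in> forms V i" "\<theta> j * f \<in> SRT V (Pow W) \<theta> j (i + 1)"
    then have "var (e j) * f \<in> SR V (P j) (i + 1)" using E[of j] by (simp add: \<theta>_def)
    from div[OF *(1,3) this] show "f \<in> SRT V (Pow W) \<theta> j i" using E[of j] *(1) by simp
  next
    fix i m and f :: "('w, 'k) mpoly"
    assume *: "2 * i + int m = 0" "f \<in> forms V i" "\<theta> (card W) ^ m * f \<in> SRT V (Pow W) \<theta> (card W) (i + int m)"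
    show "f \<in> SRT V (Pow W) \<theta> (card W) i"
    proof (cases "i < 0")
      case True then show ?thesis using *(2) by (rule SRT_neg)
    next
      case False
      then have "i = 0" "m = 0" using *(1) by auto
      then show ?thesis using * by simp
    qed
  next
    fix i :: int assume i: "0 < i"
    have "e ` {..<card W} = W" using e by (simp add: bij_betw_def)
    then have "P (card W) = {{}}" by (auto simp: P_def)
    moreover have "keys m \<noteq> {}" if "int (mon_deg m) = i" for m :: "'w \<Rightarrow>\<^sub>0 nat" using that i by (auto simp: mon_deg_def)
    ultimately show "forms V i \<subseteq> SRT V (Pow W) \<theta> (card W) i"
      unfolding E[OF order_refl] by (auto simp: SR_def forms_def)
  qed (rule lin)
  then show ?thesis by blast
qed

section \<open>Joins of subdivided simplices\<close>

text \<open>The chains in \<open>interval X Y\<close> form the barycentric subdivision of a simplex with vertex set \<open>Y - X\<close>.\<close>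

definition interval :: "'v set \<Rightarrow> 'v set \<Rightarrow> 'v set set" where
  "interval X Y = {H. X \<subset> H \<and> H \<subseteq> Y}"

definition join_vertices :: "('v set \<times> 'v set) set \<Rightarrow> 'v set set" where
  "join_vertices I = (\<Union>(X, Y)\<in>I. interval X Y)"

text \<open>Vertices from different intervals are always adjacent, so for disjoint intervals the
  flag complex of this relation is the join of the order complexes.\<close>

definition comparable_in :: "('v set \<times> 'v set) set \<Rightarrow> 'v set \<Rightarrow> 'v set \<Rightarrow> bool" where
  "comparable_in I H K \<longleftrightarrow> (\<forall>(X, Y)\<in>I. H \<in> interval X Y \<longrightarrow> K \<in> interval X Y \<longrightarrow> H \<subseteq> K \<or> K \<subseteq> H)"

lemma flag_cong:
  assumes "W = W'" "\<And>u v. u \<in> W \<Longrightarrow> v \<in> W \<Longrightarrow> u \<noteq> v \<Longrightarrow> R u v \<longleftrightarrow> R' u v"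
  shows "flag W R = flag W' R'"
  using assms unfolding flag_def by blast

lemma finite_interval: "finite Y \<Longrightarrow> finite (interval X Y)"
  by (rule finite_subset[of _ "Pow Y"]) (auto simp: interval_def)

section \<open>Building one factor of a join by edge subdivisions\<close>

text \<open>\<open>interval X Y\<close> is the factor being built and \<open>i\<close> the vertex
  split off; \<open>Wr\<close> and \<open>Rr\<close> stand for the remaining factors, which are
  joined to everything. The strict inclusion \<open>XZ\<close> says that the factor has at least two
  vertices.\<close>

locale interval_splitting =
  fixes X Y :: "'v set" and i :: 'v and Wr :: "'v set set" and Rr :: "'v set \<Rightarrow> 'v set \<Rightarrow> bool"
    and V :: "'v set set" and dummy :: "'k::field itself"
  assumes finY: "finite Y" and iX: "i \<notin> X" and iY: "i \<in> Y" and XZ: "X \<subset> Y - {i}"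
    and Wr: "Wr \<inter> interval X Y = {}" and V: "Wr \<union> interval X Y \<subseteq> V" and Rr_sym: "\<And>H K. Rr H K \<Longrightarrow> Rr K H"
begin

text \<open>\<open>W U\<close> and \<open>R U\<close> describe the flag complex in which the edges \<open>{F, c}\<close> with \<open>F \<in> U\<close> have been subdivided by \<open>insert i F\<close>.\<close>

definition "Z = Y - {i}"
definition "c = insert i X"
definition W :: "'v set set \<Rightarrow> 'v set set" where
  "W U = interval X Z \<union> {c} \<union> insert i ` U \<union> Wr"
definition R :: "'v set set \<Rightarrow> 'v set \<Rightarrow> 'v set \<Rightarrow> bool" where
  "R U H K \<longleftrightarrow> (if H \<in> Wr \<and> K \<in> Wr then Rr H K
     else H \<in> Wr \<or> K \<in> Wr \<or> H \<subseteq> K \<or> K \<subseteq> H \<or> (H = c \<and> K \<subseteq> Z \<and> K \<notin> U) \<or> (K = c \<and> H \<subseteq> Z \<and> H \<notin> U))"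

definition upset :: "'v set set \<Rightarrow> bool" where
  "upset U \<longleftrightarrow> U \<subseteq> interval X Z \<and> (\<forall>F\<in>U. \<forall>G\<in>interval X Z. F \<subseteq> G \<longrightarrow> G \<in> U)"

lemma ivs: "H \<in> interval X Z \<Longrightarrow> H \<in> interval X Y" "c \<in> interval X Y" "H \<in> interval X Z \<Longrightarrow> insert i H \<in> interval X Y"
  "H \<in> interval X Z \<Longrightarrow> i \<notin> H" "H \<in> interval X Z \<Longrightarrow> H \<subseteq> Z" "i \<notin> Z" "i \<in> c" "Z \<in> interval X Z" "H \<in> interval X Z \<Longrightarrow> X \<subset> H"
  using iX iY XZ by (auto simp: interval_def Z_def c_def)

lemma interval_c:
  assumes "F \<in> interval X Z"
  shows "F \<noteq> c" "insert i F \<noteq> c" "\<not> F \<subseteq> c" "\<not> c \<subseteq> F" "c \<subseteq> insert i F" "i \<notin> F"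
proof -
  have i: "i \<notin> F" "X \<subset> F" using ivs(4,9)[OF assms] .
  obtain x where x: "x \<in> F" "x \<notin> X" using i(2) by blast
  then have "x \<notin> c" using i(1) by (auto simp: c_def)
  then show "\<not> F \<subseteq> c" "insert i F \<noteq> c" "F \<noteq> c" using x(1) by auto
  show "\<not> c \<subseteq> F" "i \<notin> F" using i(1) ivs(7) by auto
  show "c \<subseteq> insert i F" using i(2) by (auto simp: c_def)
qed

lemma not_Wr: "H \<in> interval X Y \<Longrightarrow> H \<notin> Wr" using Wr by blast

lemma W_cases:
  assumes "H \<in> W U" "upset U"
  obtains "H \<in> Wr" | "H \<in> interval X Z" "H \<notin> Wr" | "H = c" "H \<notin> Wr" | G where "G \<in> U" "G \<in> interval X Z" "H = insert i G" "H \<notin> Wr"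
proof -
  consider "H \<in> Wr" | "H \<in> interval X Z" | "H = c" | "H \<in> insert i ` U" using assms(1) unfolding W_def by blast
  then show ?thesis
  proof cases
    case 4
    then obtain G where "G \<in> U" "H = insert i G" by blast
    moreover from this have "G \<in> interval X Z" using assms(2) by (auto simp: upset_def)
    ultimately show ?thesis using that(4) ivs(3) not_Wr by blast
  qed (use that ivs(1,2) not_Wr in blast)+
qed

lemma W_V: "upset U \<Longrightarrow> W U \<subseteq> V"
proof
  fix H assume "upset U" "H \<in> W U"
  then have "H \<in> Wr \<or> H \<in> interval X Y" using W_cases[of H U] ivs(1-3) by metis
  then show "H \<in> V" using V by blast
qed

text \<open>Adjacency to \<open>insert i F\<close> has to agree with membership in the star of
  \<open>{F, c}\<close>. All sets strictly above \<open>F\<close> in \<open>interval X Z\<close>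
  have already lost their edge to \<open>c\<close>, so of the sets without \<open>i\<close> exactly
  the subsets of \<open>F\<close> are left, and these are the ones below \<open>insert i F\<close>.
  A vertex \<open>insert i G\<close> is comparable to it just when it contains
  \<open>F\<close>.\<close>

lemma subdivision_step:
  assumes U: "upset U" and F: "F \<in> interval X Z" "F \<notin> U" and max: "\<And>G. G \<in> interval X Z \<Longrightarrow> F \<subset> G \<Longrightarrow> G \<in> U"
  shows "edge_subdivision V (W U) (R U) (R (insert F U)) F (insert i F) c {v \<in> W U. (v = F \<or> R U v F) \<and> (v = c \<or> R U v c)}"
proof
  have c: "c \<notin> Wr" "F \<notin> Wr" "insert i F \<notin> Wr" "F \<noteq> c" "insert i F \<noteq> c" "\<not> F \<subseteq> c" "\<not> c \<subseteq> F" "i \<notin> F"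
    using interval_c[OF F(1)] not_Wr[OF ivs(2)] not_Wr[OF ivs(1)[OF F(1)]] not_Wr[OF ivs(3)[OF F(1)]] by simp_all
  show "W U \<subseteq> V" by (rule W_V[OF U])
  show "insert i F \<in> V" using ivs(3)[OF F(1)] V by blast
  show "insert i F \<notin> W U"
  proof
    assume "insert i F \<in> W U"
    then show False using U
    proof (cases rule: W_cases)
      case (4 G)
      then have "F = G" using c(8) ivs(4)[of G] by (metis insert_ident)
      then show False using 4 F by simp
    qed (use c ivs(4) in auto)
  qed
  show "F \<in> W U" "c \<in> W U" using F by (auto simp: W_def)
  show "F \<noteq> c" by (rule c)
  show "R U u v \<Longrightarrow> R U v u" for u v unfolding R_def using Rr_sym by auto
  show "R U F c" using F(2) ivs(5)[OF F(1)] by (simp add: R_def c)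
  show "R (insert F U) u v \<longleftrightarrow> R U u v \<and> {u, v} \<noteq> {F, c}" if "u \<in> W U" "v \<in> W U" "u \<noteq> v" for u v
  proof (cases "{u, v} = {F, c}")
    case True
    then have "u = F \<and> v = c \<or> u = c \<and> v = F" by (auto simp: doubleton_eq_iff)
    then show ?thesis using c True by (auto simp: R_def)
  next
    case False
    then have n: "\<not> (u = F \<and> v = c)" "\<not> (u = c \<and> v = F)" by auto
    then have "u = c \<and> v \<subseteq> Z \<and> v \<notin> insert F U \<longleftrightarrow> u = c \<and> v \<subseteq> Z \<and> v \<notin> U"
      "v = c \<and> u \<subseteq> Z \<and> u \<notin> insert F U \<longleftrightarrow> v = c \<and> u \<subseteq> Z \<and> u \<notin> U" by blast+
    then show ?thesis unfolding R_def by (simp only: False simp_thms)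
  qed
  have adj: "R (insert F U) (insert i F) v \<longleftrightarrow> (v = F \<or> R U v F) \<and> (v = c \<or> R U v c)" if v: "v \<in> W U" for v
    using v U
  proof (cases rule: W_cases)
    case 1
    then show ?thesis using c by (simp add: R_def)
  next
    case 2
    note vc = interval_c[OF 2(1)]
    have "\<not> insert i F \<subseteq> v" using vc(6) by blast
    moreover have vF: "v \<subseteq> insert i F \<longleftrightarrow> v \<subseteq> F" using vc(6) by blast
    ultimately have L: "R (insert F U) (insert i F) v \<longleftrightarrow> v \<subseteq> F" using c vc 2(2) by (simp add: R_def)
    have M: "R U v F \<longleftrightarrow> v \<subseteq> F \<or> F \<subseteq> v" using c vc 2(2) by (simp add: R_def)
    have K: "R U v c \<longleftrightarrow> v \<notin> U" using c vc 2(2) ivs(5)[OF 2(1)] by (simp add: R_def)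
    have "v \<notin> U" if "v \<subseteq> F" using that U F 2(1) unfolding upset_def by blast
    moreover have "v \<in> U" if "F \<subset> v" using max[OF 2(1) that] .
    ultimately show ?thesis unfolding L M K using vc(1) by blast
  next
    case 3
    have "R (insert F U) (insert i F) c" using interval_c(5)[OF F(1)] c by (simp add: R_def)
    moreover have "R U c F" using c F(2) ivs(5)[OF F(1)] by (simp add: R_def)
    ultimately show ?thesis unfolding 3(1) by simp
  next
    case (4 G)
    note Gc = interval_c[OF 4(2)]
    have "\<not> G \<subseteq> F" using U 4(1) F unfolding upset_def by blast
    then have GF: "\<not> insert i G \<subseteq> insert i F" "\<not> insert i G \<subseteq> F" "insert i G \<noteq> F" using Gc(6) c(8) by blast+
    have "insert i F \<subseteq> insert i G \<longleftrightarrow> F \<subseteq> insert i G" by blast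
    then have L: "R (insert F U) (insert i F) v \<longleftrightarrow> F \<subseteq> v" using c Gc(2) 4(3,4) GF by (simp add: R_def)
    have M: "R U v F \<longleftrightarrow> F \<subseteq> v" using c Gc(2) 4(3,4) GF by (simp add: R_def)
    have K: "R U v c" using c Gc(2,5) 4(3,4) by (simp add: R_def)
    show ?thesis using L M K GF(3) 4(3) by simp
  qed
  show "R (insert F U) (insert i F) v \<longleftrightarrow> v \<in> {v \<in> W U. (v = F \<or> R U v F) \<and> (v = c \<or> R U v c)}" if "v \<in> W U" for v
    using adj[OF that] that by simp
  have RS: "R U' u v \<longleftrightarrow> R U' v u" for U' u v unfolding R_def using Rr_sym by auto
  show "R (insert F U) v (insert i F) \<longleftrightarrow> v \<in> {v \<in> W U. (v = F \<or> R U v F) \<and> (v = c \<or> R U v c)}" if "v \<in> W U" for v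
    unfolding RS[of _ v "insert i F"] using adj[OF that] that by simp
qed simp

text \<open>Before any subdivision \<open>Z\<close> contains every vertex of
  \<open>interval X Z\<close> and \<open>c\<close> is joined to all of them, so both ends of the
  first edge are cone points.\<close>

lemma star_top: "{v \<in> W {}. (v = Z \<or> R {} v Z) \<and> (v = c \<or> R {} v c)} = W {}"
proof -
  have "upset {}" by (simp add: upset_def)
  have "(v = Z \<or> R {} v Z) \<and> (v = c \<or> R {} v c)" if v: "v \<in> W {}" for v
    using v \<open>upset {}\<close> by (cases rule: W_cases) (use ivs not_Wr in \<open>auto simp: R_def\<close>)
  then show ?thesis by blast
qed

text \<open>A vertex of \<open>interval X Z\<close> that still has its edge to \<open>c\<close> is
  outside \<open>U\<close>, hence not strictly above \<open>F\<close>, and adjacency to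
  \<open>F\<close> puts it below. Vertices \<open>insert i G\<close> adjacent to \<open>F\<close>
  satisfy \<open>F \<subset> G\<close>. The star is thus again a join of intervals.\<close>

lemma star_link:
  assumes U: "upset U" "Z \<in> U" and F: "F \<in> interval X Z" "F \<notin> U" and max: "\<And>G. G \<in> interval X Z \<Longrightarrow> F \<subset> G \<Longrightarrow> G \<in> U"
  shows "{v \<in> W U. (v = F \<or> R U v F) \<and> (v = c \<or> R U v c)} = interval X F \<union> {c} \<union> interval (insert i F) Y \<union> Wr"
proof (intro set_eqI iffI)
  have c: "c \<notin> Wr" "F \<notin> Wr" "F \<noteq> c" "\<not> F \<subseteq> c" "\<not> c \<subseteq> F" "i \<notin> F" "X \<subset> F"
    using interval_c[OF F(1)] not_Wr[OF ivs(2)] not_Wr[OF ivs(1)[OF F(1)]] ivs(9)[OF F(1)] by simp_all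
  have Rc: "R U c F" using F(2) ivs(5)[OF F(1)] by (simp add: R_def c)
  fix v
  {
    assume "v \<in> {v \<in> W U. (v = F \<or> R U v F) \<and> (v = c \<or> R U v c)}"
    then have v: "v \<in> W U" "v = F \<or> R U v F" "v = c \<or> R U v c" by auto
    from v(1) U(1) show "v \<in> interval X F \<union> {c} \<union> interval (insert i F) Y \<union> Wr"
    proof (cases rule: W_cases)
      case 2
      have ne: "v \<noteq> c" "v \<subseteq> Z" "\<not> c \<subseteq> v" "\<not> v \<subseteq> c"
        using 2(1) ivs(4)[OF 2(1)] ivs(5,9)[OF 2(1)] ivs(7) by (auto simp: c_def)
      then have "v \<notin> U" using v(3) c 2 by (auto simp: R_def)
      then have "\<not> F \<subset> v" using max[OF 2(1)] by blast
      then have "v \<subseteq> F" using v(2) c 2 ne by (auto simp: R_def)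
      then show ?thesis using ivs(9)[OF 2(1)] by (simp add: interval_def)
    next
      case (4 G)
      have "\<not> G \<subseteq> F" using U 4(1) F unfolding upset_def by blast
      have "\<not> v \<subseteq> F" "v \<noteq> F" using 4(3) c(6) by auto
      moreover have "v \<noteq> c" using 4(2,3) ivs(4,9)[OF 4(2)] iX unfolding c_def by (metis insert_ident psubset_eq)
      ultimately have "F \<subseteq> v" using v(2) 4 c by (auto simp: R_def)
      then have "insert i F \<subseteq> v" "insert i F \<noteq> v" using 4(3) \<open>\<not> G \<subseteq> F\<close> ivs(4)[OF 4(2)] by auto
      moreover have "v \<subseteq> Y" using ivs(3)[OF 4(2)] 4(3) by (simp add: interval_def)
      ultimately show ?thesis by (auto simp: interval_def)
    qed simp_all
  }
  {
    assume "v \<in> interval X F \<union> {c} \<union> interval (insert i F) Y \<union> Wr"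
    then consider "v \<in> interval X F" | "v = c" | "v \<in> interval (insert i F) Y" | "v \<in> Wr" by blast
    then show "v \<in> {v \<in> W U. (v = F \<or> R U v F) \<and> (v = c \<or> R U v c)}"
    proof cases
      case 1
      then have vZ: "v \<in> interval X Z" "v \<subseteq> F" using F(1) by (auto simp: interval_def)
      then have "v \<notin> U" using U(1) F unfolding upset_def by blast
      then show ?thesis using vZ ivs(5)[OF vZ(1)] c not_Wr[OF ivs(1)[OF vZ(1)]] by (auto simp: W_def R_def)
    next
      case 2
      then show ?thesis using Rc by (simp add: W_def)
    next
      case 3
      define G where "G = v - {i}"
      have v: "v = insert i G" "F \<subset> G" using 3 c(6) by (auto simp: G_def interval_def)
      then have G: "G \<in> interval X Z" using 3 c(7) by (auto simp: interval_def Z_def G_def)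
      then have "G \<in> U" using max v(2) by blast
      moreover have "F \<subseteq> v" "c \<subseteq> v" using v c(7) by (auto simp: c_def)
      ultimately show ?thesis using v not_Wr[OF ivs(3)[OF G]] c by (auto simp: W_def R_def)
    next
      case 4
      then show ?thesis using c by (auto simp: W_def R_def)
    qed
  }
qed

lemma W_full: "W (interval X Z) = interval X Y \<union> Wr"
proof -
  have "H \<in> interval X Z \<union> {c} \<union> insert i ` interval X Z" if H: "H \<in> interval X Y" for H
  proof (cases "i \<in> H")
    case False
    then show ?thesis using H by (auto simp: interval_def Z_def)
  next
    case True
    then have e: "H = insert i (H - {i})" by auto
    show ?thesis
    proof (cases "H - {i} = X")
      case True
      then show ?thesis using e by (simp add: c_def)
    next
      case False
      then have "H - {i} \<in> interval X Z" using H iX by (auto simp: interval_def Z_def)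
      then show ?thesis using e by blast
    qed
  qed
  then show ?thesis using ivs(1-3) unfolding W_def by blast
qed

text \<open>The induction on \<open>U\<close> removes the most recently subdivided edge. The
  suspension step at \<open>{Z, c}\<close> is the only one that gains a unit of \<open>s\<close>
  over its base.\<close>

lemma full_complex:
  assumes inf: "infinite (UNIV :: 'k set)" and finV: "finite V" and N: "s < N" "0 \<le> s"
    and base: "\<exists>\<theta>::nat \<Rightarrow> ('v set, 'k) mpoly. good V D (s - 1) (s - 1) N (flag (W {}) (R {})) \<theta>"
    and links: "\<And>F U. F \<in> interval X Z \<Longrightarrow> F \<noteq> Z \<Longrightarrow> upset U \<Longrightarrow> Z \<in> U \<Longrightarrow> F \<notin> U \<Longrightarrow>
       (\<And>G. G \<in> interval X Z \<Longrightarrow> F \<subset> G \<Longrightarrow> G \<in> U) \<Longrightarrow>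
       \<exists>\<theta>::nat \<Rightarrow> ('v set, 'k) mpoly. good V D (s - 2) (s - 2) N (flag (interval X F \<union> {c} \<union> interval (insert i F) Y \<union> Wr) (R U)) \<theta>"
  shows "\<exists>\<theta>::nat \<Rightarrow> ('v set, 'k) mpoly. good V D s s N (flag (W (interval X Z)) (R (interval X Z))) \<theta>"
proof -
  have Wins: "insert (insert i F) (W U) = W (insert F U)" for F U by (auto simp: W_def)
  have "\<exists>\<theta>::nat \<Rightarrow> ('v set, 'k) mpoly. good V D s s N (flag (W U) (R U)) \<theta>" if "upset U" "Z \<in> U" for U
    using that
  proof (induction "card U" arbitrary: U rule: less_induct)
    case less
    have finU: "finite U" using less(2) finite_interval[of Z X] finY finite_subset by (auto simp: upset_def Z_def)
    show ?case
    proof (cases "U = {Z}")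
      case True
      have "upset {}" by (simp add: upset_def)
      interpret es: edge_subdivision V "W {}" "R {}" "R {Z}" Z "insert i Z" c "W {}" "TYPE('k)"
        using subdivision_step[OF \<open>upset {}\<close> ivs(8)] ivs(8) unfolding star_top by (auto simp: interval_def)
      have "\<exists>\<theta>::nat \<Rightarrow> ('v set, 'k) mpoly. good V D s s N es.\<Gamma>' \<theta>"
        by (rule es.ex_good_suspension[OF inf finV _ _ _ refl]) (use N base in \<open>auto simp: es.\<Gamma>_def\<close>)
      then show ?thesis unfolding es.\<Gamma>'_def Wins True .
    next
      case False
      then have ne: "card ` (U - {Z}) \<noteq> {}" "finite (card ` (U - {Z}))" using less(3) finU by auto
      \<comment> \<open>A member of least cardinality: without it \<open>U\<close> is still closed
        upwards, and everything above it stays in, as \<open>subdivision_step\<close>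
        demands.\<close>
      obtain F where F: "F \<in> U - {Z}" "\<And>G. G \<in> U - {Z} \<Longrightarrow> card F \<le> card G"
        using Min_in[OF ne(2,1)] Min_le[OF ne(2)] by (metis (no_types, lifting) imageE image_eqI)
      define U0 where "U0 = U - {F}"
      have UU: "U = insert F U0" "F \<notin> U0" using F(1) by (auto simp: U0_def)
      have FZ: "F \<in> interval X Z" "F \<noteq> Z" using F(1) less(2) by (auto simp: upset_def)
      have up0: "upset U0"
        unfolding upset_def
      proof (intro conjI ballI impI)
        show "U0 \<subseteq> interval X Z" using less(2) by (auto simp: upset_def U0_def)
        fix H G assume H: "H \<in> U0" "G \<in> interval X Z" "H \<subseteq> G"
        then have "G \<in> U" using less(2) by (auto simp: upset_def U0_def)
        moreover have "G \<noteq> F"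
        proof
          assume "G = F"
          then have "H \<subset> F" "H \<noteq> Z" using H FZ by (auto simp: U0_def interval_def)
          moreover have "finite F" using FZ(1) finY finite_subset by (auto simp: interval_def Z_def)
          ultimately have "card H < card F" by (intro psubset_card_mono)
          then show False using F(2)[of H] H(1) \<open>H \<noteq> Z\<close> by (simp add: U0_def)
        qed
        ultimately show "G \<in> U0" by (simp add: U0_def)
      qed
      have max: "G \<in> U0" if "G \<in> interval X Z" "F \<subset> G" for G
        using that less(2) F(1) unfolding upset_def U0_def by blast
      have Z0: "Z \<in> U0" using less(3) FZ(2) by (simp add: U0_def)
      have se: "edge_subdivision V (W U0) (R U0) (R (insert F U0)) F (insert i F) c {v \<in> W U0. (v = F \<or> R U0 v F) \<and> (v = c \<or> R U0 v c)}"
        by (rule subdivision_step[OF up0 FZ(1) UU(2)]) (rule max)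
      have sl: "{v \<in> W U0. (v = F \<or> R U0 v F) \<and> (v = c \<or> R U0 v c)} = interval X F \<union> {c} \<union> interval (insert i F) Y \<union> Wr"
        by (rule star_link[OF up0 Z0 FZ(1) UU(2)]) (rule max)
      interpret es: edge_subdivision V "W U0" "R U0" "R (insert F U0)" F "insert i F" c "interval X F \<union> {c} \<union> interval (insert i F) Y \<union> Wr" "TYPE('k)"
        using se unfolding sl .
      have "card U0 < card U" using finU F(1) unfolding U0_def by (intro psubset_card_mono) auto
      from less(1)[OF this up0 Z0] have 1: "\<exists>\<theta>::nat \<Rightarrow> ('v set, 'k) mpoly. good V D s s N es.\<Gamma> \<theta>" unfolding es.\<Gamma>_def .
      have 2: "\<exists>\<theta>::nat \<Rightarrow> ('v set, 'k) mpoly. good V D (s - 2) (s - 1) N es.\<Gamma>s \<theta>"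
      proof -
        have "\<exists>\<theta>::nat \<Rightarrow> ('v set, 'k) mpoly. good V D (s - 2) (s - 2) N es.\<Gamma>s \<theta>"
          unfolding es.\<Gamma>s_def by (rule links[OF FZ up0 Z0 UU(2)]) (rule max)
        then obtain \<theta> :: "nat \<Rightarrow> ('v set, 'k) mpoly" where "good V D (s - 2) (s - 2) N es.\<Gamma>s \<theta>" by (elim exE)
        \<comment> \<open>The top degree bound is relaxed by one, since the subdivision step asks
          for \<open>w - 1\<close> with \<open>w = s\<close>.\<close>
        then have "good V D (s - 2) (s - 1) N es.\<Gamma>s \<theta>" unfolding good_def by auto
        then show ?thesis by (intro exI[of _ \<theta>])
      qed
      have "\<exists>\<theta>::nat \<Rightarrow> ('v set, 'k) mpoly. good V D s s N es.\<Gamma>' \<theta>"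
        by (rule es.ex_good_subdivision[OF inf finV _ _ _ 1 2]) (use N in auto)
      then show ?thesis unfolding es.\<Gamma>'_def Wins UU(1) .
    qed
  qed
  moreover have "upset (interval X Z)" by (simp add: upset_def)
  ultimately show ?thesis using ivs(8) by blast
qed

end

section \<open>Induction over joins\<close>

definition join_ok :: "('v set \<times> 'v set) set \<Rightarrow> bool" where
  "join_ok I \<longleftrightarrow> finite I \<and> (\<forall>(X, Y)\<in>I. finite Y \<and> X \<subset> Y) \<and>
     (\<forall>p\<in>I. \<forall>q\<in>I. p \<noteq> q \<longrightarrow> interval (fst p) (snd p) \<inter> interval (fst q) (snd q) = {})"

definition total_rank :: "('v set \<times> 'v set) set \<Rightarrow> nat" where
  "total_rank I = (\<Sum>(X, Y)\<in>I. card (Y - X))"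

text \<open>The degree of the h-polynomial of the join. The subtraction does not truncate when
  \<open>X \<subset> Y\<close> and \<open>Y\<close> is finite.\<close>

definition excess :: "('v set \<times> 'v set) set \<Rightarrow> nat" where
  "excess I = (\<Sum>(X, Y)\<in>I. card (Y - X) - 1)"

lemma comparable_in_Un: "comparable_in (J \<union> I) H K \<longleftrightarrow> comparable_in J H K \<and> comparable_in I H K"
  by (auto simp: comparable_in_def)

lemma comparable_in_outside: "H \<notin> join_vertices I \<or> K \<notin> join_vertices I \<Longrightarrow> comparable_in I H K"
  by (fastforce simp: comparable_in_def join_vertices_def)

lemma join_vertices_Un: "join_vertices (J \<union> I) = join_vertices J \<union> join_vertices I"
  by (auto simp: join_vertices_def)

lemma join_ok_Un:
  assumes J: "join_ok J" and I: "join_ok I" and d: "join_vertices J \<inter> join_vertices I = {}"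
  shows "join_ok (J \<union> I)" and "J \<inter> I = {}"
proof -
  have sub: "interval (fst p) (snd p) \<subseteq> join_vertices A" if "p \<in> A" for p A using that by (force simp: join_vertices_def)
  have ne: "snd p \<in> interval (fst p) (snd p)" if "p \<in> J" for p using that J by (fastforce simp: join_ok_def interval_def)
  show "J \<inter> I = {}"
  proof (rule ccontr)
    assume "J \<inter> I \<noteq> {}"
    then obtain p where "p \<in> J" "p \<in> I" by blast
    then show False using sub[of p J] sub[of p I] ne[of p] d by blast
  qed
  have "interval (fst p) (snd p) \<inter> interval (fst q) (snd q) = {}" if pq: "p \<in> J \<union> I" "q \<in> J \<union> I" and "p \<noteq> q" for p q
  proof -
    consider "p \<in> J" "q \<in> J" | "p \<in> I" "q \<in> I" | "p \<in> J" "q \<in> I" | "p \<in> I" "q \<in> J" using pq by blast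
    then show ?thesis
    proof cases
      case 1 then show ?thesis using J \<open>p \<noteq> q\<close> by (simp add: join_ok_def)
    next
      case 2 then show ?thesis using I \<open>p \<noteq> q\<close> by (simp add: join_ok_def)
    next
      case 3 then show ?thesis using sub[OF 3(1)] sub[OF 3(2)] d by blast
    next
      case 4 then show ?thesis using sub[OF 4(1)] sub[OF 4(2)] d by blast
    qed
  qed
  moreover have "finite (J \<union> I)" "\<forall>(X, Y)\<in>J \<union> I. finite Y \<and> X \<subset> Y" using I J by (auto simp: join_ok_def)
  ultimately show "join_ok (J \<union> I)" by (simp add: join_ok_def)
qed

context interval_splitting
begin

text \<open>Vertices of the other factors are joined to the split factor on both sides, so only the
  relation inside that factor has to be compared.\<close>

lemma flag_join:
  assumes Wr': "Wr = join_vertices I" "Rr = comparable_in I" and J: "join_vertices J \<subseteq> interval X Y"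
    and eq: "\<And>u v. u \<in> join_vertices J \<Longrightarrow> v \<in> join_vertices J \<Longrightarrow> u \<noteq> v \<Longrightarrow> R U u v \<longleftrightarrow> comparable_in J u v"
  shows "flag (join_vertices J \<union> Wr) (R U) = flag (join_vertices (J \<union> I)) (comparable_in (J \<union> I))"
proof (rule flag_cong)
  show "join_vertices J \<union> Wr = join_vertices (J \<union> I)" by (simp add: Wr' join_vertices_Un)
  have d: "H \<notin> join_vertices J" if "H \<in> Wr" for H using that J Wr by blast
  fix u v assume uv: "u \<in> join_vertices J \<union> Wr" "v \<in> join_vertices J \<union> Wr" "u \<noteq> v"
  show "R U u v \<longleftrightarrow> comparable_in (J \<union> I) u v"
  proof (cases "u \<in> Wr \<or> v \<in> Wr")
    case True
    then have J': "comparable_in J u v" using d comparable_in_outside[of u J v] by blast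
    show ?thesis
    proof (cases "u \<in> Wr \<and> v \<in> Wr")
      case True
      then show ?thesis unfolding R_def comparable_in_Un using J' by (simp add: Wr'(2))
    next
      case False
      then have "comparable_in I u v" using comparable_in_outside[of u I v] Wr'(1) by blast
      moreover have "R U u v" using False True \<open>u \<in> Wr \<or> v \<in> Wr\<close> by (auto simp: R_def)
      ultimately show ?thesis using J' by (simp add: comparable_in_Un)
    qed
  next
    case False
    then have "comparable_in I u v" using comparable_in_outside[of u I v] Wr'(1) by blast
    then show ?thesis using eq[of u v] uv False by (simp add: comparable_in_Un)
  qed
qed

text \<open>Makes the cone point a factor \<open>(X, c)\<close> of rank one and excess zero, so that
  base and links fit the format of joins.\<close>

lemma interval_to_c: "interval X c = {c}"
  using iX unfolding interval_def c_def by blast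

lemma R_inside: "H \<notin> Wr \<Longrightarrow> K \<notin> Wr \<Longrightarrow> R U H K \<longleftrightarrow> H \<subseteq> K \<or> K \<subseteq> H \<or> (H = c \<and> K \<subseteq> Z \<and> K \<notin> U) \<or> (K = c \<and> H \<subseteq> Z \<and> H \<notin> U)"
  by (simp add: R_def)

lemma flag_full:
  assumes "Wr = join_vertices I" "Rr = comparable_in I"
  shows "flag (W (interval X Z)) (R (interval X Z)) = flag (join_vertices ({(X, Y)} \<union> I)) (comparable_in ({(X, Y)} \<union> I))"
proof -
  have "flag (join_vertices {(X, Y)} \<union> Wr) (R (interval X Z)) = flag (join_vertices ({(X, Y)} \<union> I)) (comparable_in ({(X, Y)} \<union> I))"
  proof (rule flag_join[OF assms])
    fix u v assume "u \<in> join_vertices {(X, Y)}" "v \<in> join_vertices {(X, Y)}"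
    then have uv: "u \<in> interval X Y" "v \<in> interval X Y" by (simp_all add: join_vertices_def)
    have n: "(H \<subseteq> Z \<and> H \<notin> interval X Z) = False" if "H \<in> interval X Y" for H using that by (auto simp: interval_def)
    have "comparable_in {(X, Y)} u v \<longleftrightarrow> u \<subseteq> v \<or> v \<subseteq> u" using uv by (simp add: comparable_in_def)
    then show "R (interval X Z) u v \<longleftrightarrow> comparable_in {(X, Y)} u v"
      unfolding R_inside[OF not_Wr[OF uv(1)] not_Wr[OF uv(2)]] n[OF uv(1)] n[OF uv(2)] by simp
  qed (simp add: join_vertices_def)
  then show ?thesis unfolding W_full by (simp add: join_vertices_def)
qed

lemma flag_start:
  assumes "Wr = join_vertices I" "Rr = comparable_in I"
  shows "flag (W {}) (R {}) = flag (join_vertices ({(X, Z), (X, c)} \<union> I)) (comparable_in ({(X, Z), (X, c)} \<union> I))"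
proof -
  have VJ: "join_vertices {(X, Z), (X, c)} = interval X Z \<union> {c}" by (simp add: join_vertices_def interval_to_c)
  have "flag (join_vertices {(X, Z), (X, c)} \<union> Wr) (R {}) = flag (join_vertices ({(X, Z), (X, c)} \<union> I)) (comparable_in ({(X, Z), (X, c)} \<union> I))"
  proof (rule flag_join[OF assms])
    show "join_vertices {(X, Z), (X, c)} \<subseteq> interval X Y" unfolding VJ using ivs(1,2) by blast
    fix u v assume "u \<in> join_vertices {(X, Z), (X, c)}" "v \<in> join_vertices {(X, Z), (X, c)}" and ne: "u \<noteq> v"
    then have uv: "u \<in> interval X Z \<or> u = c" "v \<in> interval X Z \<or> v = c" by (auto simp: VJ)
    then have "u \<notin> Wr" "v \<notin> Wr" using not_Wr ivs(1,2) by blast+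
    note Rin = R_inside[OF this, of "{}"]
    have cZ: "c \<notin> interval X Z" using ivs(4,7) by blast
    from uv ne consider "u \<in> interval X Z" "v \<in> interval X Z" | "u = c" "v \<in> interval X Z" | "u \<in> interval X Z" "v = c" by blast
    then show "R {} u v \<longleftrightarrow> comparable_in {(X, Z), (X, c)} u v"
    proof cases
      case 1
      then have "u \<noteq> c" "v \<noteq> c" using cZ by blast+
      then show ?thesis using 1 unfolding Rin by (simp add: comparable_in_def interval_to_c)
    next
      case 2
      then show ?thesis using ivs(5)[OF 2(2)] cZ unfolding Rin by (auto simp: comparable_in_def interval_to_c)
    next
      case 3
      then show ?thesis using ivs(5)[OF 3(1)] cZ unfolding Rin by (auto simp: comparable_in_def interval_to_c)
    qed
  qed
  moreover have "W {} = join_vertices {(X, Z), (X, c)} \<union> Wr" by (simp add: W_def VJ)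
  ultimately show ?thesis by simp
qed

lemma flag_link:
  assumes I: "Wr = join_vertices I" "Rr = comparable_in I" and U: "upset U" and F: "F \<in> interval X Z" "F \<notin> U"
  shows "flag (interval X F \<union> {c} \<union> interval (insert i F) Y \<union> Wr) (R U) =
    flag (join_vertices ({(X, F), (X, c), (insert i F, Y)} \<union> I)) (comparable_in ({(X, F), (X, c), (insert i F, Y)} \<union> I))"
proof -
  let ?J = "{(X, F), (X, c), (insert i F, Y)}"
  have VJ: "join_vertices ?J = interval X F \<union> {c} \<union> interval (insert i F) Y" by (auto simp: join_vertices_def interval_to_c)
  have FZ: "F \<subseteq> Z" "X \<subset> F" using ivs(5,9)[OF F(1)] .
  have low: "v \<in> interval X Y \<and> v \<subseteq> Z \<and> v \<notin> U \<and> i \<notin> v \<and> v \<noteq> c" if "v \<in> interval X F" for v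
  proof -
    have "v \<in> interval X Z" "v \<subseteq> F" using that FZ by (auto simp: interval_def)
    then show ?thesis using ivs(1)[of v] ivs(4)[of v] ivs(5)[of v] ivs(7) U F unfolding upset_def by blast
  qed
  have high: "v \<in> interval X Y \<and> i \<in> v \<and> c \<subseteq> v \<and> F \<subseteq> v \<and> v \<noteq> c \<and> \<not> v \<subseteq> Z" if "v \<in> interval (insert i F) Y" for v
  proof -
    have v: "insert i F \<subset> v" "v \<subseteq> Y" using that by (auto simp: interval_def)
    then have "\<not> v \<subseteq> c" using interval_c(3)[OF F(1)] by blast
    then show ?thesis using v FZ ivs(6) by (auto simp: interval_def c_def)
  qed
  have "flag (join_vertices ?J \<union> Wr) (R U) = flag (join_vertices (?J \<union> I)) (comparable_in (?J \<union> I))"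
  proof (rule flag_join[OF I])
    show "join_vertices ?J \<subseteq> interval X Y" unfolding VJ using low high ivs(2) by blast
    fix u v assume "u \<in> join_vertices ?J" "v \<in> join_vertices ?J" and ne: "u \<noteq> v"
    then have uv: "u \<in> interval X F \<or> u = c \<or> u \<in> interval (insert i F) Y" "v \<in> interval X F \<or> v = c \<or> v \<in> interval (insert i F) Y" by (auto simp: VJ)
    then have "u \<notin> Wr" "v \<notin> Wr" using not_Wr low high ivs(2) by blast+
    note Rin = R_inside[OF this, of U]
    have cc: "c \<notin> interval X F" "c \<notin> interval (insert i F) Y" using low high by blast+
    have lh: "x \<notin> interval (insert i F) Y" if "x \<in> interval X F" for x using low[OF that] high[of x] by blast
    have hl: "x \<subseteq> y" if "x \<in> interval X F" "y \<in> interval (insert i F) Y" for x y using that by (auto simp: interval_def)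
    from uv ne consider "u \<in> interval X F" "v \<in> interval X F" | "u \<in> interval (insert i F) Y" "v \<in> interval (insert i F) Y"
      | "u \<in> interval X F" "v \<in> interval (insert i F) Y" | "v \<in> interval X F" "u \<in> interval (insert i F) Y"
      | "u = c" "v \<in> interval X F" | "v = c" "u \<in> interval X F" | "u = c" "v \<in> interval (insert i F) Y" | "v = c" "u \<in> interval (insert i F) Y" by blast
    then show "R U u v \<longleftrightarrow> comparable_in ?J u v"
    proof cases
      case 1
      then show ?thesis using low[OF 1(1)] low[OF 1(2)] lh unfolding Rin by (simp add: comparable_in_def interval_to_c)
    next
      case 2
      then show ?thesis using high[OF 2(1)] high[OF 2(2)] lh unfolding Rin by (auto simp: comparable_in_def interval_to_c)
    next
      case 3
      then show ?thesis using hl[OF 3] low[OF 3(1)] high[OF 3(2)] lh[of u] lh[of v] unfolding Rin by (auto simp: comparable_in_def interval_to_c)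
    next
      case 4
      then show ?thesis using hl[OF 4] low[OF 4(1)] high[OF 4(2)] lh[of u] lh[of v] unfolding Rin by (auto simp: comparable_in_def interval_to_c)
    next
      case 5
      then show ?thesis using low[OF 5(2)] cc unfolding Rin by (auto simp: comparable_in_def interval_to_c)
    next
      case 6
      then show ?thesis using low[OF 6(2)] cc unfolding Rin by (auto simp: comparable_in_def interval_to_c)
    next
      case 7
      then show ?thesis using high[OF 7(2)] cc unfolding Rin by (auto simp: comparable_in_def interval_to_c)
    next
      case 8
      then show ?thesis using high[OF 8(2)] cc unfolding Rin by (auto simp: comparable_in_def interval_to_c)
    qed
  qed
  then show ?thesis unfolding VJ .
qed

end

lemma sums_Un:
  assumes "finite J" "finite I" "J \<inter> I = {}"
  shows "total_rank (J \<union> I) = total_rank J + total_rank I" "excess (J \<union> I) = excess J + excess I"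
  using assms by (simp_all add: total_rank_def excess_def sum.union_disjoint)

text \<open>Induction on \<open>excess\<close>. Splitting a factor leads to a base complex with
  excess one less and to links with excess two less, all of the same rank, as
  \<open>full_complex\<close> requires for \<open>s = excess I\<close>.\<close>

theorem good_join:
  assumes inf: "infinite (UNIV :: 'k::field set)" and V: "finite V"
    and I: "join_ok I" "join_vertices I \<subseteq> V" and N: "int (excess I) < N"
  shows "\<exists>\<theta>::nat \<Rightarrow> ('v set, 'k) mpoly. good V (total_rank I) (int (excess I)) (int (excess I)) N (flag (join_vertices I) (comparable_in I)) \<theta>"
  using I N
proof (induction "excess I" arbitrary: I rule: less_induct)
  case less
  have fin: "finite I" and XY: "\<And>X Y. (X, Y) \<in> I \<Longrightarrow> finite Y \<and> X \<subset> Y" using less(2) by (auto simp: join_ok_def)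
  have pos: "card (Y - X) \<ge> 1" if "(X, Y) \<in> I" for X Y
  proof -
    have "finite (Y - X)" "Y - X \<noteq> {}" using XY[OF that] by auto
    then show ?thesis using card_gt_0_iff[of "Y - X"] by linarith
  qed
  show ?case
  \<comment> \<open>If every factor is a single point, the join is an ordinary simplex and the
    excess is zero.\<close>
  proof (cases "\<forall>(X, Y)\<in>I. card (Y - X) = 1")
    case True
    have iv1: "interval X Y = {Y}" if "(X, Y) \<in> I" for X Y
    proof -
      obtain x where x: "Y - X = {x}" using True \<open>(X, Y) \<in> I\<close> card_1_singletonE by blast
      have "H = Y" if H: "X \<subset> H" "H \<subseteq> Y" for H
      proof -
        obtain h where "h \<in> H" "h \<notin> X" using H(1) by blast
        then have "h \<in> Y - X" using H(2) by blast
        then have xH: "x \<in> H" using x \<open>h \<in> H\<close> by simp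
        have "y \<in> H" if "y \<in> Y" for y
          using that H(1) xH x by (cases "y \<in> X") auto
        then show ?thesis using H(2) by blast
      qed
      then show ?thesis using XY[OF that] unfolding interval_def by auto
    qed
    have VI: "join_vertices I = snd ` I" unfolding join_vertices_def using iv1 by force
    have inj: "inj_on snd I"
    proof (rule inj_onI, rule ccontr)
      fix p q assume pq: "p \<in> I" "q \<in> I" "snd p = snd q" "p \<noteq> q"
      then have "interval (fst p) (snd p) \<inter> interval (fst q) (snd q) = {}"
        using less(2) pq(1,2,4) unfolding join_ok_def by blast
      moreover have "(fst p, snd p) \<in> I" "(fst q, snd q) \<in> I" unfolding prod.collapse using pq by blast+
      ultimately show False using iv1[of "fst p" "snd p"] iv1[of "fst q" "snd q"] pq(3) by simp
    qed
    have e0: "excess I = 0" unfolding excess_def using True by (intro sum.neutral) auto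
    have "total_rank I = (\<Sum>p\<in>I. 1)" unfolding total_rank_def using True by (intro sum.cong) auto
    then have D: "total_rank I = card (join_vertices I)" using card_image[OF inj] by (simp add: VI)
    have "comparable_in I H K" if "H \<noteq> K" for H K
      unfolding comparable_in_def using iv1 that by auto
    then have fl: "flag (join_vertices I) (comparable_in I) = Pow (join_vertices I)" by (auto simp: flag_def)
    have "finite (join_vertices I)" using fin VI by simp
    moreover have "0 \<le> N" using less(4) by simp
    ultimately show ?thesis unfolding e0 D fl of_nat_0 by (intro good_simplex less(3))
  next
    case False
    then obtain X Y where XYI: "(X, Y) \<in> I" "card (Y - X) \<noteq> 1" by auto
    have fY: "finite Y" "X \<subset> Y" using XY[OF XYI(1)] by auto
    obtain i where i: "i \<in> Y" "i \<notin> X" using fY by blast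
    have cY: "card (Y - X) \<ge> 2" using pos[OF XYI(1)] XYI(2) by simp
    define I' where "I' = I - {(X, Y)}"
    have II: "I = {(X, Y)} \<union> I'" using XYI by (auto simp: I'_def)
    have okI': "join_ok I'" using less(2) by (auto simp: join_ok_def I'_def)
    have dis: "join_vertices I' \<inter> interval X Y = {}"
    proof -
      have "interval (fst p) (snd p) \<inter> interval X Y = {}" if "p \<in> I'" for p
        using less(2) that XYI(1) unfolding join_ok_def I'_def by (metis DiffD1 DiffD2 fst_conv insertI1 snd_conv)
      then show ?thesis by (force simp: join_vertices_def)
    qed
    have XZ: "X \<subset> Y - {i}"
    proof -
      have "X \<noteq> Y - {i}"
      proof
        assume "X = Y - {i}"
        then have "Y - X = {i}" using i by auto
        then show False using cY by simp
      qed
      then show ?thesis using fY i by blast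
    qed
    have "join_vertices I = interval X Y \<union> join_vertices I'" by (subst II) (simp add: join_vertices_def)
    then have VV: "join_vertices I' \<union> interval X Y \<subseteq> V" using less(3) by blast
    have symR: "comparable_in I' K H" if "comparable_in I' H K" for H K using that by (auto simp: comparable_in_def)
    interpret sp: interval_splitting X Y i "join_vertices I'" "comparable_in I'" V "TYPE('k)"
      by unfold_locales (use fY i XZ dis VV symR in auto)
    have cc: "card (sp.c - X) = 1" using i by (simp add: sp.c_def insert_Diff_if)
    have cZ: "card (sp.Z - X) + 1 = card (Y - X)"
    proof -
      have "Y - X = insert i (sp.Z - X)" "i \<notin> sp.Z - X" using i by (auto simp: sp.Z_def)
      then show ?thesis using fY by (simp add: sp.Z_def)
    qed
    have fin': "finite I'" using fin by (simp add: I'_def)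
    have sI: "total_rank I = card (Y - X) + total_rank I'" "excess I = card (Y - X) - 1 + excess I'"
    proof -
      have "finite {(X, Y)}" "{(X, Y)} \<inter> I' = {}" by (simp_all add: I'_def)
      note s = sums_Un[OF this(1) fin' this(2), folded II]
      have "total_rank {(X, Y)} = card (Y - X)" "excess {(X, Y)} = card (Y - X) - 1"
        by (simp_all add: total_rank_def excess_def)
      then show "total_rank I = card (Y - X) + total_rank I'" "excess I = card (Y - X) - 1 + excess I'"
        using s by simp_all
    qed
    have fsp: "finite sp.Z" "finite sp.c" "X \<subset> sp.c"
      using fY i finite_subset[of X Y] by (auto simp: sp.Z_def sp.c_def)
    have base: "\<exists>\<theta>::nat \<Rightarrow> ('v set, 'k) mpoly. good V (total_rank I) (int (excess I) - 1) (int (excess I) - 1) N (flag (sp.W {}) (sp.R {})) \<theta>"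
    proof -
      let ?J = "{(X, sp.Z), (X, sp.c)}"
      have ne: "sp.Z \<noteq> sp.c" using sp.ivs(6,7) by blast
      have VJ: "join_vertices ?J = interval X sp.Z \<union> {sp.c}" by (simp add: join_vertices_def sp.interval_to_c)
      have c: "sp.c \<notin> interval X sp.Z" using sp.ivs(4,7) by blast
      have okJ: "join_ok ?J"
        unfolding join_ok_def using fsp ne c XZ sp.interval_to_c by (auto simp: sp.Z_def)
      have JY: "join_vertices ?J \<subseteq> interval X Y" unfolding VJ using sp.ivs(1,2) by blast
      then have "join_vertices ?J \<inter> join_vertices I' = {}" using dis by blast
      note ok = join_ok_Un[OF okJ okI' this]
      have "finite ?J" by simp
      note s = sums_Un[OF this fin' ok(2)]
      have J: "total_rank ?J = card (Y - X)" "excess ?J + 1 = card (Y - X) - 1"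
        using ne cc cZ cY by (simp_all add: total_rank_def excess_def)
      have t: "total_rank (?J \<union> I') = total_rank I" and e: "int (excess (?J \<union> I')) = int (excess I) - 1"
        using s J sI by simp_all
      have "\<exists>\<theta>::nat \<Rightarrow> ('v set, 'k) mpoly. good V (total_rank (?J \<union> I')) (int (excess (?J \<union> I'))) (int (excess (?J \<union> I'))) N
          (flag (join_vertices (?J \<union> I')) (comparable_in (?J \<union> I'))) \<theta>"
      proof (rule less(1)[OF _ ok(1)])
        show "join_vertices (?J \<union> I') \<subseteq> V" unfolding join_vertices_Un using JY VV by blast
      qed (use e less(4) in linarith)+
      then show ?thesis unfolding sp.flag_start[OF refl refl] e t .
    qed
    have links: "\<exists>\<theta>::nat \<Rightarrow> ('v set, 'k) mpoly. good V (total_rank I) (int (excess I) - 2) (int (excess I) - 2) N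
        (flag (interval X F \<union> {sp.c} \<union> interval (insert i F) Y \<union> join_vertices I') (sp.R U)) \<theta>"
      if F: "F \<in> interval X sp.Z" "F \<noteq> sp.Z" and U: "sp.upset U" "F \<notin> U" for F U
    proof -
      let ?J = "{(X, F), (X, sp.c), (insert i F, Y)}"
      have FZ: "F \<subseteq> sp.Z" "X \<subset> F" using sp.ivs(5,9)[OF F(1)] .
      have iF: "i \<notin> F" by (rule sp.ivs(4)[OF F(1)])
      have fF: "finite F" using FZ fsp finite_subset by blast
      have FY: "insert i F \<subset> Y" using FZ F(2) i by (auto simp: sp.Z_def)
      have ne: "(X, F) \<noteq> (X, sp.c)" "(X, F) \<noteq> (insert i F, Y)" "(X, sp.c) \<noteq> (insert i F, Y)"
        using sp.interval_c[OF F(1)] i by auto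
      have VJ: "join_vertices ?J = interval X F \<union> {sp.c} \<union> interval (insert i F) Y" by (auto simp: join_vertices_def sp.interval_to_c)
      have d: "sp.c \<notin> interval X F" "sp.c \<notin> interval (insert i F) Y" "interval X F \<inter> interval (insert i F) Y = {}"
        using sp.interval_c[OF F(1)] iF sp.ivs(7) by (auto simp: interval_def)
      have okJ: "join_ok ?J"
        unfolding join_ok_def using fsp fF fY FZ FY d sp.interval_to_c by auto
      have JY: "join_vertices ?J \<subseteq> interval X Y"
        unfolding VJ using sp.ivs(2) FZ FY by (auto simp: interval_def sp.Z_def)
      then have "join_vertices ?J \<inter> join_vertices I' = {}" using dis by blast
      note ok = join_ok_Un[OF okJ okI' this]
      have "finite ?J" by simp
      note s = sums_Un[OF this fin' ok(2)]
      have c1: "card (F - X) + card (Y - insert i F) + 1 = card (Y - X)"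
      proof -
        have "Y - X = insert i ((F - X) \<union> (Y - insert i F))" using FZ FY i by (auto simp: sp.Z_def)
        moreover have "i \<notin> (F - X) \<union> (Y - insert i F)" using iF by auto
        moreover have "card ((F - X) \<union> (Y - insert i F)) = card (F - X) + card (Y - insert i F)"
          by (rule card_Un_disjoint) (use fF fY in auto)
        ultimately show ?thesis using fF fY by simp
      qed
      have c2: "card (F - X) \<ge> 1" "card (Y - insert i F) \<ge> 1"
        using FZ FY fF fY by (auto simp: Suc_le_eq card_gt_0_iff)
      \<comment> \<open>The vertex \<open>i\<close> is the rank of the point factor, which has no
        excess; the other two factors have ranks adding up to \<open>card (Y - X) - 1\<close> and
        lose one each.\<close>
      have J: "total_rank ?J = card (Y - X)" "excess ?J + 2 = card (Y - X) - 1"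
        using ne cc c1 c2 by (simp_all add: total_rank_def excess_def)
      have t: "total_rank (?J \<union> I') = total_rank I" and e: "int (excess (?J \<union> I')) = int (excess I) - 2"
        using s J sI by simp_all
      have "\<exists>\<theta>::nat \<Rightarrow> ('v set, 'k) mpoly. good V (total_rank (?J \<union> I')) (int (excess (?J \<union> I'))) (int (excess (?J \<union> I'))) N
          (flag (join_vertices (?J \<union> I')) (comparable_in (?J \<union> I'))) \<theta>"
      proof (rule less(1)[OF _ ok(1)])
        show "join_vertices (?J \<union> I') \<subseteq> V" unfolding join_vertices_Un using JY VV by blast
      qed (use e less(4) in linarith)+
      then show ?thesis unfolding sp.flag_link[OF refl refl U(1) F(1) U(2)] e t .
    qed
    have "\<exists>\<theta>::nat \<Rightarrow> ('v set, 'k) mpoly. good V (total_rank I) (int (excess I)) (int (excess I)) N (flag (sp.W (interval X sp.Z)) (sp.R (interval X sp.Z))) \<theta>"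
      by (rule sp.full_complex[OF inf V less(4) _ base links]) auto
    then show ?thesis unfolding sp.flag_full[OF refl refl] II[symmetric] .
  qed
qed

section \<open>Shellings\<close>

lemma sd_Pow: "sd (Pow F) = flag (interval {} F) (\<lambda>H K. H \<subseteq> K \<or> K \<subseteq> H)"
proof -
  have "interval {} F = Pow F - {{}}" by (auto simp: interval_def)
  then show ?thesis unfolding sd_def flag_def by (intro Collect_cong conj_cong) (simp, blast)
qed

text \<open>The empty simplex is separate, because there \<open>s = -1\<close> while the excess is
  0; a Lefschetz condition with \<open>s = -1\<close> only concerns negative degrees. The top degree
  is relaxed to \<open>card F\<close>, the bound that glueing preserves.\<close>

lemma good_sd_simplex:
  assumes inf: "infinite (UNIV :: 'k::field set)" and V: "finite V" "Pow F \<subseteq> V" and F: "finite F" and N: "int (card F) < N"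
  shows "\<exists>\<theta>::nat \<Rightarrow> ('v set, 'k) mpoly. good V (card F) (int (card F) - 1) (int (card F)) N (sd (Pow F)) \<theta>"
proof (cases "F = {}")
  case True
  have ok: "join_ok {}" "join_vertices {} \<subseteq> V" by (simp_all add: join_ok_def join_vertices_def)
  have s: "total_rank {} = 0" "excess {} = 0" by (simp_all add: total_rank_def excess_def)
  have "flag (join_vertices {}) (comparable_in {}) = sd (Pow F)"
    using True unfolding join_vertices_def by (auto simp: flag_def sd_def)
  then obtain \<theta> :: "nat \<Rightarrow> ('v set, 'k) mpoly" where g: "good V 0 0 0 N (sd (Pow F)) \<theta>"
    using good_join[OF inf V(1) ok, of N] N unfolding s by auto
  have "good V 0 (- 1) 0 N (sd (Pow F)) \<theta>"
    unfolding good_def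
  proof (intro conjI allI impI ballI)
    fix i m and f :: "('v set, 'k) mpoly" assume *: "2 * i + int m = - 1" "f \<in> forms V i"
    then have "i < 0" by simp
    then show "f \<in> SRT V (sd (Pow F)) \<theta> 0 i" using *(2) by (rule SRT_neg)
  qed (use goodD[OF g] in auto)
  then show ?thesis using True by auto
next
  case False
  have ok: "join_ok {({}, F)}" "join_vertices {({}, F)} \<subseteq> V" using F False V(2) by (auto simp: join_ok_def join_vertices_def interval_def)
  have c: "card F \<ge> 1" using False F by (simp add: Suc_le_eq card_gt_0_iff)
  have s: "total_rank {({}, F)} = card F" "excess {({}, F)} = card F - 1" by (simp_all add: total_rank_def excess_def)
  have s': "int (card F - 1) = int (card F) - 1" using c by simp
  have "flag (join_vertices {({}, F)}) (comparable_in {({}, F)}) = sd (Pow F)"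
    unfolding sd_Pow by (rule flag_cong) (auto simp: join_vertices_def comparable_in_def)
  then obtain \<theta> :: "nat \<Rightarrow> ('v set, 'k) mpoly" where g: "good V (card F) (int (card F) - 1) (int (card F) - 1) N (sd (Pow F)) \<theta>"
    using good_join[OF inf V(1) ok, of N] N c unfolding s s' by auto
  then have "good V (card F) (int (card F) - 1) (int (card F)) N (sd (Pow F)) \<theta>" unfolding good_def by auto
  then show ?thesis by (intro exI[of _ \<theta>])
qed

lemma sd_Int: "sd (A \<inter> B) = sd A \<inter> sd B"
  unfolding sd_def by blast

lemma sd_mono: "A \<subseteq> B \<Longrightarrow> sd A \<subseteq> sd B"
  unfolding sd_def by blast

lemma down_closed_sd: "down_closed (sd A)"
  unfolding down_closed_def sd_def by blast

lemma chain_has_top: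
  assumes "finite C" "C \<noteq> {}" "\<forall>F\<in>C. \<forall>G\<in>C. F \<subseteq> G \<or> G \<subseteq> F"
  shows "\<exists>T\<in>C. \<forall>F\<in>C. F \<subseteq> T"
  using assms
proof (induction C rule: finite_ne_induct)
  case (insert F C)
  then obtain T where T: "T \<in> C" "\<forall>F\<in>C. F \<subseteq> T" by blast
  then consider "F \<subseteq> T" | "T \<subseteq> F" using insert.prems by blast
  then show ?case
  proof cases
    case 1 then show ?thesis using T by blast
  next
    case 2 then show ?thesis using T by blast
  qed
qed simp

text \<open>A nonempty chain lies in whichever of the two complexes contains its largest
  member.\<close>

lemma sd_Un:
  assumes "down_closed A" "down_closed B" "finite A" "finite B"
  shows "sd (A \<union> B) = sd A \<union> sd B"
proof
  show "sd (A \<union> B) \<subseteq> sd A \<union> sd B"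
  proof
    fix C assume C: "C \<in> sd (A \<union> B)"
    show "C \<in> sd A \<union> sd B"
    proof (cases "C = {}")
      case False
      have "finite C" using C assms(3,4) finite_subset[of C "A \<union> B"] by (auto simp: sd_def)
      then obtain T where T: "T \<in> C" "\<forall>F\<in>C. F \<subseteq> T" using chain_has_top[OF _ False] C by (auto simp: sd_def)
      then have "T \<in> A \<or> T \<in> B" using C by (auto simp: sd_def)
      then have "C \<subseteq> A \<or> C \<subseteq> B" using T(2) assms(1,2) unfolding down_closed_def by blast
      then show ?thesis using C by (auto simp: sd_def)
    qed (auto simp: sd_def)
  qed
  show "sd A \<union> sd B \<subseteq> sd (A \<union> B)" using sd_mono by blast
qed

definition attaches :: "nat \<Rightarrow> 'v set set \<Rightarrow> 'v set \<Rightarrow> bool" where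
  "attaches d S F \<longleftrightarrow> (\<exists>\<G>. \<G> \<noteq> {} \<and> (\<forall>G\<in>\<G>. G \<subseteq> F \<and> card G + 1 = d) \<and>
     gen_complex {F} \<inter> gen_complex S = gen_complex \<G>)"

text \<open>Phrased for lists of sets of one given size, so that the intersections met along a
  shelling are instances in size \<open>d - 1\<close>.\<close>

definition shelling :: "nat \<Rightarrow> 'v set list \<Rightarrow> bool" where
  "shelling d Fs \<longleftrightarrow> Fs \<noteq> [] \<and> (\<forall>F\<in>set Fs. finite F \<and> card F = d) \<and>
     (\<forall>k. 1 \<le> k \<and> k < length Fs \<longrightarrow> attaches d (set (take k Fs)) (Fs ! k))"

lemma down_closed_gen: "down_closed (gen_complex S)"
  unfolding down_closed_def gen_complex_def by blast

lemma finite_gen: "finite S \<Longrightarrow> (\<And>F. F \<in> S \<Longrightarrow> finite F) \<Longrightarrow> finite (gen_complex S)"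
  unfolding gen_complex_def by auto

text \<open>Distinct codimension one faces of a simplex meet in codimension two, so any order works.\<close>

lemma shelling_codim_one_faces:
  assumes F: "finite F" "card F = Suc d" and Gs: "distinct Gs" "Gs \<noteq> []" "\<And>G. G \<in> set Gs \<Longrightarrow> G \<subseteq> F \<and> card G = d"
  shows "shelling d Gs"
  unfolding shelling_def
proof (intro conjI ballI allI impI)
  show "finite G" "card G = d" if "G \<in> set Gs" for G using Gs(3)[OF that] F finite_subset by auto
  fix k assume k: "1 \<le> k \<and> k < length Gs"
  define \<G> where "\<G> = (\<lambda>j. Gs ! k \<inter> Gs ! j) ` {..<k}"
  have c: "card (Gs ! k \<inter> Gs ! j) + 1 = d" if "j < k" for j
  proof -
    have in': "Gs ! k \<in> set Gs" "Gs ! j \<in> set Gs" using that k by auto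
    note m = Gs(3)[OF in'(1)] Gs(3)[OF in'(2)]
    have fin: "finite (Gs ! k)" "finite (Gs ! j)" using m F(1) finite_subset by auto
    have ne: "Gs ! k \<noteq> Gs ! j" using that k Gs(1) by (simp add: nth_eq_iff_index_eq)
    have u: "card (Gs ! k \<union> Gs ! j) \<le> Suc d" using m F card_mono[of F "Gs ! k \<union> Gs ! j"] by auto
    have "card (Gs ! k \<union> Gs ! j) \<noteq> d"
    proof
      assume a: "card (Gs ! k \<union> Gs ! j) = d"
      have "Gs ! k = Gs ! k \<union> Gs ! j" by (rule card_subset_eq) (use a m fin in simp_all)
      moreover have "Gs ! j = Gs ! k \<union> Gs ! j" by (rule card_subset_eq) (use a m fin in simp_all)
      ultimately show False using ne by simp
    qed
    moreover have "card (Gs ! k \<union> Gs ! j) \<ge> d" using card_mono[of "Gs ! k \<union> Gs ! j" "Gs ! k"] fin m by auto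
    moreover have "card (Gs ! k) + card (Gs ! j) = card (Gs ! k \<union> Gs ! j) + card (Gs ! k \<inter> Gs ! j)"
      by (rule card_Un_Int[OF fin])
    ultimately show ?thesis using u m by linarith
  qed
  have st: "set (take k Gs) = (\<lambda>j. Gs ! j) ` {..<k}"
    using k nth_image[of k Gs] by (simp add: atLeast0LessThan)
  have "gen_complex {Gs ! k} \<inter> gen_complex (set (take k Gs)) = gen_complex \<G>"
    unfolding st \<G>_def gen_complex_def by auto
  moreover have "0 \<in> {..<k}" using k by simp
  then have "\<G> \<noteq> {}" unfolding \<G>_def by blast
  moreover have "\<forall>G\<in>\<G>. G \<subseteq> Gs ! k \<and> card G + 1 = d" using c by (auto simp: \<G>_def)
  ultimately show "attaches d (set (take k Gs)) (Gs ! k)" unfolding attaches_def by (intro exI[of _ \<G>] conjI)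
qed (use Gs in auto)

text \<open>An outer induction on \<open>d\<close> supplies the intersections and an inner one the
  initial segments of the list. The three good choices obtained separately are replaced by a common
  one through \<open>generic_conj\<close> before glueing.\<close>

theorem good_shelling:
  assumes inf: "infinite (UNIV :: 'k::field set)" and V: "finite V" and N: "int d < N"
    and sh: "shelling d Fs" and FV: "gen_complex (set Fs) \<subseteq> V"
  shows "\<exists>\<theta>::nat \<Rightarrow> ('v set, 'k) mpoly. good V d (int d - 1) (int d) N (sd (gen_complex (set Fs))) \<theta>"
  using N sh FV
proof (induction d arbitrary: Fs rule: less_induct)
  case (less d)
  note IHd = less.IH and Nd = less.prems(1)
  show ?case using less.prems(2,3)
  proof (induction Fs rule: rev_induct)
    case Nil
    then show ?case by (simp add: shelling_def)
  next
    case (snoc F Fs)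
    have F: "finite F" "card F = d" using snoc(2) by (auto simp: shelling_def)
    have genF: "gen_complex {F} = Pow F" by (simp add: gen_complex_def)
    have gen: "gen_complex (set (Fs @ [F])) = gen_complex (set Fs) \<union> Pow F" by (auto simp: gen_complex_def)
    have PV: "Pow F \<subseteq> V" "gen_complex (set Fs) \<subseteq> V" using snoc(3) gen by auto
    have "int (card F) < N" using F(2) Nd by simp
    from good_sd_simplex[OF inf V PV(1) F(1) this]
    have gF: "\<exists>\<theta>::nat \<Rightarrow> ('v set, 'k) mpoly. good V d (int d - 1) (int d) N (sd (Pow F)) \<theta>" unfolding F(2) .
    show ?case
    proof (cases "Fs = []")
      case True
      then show ?thesis using gF by (simp add: gen_complex_def)
    next
      case False
      have shFs: "shelling d Fs"
        unfolding shelling_def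
      proof (intro conjI allI impI)
        show "Fs \<noteq> []" by fact
        show "\<forall>F\<in>set Fs. finite F \<and> card F = d" using snoc(2) by (auto simp: shelling_def)
        fix k assume k: "1 \<le> k \<and> k < length Fs"
        have "(Fs @ [F]) ! k = Fs ! k" "take k (Fs @ [F]) = take k Fs" using k by (auto simp: nth_append)
        moreover have "1 \<le> k \<and> k < length (Fs @ [F])" using k by simp
        ultimately show "attaches d (set (take k Fs)) (Fs ! k)" using snoc(2) unfolding shelling_def by metis
      qed
      have g1: "\<exists>\<theta>::nat \<Rightarrow> ('v set, 'k) mpoly. good V d (int d - 1) (int d) N (sd (gen_complex (set Fs))) \<theta>"
        by (rule snoc.IH[OF shFs PV(2)])
      have "1 \<le> length Fs \<and> length Fs < length (Fs @ [F])" using False by (simp add: Suc_le_eq)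
      then have "attaches d (set (take (length Fs) (Fs @ [F]))) ((Fs @ [F]) ! length Fs)"
        using snoc(2) unfolding shelling_def by blast
      then have "attaches d (set Fs) F" by simp
      from this[unfolded attaches_def genF] obtain \<G> where G: "\<G> \<noteq> {}" "\<forall>G\<in>\<G>. G \<subseteq> F \<and> card G + 1 = d"
        "Pow F \<inter> gen_complex (set Fs) = gen_complex \<G>" by (elim exE conjE)
      obtain d' where d': "d = Suc d'" using G(1,2) by (cases d) auto
      have finG: "finite \<G>" using G(2) F(1) finite_subset[of \<G> "Pow F"] by auto
      obtain Gs where Gs: "set Gs = \<G>" "distinct Gs" using finite_distinct_list[OF finG] by blast
      have shG: "shelling d' Gs"
        by (rule shelling_codim_one_faces[OF F(1) _ Gs(2)]) (use F(2) d' G Gs(1) in auto)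
      have "gen_complex (set Gs) \<subseteq> V" using G(3) PV Gs(1) by blast
      from IHd[of d' Gs, OF _ _ shG this] have g0: "\<exists>\<theta>::nat \<Rightarrow> ('v set, 'k) mpoly. good V d' (int d' - 1) (int d') N (sd (gen_complex \<G>)) \<theta>"
        using Nd d' Gs(1) by simp
      let ?A = "sd (gen_complex (set Fs))" and ?B = "sd (Pow F)"
      have fins: "finite (gen_complex (set Fs))" "finite (Pow F)"
        using shFs F(1) by (auto simp: shelling_def intro: finite_gen)
      have dP: "down_closed (Pow F)" by (auto simp: down_closed_def)
      have un: "sd (gen_complex (set (Fs @ [F]))) = ?A \<union> ?B"
        unfolding gen by (rule sd_Un[OF down_closed_gen dP fins])
      have it: "sd (gen_complex \<G>) = ?A \<inter> ?B" unfolding G(3)[symmetric] sd_Int by blast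
      have n1: "generic V (good V d (int d - 1) (int d) N ?A :: (nat \<Rightarrow> ('v set, 'k) mpoly) \<Rightarrow> bool)"
        by (rule generic_good[OF V down_closed_sd _ _ _ g1]) (use Nd in auto)
      have n2: "generic V (good V d (int d - 1) (int d) N ?B :: (nat \<Rightarrow> ('v set, 'k) mpoly) \<Rightarrow> bool)"
        by (rule generic_good[OF V down_closed_sd _ _ _ gF]) (use Nd in auto)
      have n0: "generic V (good V d' (int d' - 1) (int d') N (sd (gen_complex \<G>)) :: (nat \<Rightarrow> ('v set, 'k) mpoly) \<Rightarrow> bool)"
        by (rule generic_good[OF V down_closed_sd _ _ _ g0]) (use Nd d' in auto)
      from generic_ex[OF generic_conj[OF inf generic_conj[OF inf n1 n2] n0]]
      obtain \<theta> :: "nat \<Rightarrow> ('v set, 'k) mpoly" where t: "good V d (int d - 1) (int d) N ?A \<theta>" "good V d (int d - 1) (int d) N ?B \<theta>"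
        "good V d' (int d' - 1) (int d') N (sd (gen_complex \<G>)) \<theta>" by (elim exE conjE)
      have e: "int d - 1 = int d'" "int d = int d' + 1" by (simp_all add: d')
      have "good V (Suc d') (int d') (int d' + 1) N (?A \<union> ?B) \<theta>"
        by (rule good_glue[OF t(1)[unfolded e(1), unfolded e(2), unfolded d'] t(2)[unfolded e(1), unfolded e(2), unfolded d'] t(3)[unfolded it] down_closed_sd down_closed_sd]) (use Nd d' in simp)
      then have "good V d (int d - 1) (int d) N (sd (gen_complex (set (Fs @ [F])))) \<theta>" unfolding un e(1) unfolding e(2) unfolding d' .
      then show ?thesis by (intro exI[of _ \<theta>])
    qed
  qed
qed

section \<open>The ungraded ideal\<close>

lemma ideal_gen_0: "0 \<in> ideal_gen S"
  unfolding ideal_gen_def by (rule CollectI, rule exI[of _ "{}"]) simp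

lemma ideal_gen_mem: "s \<in> S \<Longrightarrow> c * s \<in> ideal_gen S"
  unfolding ideal_gen_def by (rule CollectI, rule exI[of _ "{s}"], rule exI[of _ "\<lambda>_. c"]) simp

lemma ideal_gen_add:
  assumes "f \<in> ideal_gen S" "g \<in> ideal_gen S"
  shows "f + g \<in> ideal_gen S"
proof -
  obtain T c where f: "f = (\<Sum>s\<in>T. c s * s)" "finite T" "T \<subseteq> S" using assms(1) unfolding ideal_gen_def by auto
  obtain U d where g: "g = (\<Sum>s\<in>U. d s * s)" "finite U" "U \<subseteq> S" using assms(2) unfolding ideal_gen_def by auto
  have "f = (\<Sum>s\<in>T \<union> U. (if s \<in> T then c s else 0) * s)"
    unfolding f(1) by (rule sum.mono_neutral_cong_left) (use f g in auto)
  moreover have "g = (\<Sum>s\<in>T \<union> U. (if s \<in> U then d s else 0) * s)"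
    unfolding g(1) by (rule sum.mono_neutral_cong_left) (use f g in auto)
  ultimately have "f + g = (\<Sum>s\<in>T \<union> U. ((if s \<in> T then c s else 0) + (if s \<in> U then d s else 0)) * s)"
    by (simp only: sum.distrib[symmetric] distrib_right)
  then show ?thesis unfolding ideal_gen_def
    by (intro CollectI exI[of _ "T \<union> U"] exI[of _ "\<lambda>s. (if s \<in> T then c s else 0) + (if s \<in> U then d s else 0)"])
      (use f g in simp)
qed

lemma ideal_gen_sum: "(\<And>x. x \<in> A \<Longrightarrow> f x \<in> ideal_gen S) \<Longrightarrow> (\<Sum>x\<in>A. f x) \<in> ideal_gen S"
  by (induction A rule: infinite_finite_induct) (auto intro: ideal_gen_0 ideal_gen_add)

section \<open>Homogeneous components and transfer to the ungraded ideal\<close>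

text \<open>Terms with a variable outside \<open>V\<close> are dropped as well: for a complex with
  faces inside \<open>V\<close> they belong to the nonface ideal.\<close>

definition component :: "'w set \<Rightarrow> int \<Rightarrow> ('w, 'k::field) mpoly \<Rightarrow> ('w, 'k) mpoly" where
  "component V i f = (\<Sum>m\<in>{m \<in> keys f. keys m \<subseteq> V \<and> int (mon_deg m) = i}. single m (lookup f m))"

lemma lookup_component: "lookup (component V i f) m = (if keys m \<subseteq> V \<and> int (mon_deg m) = i then lookup f m else 0)"
  by (auto simp: component_def lookup_sum lookup_single when_def in_keys_iff)

lemma component_forms: "component V i f \<in> forms V i"
  by (auto simp: forms_def in_keys_iff[of _ "component V i f"] lookup_component split: if_splits)

lemma component_add: "component V i (f + g) = component V i f + component V i g"
  by (rule poly_mapping_eqI) (simp add: lookup_component lookup_add)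

lemma component_zero [simp]: "component V i 0 = 0"
  by (rule poly_mapping_eqI) (simp add: lookup_component)

lemma component_sum: "component V i (\<Sum>x\<in>A. f x) = (\<Sum>x\<in>A. component V i (f x))"
  by (induction A rule: infinite_finite_induct) (simp_all add: component_add)

lemma component_eq: "f \<in> forms V i \<Longrightarrow> component V j f = (if i = j then f else 0)"
  by (rule poly_mapping_eqI) (auto simp: lookup_component forms_def in_keys_iff)

lemma component_outside:
  assumes "\<And>m. m \<in> keys f \<Longrightarrow> \<not> keys m \<subseteq> V" shows "component V i f = 0"
proof (rule poly_mapping_eqI)
  fix m show "lookup (component V i f) m = lookup 0 m"
    using assms[of m] by (auto simp: lookup_component in_keys_iff)
qed

lemma component_mult:
  assumes g: "g \<in> forms V k"
  shows "component V (i + k) (f * g) = component V i f * g"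
proof (induction f rule: poly_mapping_sum_induct)
  case (add m c f)
  have "component V (i + k) (single m c * g) = component V i (single m c) * g"
  proof (cases "keys m \<subseteq> V")
    case True
    then have s: "single m c \<in> forms V (int (mon_deg m))" by (simp add: forms_def)
    show ?thesis
      unfolding component_eq[OF s] component_eq[OF forms_mult[OF s g]] by simp
  next
    case False
    have "\<not> keys n \<subseteq> V" if n: "n \<in> keys (single m c * g)" for n
    proof -
      obtain a b where "a \<in> keys (single m c)" "n = a + b" using keys_mult'[OF n] by (elim exE conjE)
      then show ?thesis using False by (auto simp: keys_plus_nat split: if_splits)
    qed
    then have "component V (i + k) (single m c * g) = 0" by (rule component_outside)
    moreover have "component V i (single m c) = 0" by (rule component_outside) (use False in \<open>auto split: if_splits\<close>)
    ultimately show ?thesis by simp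
  qed
  then show ?case using add(2) by (simp only: distrib_right component_add)
qed simp

lemma nonface_ideal:
  fixes f :: "('w, 'k::field) mpoly"
  assumes "\<And>m. m \<in> keys f \<Longrightarrow> keys m \<notin> \<Gamma>"
  shows "f \<in> SR_Theta_ideal \<Gamma> \<Theta>"
proof -
  have "(\<Sum>m\<in>keys f. single m (lookup f m)) \<in> SR_Theta_ideal \<Gamma> \<Theta>"
    unfolding SR_Theta_ideal_def
  proof (rule ideal_gen_sum)
    fix m assume "m \<in> keys f"
    then have "single m 1 \<in> {single m 1 |m. keys m \<notin> \<Gamma>} \<union> set \<Theta>" using assms by blast
    from ideal_gen_mem[OF this, of "const (lookup f m)"]
    show "single m (lookup f m) \<in> ideal_gen ({single m 1 |m. keys m \<notin> \<Gamma>} \<union> set \<Theta>)"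
      unfolding single_split[symmetric] .
  qed
  then show ?thesis unfolding poly_expand[symmetric] .
qed

lemma SRT_ideal:
  assumes "set \<Theta> \<supseteq> \<theta> ` {..<D}"
  shows "j \<le> D \<Longrightarrow> f \<in> SRT V \<Gamma> \<theta> j i \<Longrightarrow> f \<in> SR_Theta_ideal \<Gamma> \<Theta>"
proof (induction j arbitrary: f)
  case 0
  then show ?case by (intro nonface_ideal) (auto simp: SR_def)
next
  case (Suc j)
  then obtain e p where *: "f = e + \<theta> j * p" "e \<in> SRT V \<Gamma> \<theta> j i" by auto
  have "\<theta> j \<in> \<theta> ` {..<D}" using Suc.prems(1) by simp
  then have "\<theta> j \<in> {single m 1 |m. keys m \<notin> \<Gamma>} \<union> set \<Theta>" using assms by blast
  from ideal_gen_mem[OF this, of p] have "\<theta> j * p \<in> SR_Theta_ideal \<Gamma> \<Theta>" by (simp add: SR_Theta_ideal_def mult.commute)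
  then show ?case using Suc.IH[OF _ *(2)] Suc.prems(1) unfolding *(1) SR_Theta_ideal_def by (intro ideal_gen_add) simp_all
qed

text \<open>The ideal has homogeneous generators, so the component of a combination can be taken
  summand by summand; a multiple of \<open>\<theta> j\<close> keeps \<open>\<theta> j\<close> and
  the component of its multiplier one degree lower.\<close>

lemma ideal_SRT:
  fixes \<theta> :: "nat \<Rightarrow> ('w, 'k::field) mpoly"
  assumes dc: "down_closed \<Gamma>" and lin: "\<And>l. \<theta> l \<in> forms V 1" and f: "f \<in> SR_Theta_ideal \<Gamma> (map \<theta> [0..<D])"
  shows "component V i f \<in> SRT V \<Gamma> \<theta> D i"
proof -
  obtain T c where f: "f = (\<Sum>s\<in>T. c s * s)" "T \<subseteq> {single m 1 | m. keys m \<notin> \<Gamma>} \<union> set (map \<theta> [0..<D])"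
    using f unfolding SR_Theta_ideal_def ideal_gen_def by auto
  have "component V i (c s * s) \<in> SRT V \<Gamma> \<theta> D i" if "s \<in> T" for s
  proof -
    from that f(2) consider m where "s = single m 1" "keys m \<notin> \<Gamma>" | j where "j < D" "s = \<theta> j" by auto
    then show ?thesis
    proof cases
      case 1
      have "keys n \<notin> \<Gamma>" if "n \<in> keys (component V i (c s * s))" for n
      proof -
        have "n \<in> keys (c s * s)" using that by (auto simp: in_keys_iff lookup_component split: if_splits)
        from keys_mult'[OF this] obtain a b where "b \<in> keys s" "n = a + b" by (elim exE conjE)
        then have "keys m \<subseteq> keys n" using 1(1) by (simp add: keys_plus_nat)
        then show ?thesis using 1(2) dc unfolding down_closed_def by blast
      qed
      then have "component V i (c s * s) \<in> SR V \<Gamma> i" using component_forms by (simp add: SR_def)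
      then show ?thesis by (rule SRT_SR)
    next
      case 2
      have "component V i (c s * s) = \<theta> j * component V (i - 1) (c s)"
        using component_mult[OF lin[of j], of "i - 1" "c s"] 2(2) by (simp add: mult.commute)
      then have "component V i (c s * s) \<in> SRT V \<Gamma> \<theta> (Suc j) i"
        using SRT_theta[OF component_forms[of V "i - 1" "c s"], of \<theta> j \<Gamma>] by (simp only:)
      moreover have "Suc j \<le> D" using 2(1) by simp
      ultimately show ?thesis using SRT_mono by blast
    qed
  qed
  then have "(\<Sum>s\<in>T. component V i (c s * s)) \<in> SRT V \<Gamma> \<theta> D i"
    by (induction T rule: infinite_finite_induct) (auto intro: SRT_add)
  then show ?thesis unfolding f(1) component_sum .
qed

text \<open>Monomials on \<open>V\<close> of degree at most \<open>w\<close> span the quotient: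
  those of larger degree vanish by goodness, those leaving \<open>V\<close> are nonfaces.\<close>

lemma good_max_lsop:
  fixes \<theta> :: "nat \<Rightarrow> ('w, 'k::field) mpoly"
  assumes g: "good V D s w N \<Gamma> \<theta>" and V: "finite V" and G: "\<And>F. F \<in> \<Gamma> \<Longrightarrow> F \<subseteq> V" and dim: "sc_dim \<Gamma> + 1 = int D"
  shows "max_lsop \<Gamma> (map \<theta> [0..<D])"
  unfolding max_lsop_def
proof (intro conjI)
  show "int (length (map \<theta> [0..<D])) = sc_dim \<Gamma> + 1" using dim by simp
  show "\<forall>\<theta>'\<in>set (map \<theta> [0..<D]). homogeneous_of 1 \<theta>'"
    using good_lin[OF g] by (auto simp: homogeneous_of_def forms_def)
  have sub: "\<theta> ` {..<D} \<subseteq> set (map \<theta> [0..<D])" by (simp add: lessThan_atLeast0)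
  define M where "M = {m :: 'w \<Rightarrow>\<^sub>0 nat. keys m \<subseteq> V \<and> mon_deg m \<le> nat w}"
  define B where "B = (\<lambda>m. single m (1::'k)) ` M"
  have finM: "finite M" unfolding M_def by (rule finite_monomials[OF V])
  have inj: "inj_on (\<lambda>m. single m (1::'k)) M" by (rule inj_onI) (metis keys_single zero_neq_one the_elem_eq)
  \<comment> \<open>Each \<open>b\<close> is a single monomial, so the sum over
    \<open>keys b\<close> just reads off the coefficient of \<open>f\<close> there.\<close>
  have "f - (\<Sum>b\<in>B. const (\<Sum>m\<in>keys b. lookup f m) * b) \<in> SR_Theta_ideal \<Gamma> (map \<theta> [0..<D])" for f
  proof -
    define h where "h = f - (\<Sum>b\<in>B. const (\<Sum>m\<in>keys b. lookup f m) * b)"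
    have s: "(\<Sum>b\<in>B. const (\<Sum>m\<in>keys b. lookup f m) * b) = (\<Sum>m\<in>M. single m (lookup f m))"
      unfolding B_def sum.reindex[OF inj] by (simp add: single_split[symmetric])
    have h0: "m \<notin> M" if "m \<in> keys h" for m
    proof
      assume m: "m \<in> M"
      then have "lookup (\<Sum>m\<in>M. single m (lookup f m)) m = lookup f m"
        using finM by (simp add: lookup_sum lookup_single when_def)
      then show False using \<open>m \<in> keys h\<close> by (simp add: h_def s lookup_minus in_keys_iff)
    qed
    have "(\<Sum>m\<in>keys h. single m (lookup h m)) \<in> SR_Theta_ideal \<Gamma> (map \<theta> [0..<D])"
      unfolding SR_Theta_ideal_def
    proof (rule ideal_gen_sum, fold SR_Theta_ideal_def)
      fix m assume m: "m \<in> keys h"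
      show "single m (lookup h m) \<in> SR_Theta_ideal \<Gamma> (map \<theta> [0..<D])"
      proof (cases "keys m \<subseteq> V")
        case True
        then have "w < int (mon_deg m)" using h0[OF m] by (auto simp: M_def)
        moreover have "single m (lookup h m) \<in> forms V (int (mon_deg m))" using True by (simp add: forms_def)
        ultimately have "single m (lookup h m) \<in> SRT V \<Gamma> \<theta> D (int (mon_deg m))" using good_van[OF g] by blast
        then show ?thesis by (rule SRT_ideal[OF sub order_refl])
      next
        case False
        then show ?thesis using G by (intro nonface_ideal) (auto split: if_splits)
      qed
    qed
    then show ?thesis unfolding poly_expand[symmetric] h_def .
  qed
  then have "\<forall>f. \<exists>c. f - (\<Sum>b\<in>B. const (c b) * b) \<in> SR_Theta_ideal \<Gamma> (map \<theta> [0..<D])"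
    by (intro allI exI)
  moreover have "finite B" using finM by (simp add: B_def)
  ultimately show "\<exists>B. finite B \<and> (\<forall>f. \<exists>c. f - (\<Sum>b\<in>B. const (c b) * b) \<in> SR_Theta_ideal \<Gamma> (map \<theta> [0..<D]))"
    by (intro exI[of _ B] conjI)
qed

text \<open>An arbitrary homogeneous \<open>f\<close> is replaced by its component on
  \<open>V\<close>, which changes it only by nonface terms; the bound on \<open>i\<close> makes the
  exponent positive, so passing to \<open>nat\<close> loses nothing.\<close>

lemma good_lefschetz:
  fixes \<theta> :: "nat \<Rightarrow> ('w, 'k::field) mpoly"
  assumes g: "good V D s w N \<Gamma> \<theta>" and G: "\<And>F. F \<in> \<Gamma> \<Longrightarrow> F \<subseteq> V" and dc: "down_closed \<Gamma>"
  shows "lefschetz_element s \<Gamma> (map \<theta> [0..<D]) (\<theta> D)"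
  unfolding lefschetz_element_def
proof (intro conjI allI impI)
  note lin = good_lin[OF g]
  have sub: "\<theta> ` {..<D} \<subseteq> set (map \<theta> [0..<D])" by (simp add: lessThan_atLeast0)
  show "homogeneous_of 1 (\<theta> D)" using lin[of D] by (auto simp: homogeneous_of_def forms_def)
  fix i :: nat and f
  assume i: "int i \<le> (s - 1) div 2" and f: "homogeneous_of i f"
    and *: "\<theta> D ^ nat (s - 2 * int i) * f \<in> SR_Theta_ideal \<Gamma> (map \<theta> [0..<D])"
  define m where "m = nat (s - 2 * int i)"
  have m: "2 * int i + int m = s" using i by (simp add: m_def)
  have "\<theta> D ^ m \<in> forms V (int m)" using forms_power[OF lin[of D], of m] by simp
  from component_mult[OF this, of "int i" f]
  have "component V (int i + int m) (\<theta> D ^ m * f) = \<theta> D ^ m * component V (int i) f" by (simp add: mult.commute)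
  moreover have "component V (int i + int m) (\<theta> D ^ m * f) \<in> SRT V \<Gamma> \<theta> D (int i + int m)"
    by (rule ideal_SRT[OF dc lin]) (use * in \<open>simp add: m_def\<close>)
  ultimately have "\<theta> D ^ m * component V (int i) f \<in> SRT V \<Gamma> \<theta> D (int i + int m)" by simp
  from good_lef[OF g m component_forms this] have "component V (int i) f \<in> SR_Theta_ideal \<Gamma> (map \<theta> [0..<D])"
    by (rule SRT_ideal[OF sub order_refl])
  moreover have "f - component V (int i) f \<in> SR_Theta_ideal \<Gamma> (map \<theta> [0..<D])"
  proof (rule nonface_ideal)
    fix n assume n: "n \<in> keys (f - component V (int i) f)"
    have "\<not> keys n \<subseteq> V"
    proof
      assume "keys n \<subseteq> V"
      then have "lookup (f - component V (int i) f) n = (if mon_deg n = i then 0 else lookup f n)"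
        by (simp add: lookup_minus lookup_component)
      then show False using n f by (auto simp: in_keys_iff homogeneous_of_def split: if_splits)
    qed
    then show "keys n \<notin> \<Gamma>" using G by blast
  qed
  ultimately have "component V (int i) f + (f - component V (int i) f) \<in> SR_Theta_ideal \<Gamma> (map \<theta> [0..<D])"
    unfolding SR_Theta_ideal_def by (rule ideal_gen_add)
  then show "f \<in> SR_Theta_ideal \<Gamma> (map \<theta> [0..<D])" by simp
qed

section \<open>Dimension of the subdivision and the given shelling\<close>

text \<open>Cardinality is injective on a chain and takes values from 1 to \<open>d\<close>; the
  initial segments of an enumeration of \<open>F\<close> form a chain of length
  \<open>d\<close>.\<close>

lemma sc_dim_sd:
  assumes fin: "finite \<Delta>" and dc: "down_closed \<Delta>" and F: "F \<in> \<Delta>" "finite F" "card F = d" and max: "\<And>G. G \<in> \<Delta> \<Longrightarrow> finite G \<and> card G \<le> d"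
  shows "sc_dim (sd \<Delta>) = int d - 1"
proof -
  have "finite (sd \<Delta>)" by (rule finite_subset[of _ "Pow \<Delta>"]) (use fin in \<open>auto simp: sd_def\<close>)
  moreover have "card C \<le> d" if C: "C \<in> sd \<Delta>" for C
  proof -
    have inj: "inj_on card C"
    proof (rule inj_onI)
      fix G H assume GH: "G \<in> C" "H \<in> C" "card G = card H"
      then have "finite G" "finite H" "G \<subseteq> H \<or> H \<subseteq> G" using C max by (auto simp: sd_def)
      then show "G = H" using card_subset_eq[of H G] card_subset_eq[of G H] GH(3) by metis
    qed
    have "card ` C \<subseteq> {1..d}"
    proof
      fix n assume "n \<in> card ` C"
      then obtain G where G: "G \<in> C" "n = card G" by blast
      then have "G \<in> \<Delta>" "G \<noteq> {}" using C by (auto simp: sd_def)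
      then show "n \<in> {1..d}" using max[of G] G(2) by (simp add: Suc_le_eq card_gt_0_iff)
    qed
    then have "card (card ` C) \<le> card {1..d}" by (intro card_mono) auto
    then show ?thesis using card_image[OF inj] by simp
  qed
  moreover have "\<exists>C\<in>sd \<Delta>. card C = d"
  proof -
    obtain xs where xs: "set xs = F" "distinct xs" using finite_distinct_list[OF F(2)] by blast
    have len: "length xs = d" using distinct_card[OF xs(2)] xs(1) F(3) by simp
    define C where "C = (\<lambda>k. set (take k xs)) ` {1..d}"
    have ck: "card (set (take k xs)) = k" if "k \<in> {1..d}" for k
      using that len distinct_card[OF distinct_take[OF xs(2)], of k] by simp
    have "inj_on (\<lambda>k. set (take k xs)) {1..d}" by (rule inj_on_inverseI[of _ card]) (rule ck)
    then have "card C = d" unfolding C_def by (simp add: card_image)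
    moreover have "C \<in> sd \<Delta>"
      unfolding sd_def
    proof (intro CollectI conjI ballI)
      show "C \<subseteq> \<Delta> - {{}}"
      proof
        fix G assume "G \<in> C"
        then obtain k where k: "k \<in> {1..d}" "G = set (take k xs)" by (auto simp: C_def)
        have "G \<subseteq> F" using set_take_subset[of k xs] k(2) xs(1) by simp
        then have "G \<in> \<Delta>" using dc F(1) unfolding down_closed_def by blast
        moreover have "G \<noteq> {}" using ck[OF k(1)] k by auto
        ultimately show "G \<in> \<Delta> - {{}}" by simp
      qed
      fix G H assume "G \<in> C" "H \<in> C"
      then obtain k l where "G = set (take k xs)" "H = set (take l xs)" by (auto simp: C_def)
      then show "G \<subseteq> H \<or> H \<subseteq> G" using set_take_subset_set_take[of k l xs] set_take_subset_set_take[of l k xs] by (cases "k \<le> l") auto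
    qed
    ultimately show ?thesis by blast
  qed
  ultimately have "Max (card ` sd \<Delta>) = d" by (intro Max_eqI) auto
  then show ?thesis by (simp add: sc_dim_def)
qed

lemma facet_above:
  assumes "finite \<Delta>" "F \<in> \<Delta>" shows "\<exists>G\<in>facets \<Delta>. F \<subseteq> G"
proof -
  obtain G where G: "G \<in> \<Delta>" "F \<subseteq> G" "\<forall>H\<in>\<Delta>. G \<subseteq> H \<longrightarrow> G = H"
    using finite_has_maximal2[OF assms] by (elim bexE conjE)
  then have "G \<in> facets \<Delta>" by (auto simp: facets_def)
  then show ?thesis using G(2) by (rule bexI[rotated])
qed

text \<open>Purity makes all facets as large as the largest face, so the common size is
  \<open>d\<close>; a simplex is shelled by the list of its only facet.\<close>

lemma shellable_shelling:
  assumes sc: "simplicial_complex \<Delta>" and dim: "sc_dim \<Delta> = int d - 1" and sh: "shellable \<Delta>"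
  shows "\<exists>Fs. shelling d Fs \<and> \<Delta> = gen_complex (set Fs)"
proof -
  have fin: "finite \<Delta>" "\<Delta> \<noteq> {}" and finF: "\<And>F. F \<in> \<Delta> \<Longrightarrow> finite F" and down: "\<And>F G. F \<in> \<Delta> \<Longrightarrow> G \<subseteq> F \<Longrightarrow> G \<in> \<Delta>"
    using sc unfolding simplicial_complex_def by blast+
  have Md: "Max (card ` \<Delta>) = d" using dim by (simp add: sc_dim_def)
  have "Max (card ` \<Delta>) \<in> card ` \<Delta>" using fin by (intro Max_in) auto
  then obtain T where T: "T \<in> \<Delta>" "card T = d" unfolding Md by blast
  have le: "card G \<le> d" if "G \<in> \<Delta>" for G unfolding Md[symmetric] using fin that by (intro Max_ge) auto
  obtain T' where T': "T' \<in> facets \<Delta>" "T \<subseteq> T'" using facet_above[OF fin(1) T(1)] by blast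
  have "card T' = d"
    using T T' le[of T'] card_mono[OF finF[of T'] T'(2)] by (auto simp: facets_def)
  then have card_facet: "card F = d" if "F \<in> facets \<Delta>" for F
    using sh that T'(1) unfolding shellable_def pure_def by metis
  have gen: "\<Delta> = gen_complex (facets \<Delta>)"
  proof
    show "\<Delta> \<subseteq> gen_complex (facets \<Delta>)" using facet_above[OF fin(1)] unfolding gen_complex_def by blast
    show "gen_complex (facets \<Delta>) \<subseteq> \<Delta>" using down unfolding gen_complex_def facets_def by blast
  qed
  from sh consider F where "finite F" "\<Delta> = Pow F"
    | Fs where "distinct Fs" "set Fs = facets \<Delta>"
       "\<forall>i. 1 \<le> i \<and> i < length Fs \<longrightarrow>
            (\<exists>\<G>. \<G> \<noteq> {} \<and> (\<forall>G\<in>\<G>. G \<subseteq> Fs ! i \<and> card G + 1 = card (Fs ! i)) \<and>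
                 gen_complex {Fs ! i} \<inter> gen_complex (set (take i Fs)) = gen_complex \<G>)"
    unfolding shellable_def by blast
  then show ?thesis
  proof cases
    case 1
    have "F \<in> facets \<Delta>" using 1 by (auto simp: facets_def)
    then have "shelling d [F]" using 1(1) card_facet[of F] by (simp add: shelling_def)
    moreover have "\<Delta> = gen_complex (set [F])" using 1 by (simp add: gen_complex_def)
    ultimately show ?thesis by blast
  next
    case 2
    have cF: "card (Fs ! i) = d" if "i < length Fs" for i using that 2(2) card_facet nth_mem by metis
    have "shelling d Fs"
      unfolding shelling_def
    proof (intro conjI allI impI ballI)
      show "Fs \<noteq> []" using T'(1) 2(2) by auto
      show "finite F" "card F = d" if "F \<in> set Fs" for F
        using that 2(2) card_facet[of F] finF[of F] by (simp_all add: facets_def)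
      fix k assume k: "1 \<le> k \<and> k < length Fs"
      from 2(3)[rule_format, OF this] show "attaches d (set (take k Fs)) (Fs ! k)"
        unfolding attaches_def using cF k by simp
    qed
    then show ?thesis using gen 2(2) by metis
  qed
qed

theorem theorem1p1:
  fixes \<Delta> :: "'v set set" and d :: nat
  assumes "simplicial_complex \<Delta>"
    and "sc_dim \<Delta> = int d - 1"
    and "shellable \<Delta>"
    and "infinite (UNIV :: 'k::field set)"
  shows "almost_strong_lefschetz TYPE('k) (sd \<Delta>)"
proof -
  have fin: "finite \<Delta>" using assms(1) by (simp add: simplicial_complex_def)
  from shellable_shelling[OF assms(1-3)] obtain Fs where Fs: "shelling d Fs" "\<Delta> = gen_complex (set Fs)" by blast
  have dc: "down_closed \<Delta>" unfolding Fs(2) by (rule down_closed_gen)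
  \<comment> \<open>The variables are indexed by all of \<open>\<Delta>\<close>; the empty face is
    included, and its variable is a nonface of \<open>sd \<Delta>\<close>. The value
    \<open>N = d + 1\<close> is the smallest one above \<open>d\<close>.\<close>
  from good_shelling[OF assms(4) fin _ Fs(1), of "int d + 1"]
  obtain \<theta> :: "nat \<Rightarrow> ('v set, 'k) mpoly" where g: "good \<Delta> d (int d - 1) (int d) (int d + 1) (sd \<Delta>) \<theta>"
    using Fs(2) by auto
  have G: "F \<subseteq> \<Delta>" if "F \<in> sd \<Delta>" for F using that by (auto simp: sd_def)
  have dim: "sc_dim (sd \<Delta>) = int d - 1"
  proof -
    obtain F where "F \<in> set Fs" using Fs(1) by (cases Fs) (auto simp: shelling_def)
    then have F: "F \<in> \<Delta>" "finite F" "card F = d" using Fs by (auto simp: shelling_def gen_complex_def)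
    have "finite G \<and> card G \<le> d" if "G \<in> \<Delta>" for G
      using that Fs finite_subset card_mono by (fastforce simp: shelling_def gen_complex_def)
    from sc_dim_sd[OF fin dc F this] show ?thesis .
  qed
  have "max_lsop (sd \<Delta>) (map \<theta> [0..<d])" by (rule good_max_lsop[OF g fin G]) (simp_all add: dim)
  moreover have "lefschetz_element (sc_dim (sd \<Delta>)) (sd \<Delta>) (map \<theta> [0..<d]) (\<theta> d)"
    unfolding dim by (rule good_lefschetz[OF g G down_closed_sd])
  ultimately show ?thesis unfolding almost_strong_lefschetz_def s_lefschetz_def by blast
qed

end
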